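(* Let $d\ge1$, $r\in\mathbb N^*$, $s\ge0$. For $\alpha\in\mathbb R^d$, $c>0$ and $N$ large, let $D_N(\alpha,s,c)$ be the set of $k=(k_1,\dots,k_d)\in\mathbb Z^d\setminus\{0\}$ such that $|k|\le N$ and there exists $m\in\mathbb Z$ with $$\gcd(k_1,\dots,k_d,m)=1\quad\text{and}\quad|k|^d\,|\langle k,\alpha\rangle+m|\le\frac c{\ln N(\ln\ln N)^s}.$$ Call $\alpha$ $(r,s)$-approximable if for any $c>0$ one has $\mathrm{Card}(D_N(\alpha,s,c))\ge2r$ for infinitely many $N\in\mathbb N$. If $s\le1/r$, then the set of $(r,s)$-approximable vectors $\alpha\in\mathbb T^d$ has full measure. If $s>1/r$, then the set of $(r,s)$-approximable vectors has zero measure.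
   Context: $|k|=\sqrt{\sum k_i^2}$. The $(r,s)$-approximability of $\alpha$ depends only on $\alpha$ modulo $\mathbb Z^d$; measure is Lebesgue measure. *)

theory Defs
  imports "HOL-Analysis.Analysis"
begin

definition real_vec :: "int ^ 'n \<Rightarrow> real ^ 'n" where
  "real_vec k = (\<chi> i. real_of_int (k $ i))"

text \<open>
  The dimension \<open>d\<close> is \<open>CARD('n)\<close>, so that \<open>d \<ge> 1\<close> holds automatically.
  The right-hand side of the inequality is meaningful for \<open>N \<ge> 3\<close> only, where
  \<open>ln (ln N) > 0\<close>; smaller \<open>N\<close> do not affect the notion of approximability below.
\<close>

definition D_set :: "real ^ 'n \<Rightarrow> real \<Rightarrow> real \<Rightarrow> nat \<Rightarrow> (int ^ 'n) set" where
  "D_set \<alpha> s c N =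
    {k. k \<noteq> 0 \<and> norm (real_vec k) \<le> real N \<and>
        (\<exists>m::int. Gcd (insert m (range (\<lambda>i. k $ i))) = 1 \<and>
           norm (real_vec k) ^ CARD('n) * \<bar>real_vec k \<bullet> \<alpha> + real_of_int m\<bar>
             \<le> c / (ln (real N) * ln (ln (real N)) powr s))}"

definition approximable :: "nat \<Rightarrow> real \<Rightarrow> real ^ 'n \<Rightarrow> bool" where
  "approximable r s \<alpha> \<longleftrightarrow>
    (\<forall>c::real. c > 0 \<longrightarrow> infinite {N. card (D_set \<alpha> s c N) \<ge> 2 * r})"

text \<open>
  The torus \<open>\<real>\<^sup>d / \<int>\<^sup>d\<close> with its Lebesgue measure is represented by the fundamental
  domain \<open>[0,1)\<^sup>d\<close>; lemma \<open>approximable_shift\<close> shows that approximability is a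
  property of classes modulo \<open>\<int>\<^sup>d\<close>.
\<close>

definition torus :: "(real ^ 'n) measure" where
  "torus = lebesgue_on {\<alpha>. \<forall>i. 0 \<le> \<alpha> $ i \<and> \<alpha> $ i < 1}"

text \<open>Finiteness matters because \<^const>\<open>card\<close> is \<open>0\<close> on infinite sets.\<close>

lemma finite_D_set: "finite (D_set \<alpha> s c N)"
proof (rule finite_subset)
  let ?B = "{k :: int ^ 'a. \<forall>i. k $ i \<in> {- int N..int N}}"
  show "D_set \<alpha> s c N \<subseteq> ?B"
  proof
    fix k assume "k \<in> D_set \<alpha> s c N"
    then have n: "norm (real_vec k) \<le> real N" by (simp add: D_set_def)
    have "\<bar>real_of_int (k $ i)\<bar> \<le> real N" for i
      using component_le_norm_cart[of "real_vec k" i] n by (simp add: real_vec_def)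
    then have "\<bar>k $ i\<bar> \<le> int N" for i
      by (metis of_int_abs of_int_le_iff of_int_of_nat_eq)
    then show "k \<in> ?B" by (auto simp: abs_le_iff minus_le_iff)
  qed
  have "?B \<subseteq> vec_lambda ` (UNIV \<rightarrow>\<^sub>E {- int N..int N})"
  proof
    fix k assume "k \<in> ?B"
    then have "vec_nth k \<in> UNIV \<rightarrow>\<^sub>E {- int N..int N}" by auto
    then show "k \<in> vec_lambda ` (UNIV \<rightarrow>\<^sub>E {- int N..int N})"
      by (metis image_eqI vec_nth_inverse)
  qed
  then show "finite ?B"
    by (rule finite_subset) (intro finite_imageI finite_PiE, auto)
qed

lemma D_set_shift_subset: "D_set \<alpha> s c N \<subseteq> D_set (\<alpha> + real_vec z) s c N"
proof
  fix k assume k: "k \<in> D_set \<alpha> s c N"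
  then obtain m where g: "Gcd (insert m (range (\<lambda>i. k $ i))) = 1"
    and b: "norm (real_vec k) ^ CARD('a) * \<bar>real_vec k \<bullet> \<alpha> + real_of_int m\<bar>
             \<le> c / (ln (real N) * ln (ln (real N)) powr s)"
    unfolding D_set_def mem_Collect_eq by blast
  define t where "t = (\<Sum>i\<in>UNIV. k $ i * z $ i)"
  let ?S = "range (\<lambda>i. k $ i)"
  have t: "Gcd ?S dvd t"
    unfolding t_def by (intro dvd_sum dvd_mult2 Gcd_dvd) auto
  have "Gcd (insert (m - t) ?S) = Gcd (insert m ?S)"
  proof -
    obtain q where "t = Gcd ?S * q" using t by blast
    then have "gcd (m - t) (Gcd ?S) = gcd m (Gcd ?S)"
      using gcd_add_mult[of "Gcd ?S" "- q" m] by (simp add: gcd.commute algebra_simps)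
    then show ?thesis by simp
  qed
  moreover have "real_vec k \<bullet> (\<alpha> + real_vec z) + real_of_int (m - t)
      = real_vec k \<bullet> \<alpha> + real_of_int m"
    by (simp add: t_def inner_vec_def real_vec_def distrib_left sum.distrib)
  ultimately show "k \<in> D_set (\<alpha> + real_vec z) s c N"
    using k g b unfolding D_set_def mem_Collect_eq by metis
qed

lemma approximable_shift: "approximable r s (\<alpha> + real_vec z) \<longleftrightarrow> approximable r s \<alpha>"
proof -
  have "real_vec (- z) = - real_vec z" by (simp add: real_vec_def vec_eq_iff)
  then have "D_set (\<alpha> + real_vec z) s c N = D_set \<alpha> s c N" for c N
    using D_set_shift_subset[of \<alpha> s c N z] D_set_shift_subset[of "\<alpha> + real_vec z" s c N "- z"]
    by auto
  then show ?thesis by (simp add: approximable_def)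
qed

end

theory Submission
  imports Defs "HOL-Probability.Probability" "HOL-Real_Asymp.Real_Asymp"
begin

text \<open>
Let \<open>d = CARD('n)\<close>.  For a fixed \<open>k\<close> and \<open>\<psi> = c / (ln N (ln (ln N))\<^sup>s)\<close> the vectors \<open>\<alpha>\<close> for
which \<open>k\<close> is counted lie in a union of parallel slabs of total measure at most
\<open>2 \<psi> / |k|\<^sup>d\<close>.  Sort the \<open>k\<close> into the dyadic shells \<open>2\<^sup>q / 2 < max |k\<^sub>i| \<le> 2\<^sup>q\<close>.  A shell is hit
with probability of order \<open>\<psi>\<close>, there are of order \<open>ln N\<close> shells below \<open>N\<close>, and hits in
different shells behave like independent events.  As \<open>k\<close> and \<open>- k\<close> are hit together, \<open>2 r\<close>
elements mean \<open>r\<close> hits, which has probability of order \<open>(\<psi> ln N)\<^sup>r\<close>, that is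
\<open>(ln (ln N))\<close> to the power \<open>- r s\<close>.  Along \<open>N = 2 ^ 2 ^ j\<close> this is of order \<open>j\<close> to the power \<open>- r s\<close>, and the
series over \<open>j\<close> converges exactly for \<open>s > 1 / r\<close>.  The theorem is the pair of Borel-Cantelli
statements for these events; what has to be proved is the right amount of independence.

Two hits.  If \<open>k\<close> and \<open>k'\<close> are not proportional, moving \<open>\<alpha>\<close> in a direction orthogonal to \<open>k'\<close>
but not to \<open>k\<close> shows that their slabs are exactly independent (\<open>prob_slab_pair_indep\<close>).  If
they are proportional, primitivity of \<open>(k, m)\<close> excludes the coincidences that would spoil
independence, and up to a constant factor the bound survives (\<open>prob_prim_slab_pair\<close>).  This is
where the condition on the greatest common divisor enters; without it the multiples of a single
very well approximating \<open>k\<close> would count as several hits.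

Many hits from above.  Three or more slabs are not independent in general, because the \<open>k\<close>'s may
be linearly dependent.  Instead, let hits in lower shells be given and look at a much higher
shell \<open>q\<close>.  A shift of \<open>\<alpha>\<close> by an amount \<open>\<rho>\<close> that is small for the lower shells does not disturb
them, whereas for the shell \<open>q\<close> it averages over the slabs: the probability of a hit is at most
the number of \<open>k\<close> whose slab is within reach, times the fraction of the shift during which a
slab is met.  At most points that number has the expected size; a second moment estimate, which
needs two slabs at a time only, shows that the exceptional, irregular points have small measure
(\<open>prob_near_count_large\<close>).  Away from them hits can be added one at a time
(\<open>nn_integral_chain_weight_le\<close>).  The shells must be separated by a gap of order \<open>ln (ln N)\<close>, and
two hits without this gap are so rare, by the estimate for two hits, that they can be discarded.
This gives the convergence half, \<open>AE_not_approximable\<close>.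

Hits from below.  Let \<open>S\<close> be a union of cubes of a grid and consider shells whose slabs are much
closer to each other than the mesh of the grid.  Slabs are then equidistributed in \<open>S\<close>, which
gives the expected number of hits in \<open>S\<close>; subtracting the pairs of hits, which are bounded
as above, shows that the proportion of \<open>S\<close> with at least one hit is not smaller than a constant
times the expected number of hits, up to a summable error (\<open>prob_sub_hits_ge\<close>).  Now let
the stages \<open>n = 1, 2, \<dots>\<close> consist of the shells \<open>L / 2 < q \<le> L\<close>, where \<open>L\<close> grows geometrically
in \<open>n\<close> with a large ratio, so that whatever happened before stage \<open>n\<close> is such an \<open>S\<close>.
A block of \<open>r\<close> consecutive stages contains \<open>r\<close> hits with conditional probability at least
\<open>\<kappa> / m\<close>, where \<open>m\<close> is the number of the block and \<open>s = 1 / r\<close>; since \<open>\<Sum> \<kappa> / m\<close> diverges, almost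
every \<open>\<alpha>\<close> has \<open>r\<close> hits in infinitely many blocks (\<open>AE_infinitely_many_large_D_set\<close>).
\<close>

section \<open>Integration over the torus\<close>

definition unit_cube :: "(real ^ 'n) set" where
  "unit_cube = {\<alpha>. \<forall>i. 0 \<le> \<alpha> $ i \<and> \<alpha> $ i < 1}"

text \<open>
The uniform distribution on the unit cube, as a measure on the whole space: all events below are
periodic sets, and these need not be intersected with the cube.
\<close>

definition tor :: "(real ^ 'n) measure" where
  "tor = density lborel (indicator unit_cube)"

definition periodic :: "(real ^ 'n \<Rightarrow> 'b) \<Rightarrow> bool" where
  "periodic f \<longleftrightarrow> (\<forall>\<alpha> z. f (\<alpha> + real_vec z) = f \<alpha>)"

lemma real_vec_simps [simp]:
  "real_vec k $ i = of_int (k $ i)" "real_vec (k + l) = real_vec k + real_vec l"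
  "real_vec (- k) = - real_vec k" "real_vec (0 :: int ^ 'n) = 0"
  "real_vec (k - l) = real_vec k - real_vec l"
  by (auto simp: real_vec_def vec_eq_iff)

lemma measurable_vec_nth [measurable]: "(\<lambda>\<alpha> :: real ^ 'n. \<alpha> $ i) \<in> borel_measurable borel"
  by (intro borel_measurable_continuous_onI continuous_intros)

lemma unit_cube_sets [measurable]: "unit_cube \<in> sets borel"
  unfolding unit_cube_def by measurable

lemma emeasure_unit_cube: "emeasure lborel (unit_cube :: (real ^ 'n) set) = 1"
proof (rule antisym)
  have b: "(1 :: real ^ 'n) \<bullet> b = 1" if "b \<in> Basis" for b
    using that by (auto simp: Basis_vec_def inner_axis)
  have "box 0 1 \<subseteq> (unit_cube :: (real ^ 'n) set)"
    by (auto simp: unit_cube_def mem_box_cart less_imp_le)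
  from emeasure_mono[OF this, of lborel]
  show "1 \<le> emeasure lborel (unit_cube :: (real ^ 'n) set)"
    by (simp add: emeasure_lborel_box_eq b)
  have "(unit_cube :: (real ^ 'n) set) \<subseteq> cbox 0 1"
    by (auto simp: unit_cube_def mem_box_cart less_imp_le)
  from emeasure_mono[OF this, of lborel]
  show "emeasure lborel (unit_cube :: (real ^ 'n) set) \<le> 1"
    by (simp add: emeasure_lborel_cbox_eq b)
qed

lemma sets_tor [measurable_cong, simp]: "sets tor = sets borel"
  and space_tor [simp]: "space tor = UNIV"
  by (simp_all add: tor_def)

lemma nn_integral_tor:
  assumes [measurable]: "f \<in> borel_measurable borel"
  shows "(\<integral>\<^sup>+\<alpha>. f \<alpha> \<partial>tor) = (\<integral>\<^sup>+\<alpha>. f \<alpha> * indicator unit_cube \<alpha> \<partial>lborel)"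
  unfolding tor_def by (subst nn_integral_density) (auto simp: mult.commute)

interpretation tor: prob_space "tor :: (real ^ 'n) measure"
proof
  show "emeasure (tor :: (real ^ 'n) measure) (space tor) = 1"
    unfolding tor_def by (subst emeasure_density) (auto simp: emeasure_unit_cube)
qed

lemma emeasure_tor_UNIV [simp]: "emeasure (tor :: (real ^ 'n) measure) UNIV = 1"
  using tor.emeasure_space_1 by simp

lemma tile_sum:
  "(\<integral>\<^sup>+z. indicator (unit_cube :: (real ^ 'n) set) (\<alpha> - real_vec z) \<partial>count_space UNIV) = 1"
proof -
  define z0 :: "int ^ 'n" where "z0 = (\<chi> i. \<lfloor>\<alpha> $ i\<rfloor>)"
  have "\<alpha> - real_vec z \<in> unit_cube \<longleftrightarrow> z = z0" for z
  proof -
    have "\<alpha> - real_vec z \<in> unit_cube \<longleftrightarrow> (\<forall>i. \<lfloor>\<alpha> $ i\<rfloor> = z $ i)"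
      by (auto simp: unit_cube_def floor_eq_iff algebra_simps)
    then show ?thesis by (auto simp: z0_def vec_eq_iff)
  qed
  then have "(\<lambda>z. indicator (unit_cube :: (real ^ 'n) set) (\<alpha> - real_vec z) :: ennreal)
    = indicator {z0}" by (auto simp: fun_eq_iff indicator_def)
  then show ?thesis by simp
qed

lemma nn_integral_lborel_shift:
  fixes f :: "'a :: euclidean_space \<Rightarrow> ennreal"
  assumes [measurable]: "f \<in> borel_measurable borel"
  shows "(\<integral>\<^sup>+x. f (x + t) \<partial>lborel) = (\<integral>\<^sup>+x. f x \<partial>lborel)"
proof -
  have "(\<integral>\<^sup>+x. f x \<partial>lborel) = (\<integral>\<^sup>+x. f x \<partial>distr lborel borel ((+) t))"
    by (simp add: lborel_distr_plus)
  also have "\<dots> = (\<integral>\<^sup>+x. f (x + t) \<partial>lborel)"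
    by (subst nn_integral_distr) (auto simp: add.commute)
  finally show ?thesis by simp
qed

text \<open>
The integer translates of the cube tile the space, and so do those of a shifted cube; cutting
the shifted cube along the first tiling and moving the pieces back does not change the integral
of a periodic function.
\<close>

lemma nn_integral_tor_shift:
  fixes f :: "real ^ 'n \<Rightarrow> ennreal"
  assumes [measurable]: "f \<in> borel_measurable borel" and per: "periodic f"
  shows "(\<integral>\<^sup>+\<alpha>. f (\<alpha> + t) \<partial>tor) = (\<integral>\<^sup>+\<alpha>. f \<alpha> \<partial>tor)"
proof -
  interpret C: sigma_finite_measure "count_space (UNIV :: (int ^ 'n) set)"
    by (rule sigma_finite_measure_count_space)
  interpret PS: pair_sigma_finite "lborel :: (real ^ 'n) measure" "count_space (UNIV :: (int ^ 'n) set)" ..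
  have per': "f (\<alpha> - real_vec z) = f \<alpha>" for \<alpha> z
    using per[unfolded periodic_def, rule_format, of "\<alpha> - real_vec z" z] by simp
  let ?I = "indicator (unit_cube :: (real ^ 'n) set) :: _ \<Rightarrow> ennreal"
  have swap: "(\<integral>\<^sup>+x. (\<integral>\<^sup>+z. h z x \<partial>count_space UNIV) \<partial>lborel) =
    (\<integral>\<^sup>+z. (\<integral>\<^sup>+x. h z x \<partial>lborel) \<partial>count_space (UNIV :: (int ^ 'n) set))"
    if [measurable]: "\<And>z. h z \<in> borel_measurable borel" for h :: "int ^ 'n \<Rightarrow> real ^ 'n \<Rightarrow> ennreal"
  proof -
    have [measurable]: "(\<lambda>(x, z). h z x) \<in> borel_measurable (lborel \<Otimes>\<^sub>M count_space (UNIV :: (int ^ 'n) set))"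
      unfolding measurable_split_conv
      by (rule measurable_compose_countable'[where I = UNIV and g = snd and f = "\<lambda>z x. h z (fst x)"]) auto
    show ?thesis
      by (rule PS.Fubini'[symmetric]) measurable
  qed
  have "(\<integral>\<^sup>+\<alpha>. f (\<alpha> + t) \<partial>tor) = (\<integral>\<^sup>+x. f (x + t) * ?I x \<partial>lborel)"
    by (rule nn_integral_tor) measurable
  also have "\<dots> = (\<integral>\<^sup>+x. f x * ?I (x - t) \<partial>lborel)"
    using nn_integral_lborel_shift[of "\<lambda>x. f x * ?I (x - t)" t] by simp
  also have "\<dots> = (\<integral>\<^sup>+x. (\<integral>\<^sup>+z. f x * ?I (x - t) * ?I (x - real_vec z) \<partial>count_space UNIV) \<partial>lborel)"
    by (simp add: nn_integral_cmult tile_sum)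
  also have "\<dots> = (\<integral>\<^sup>+z. (\<integral>\<^sup>+x. f x * ?I (x - t) * ?I (x - real_vec z) \<partial>lborel) \<partial>count_space UNIV)"
    by (rule swap) measurable
  also have "\<dots> = (\<integral>\<^sup>+z. (\<integral>\<^sup>+x. f x * ?I (x - t + real_vec z) * ?I x \<partial>lborel) \<partial>count_space UNIV)"
  proof (rule nn_integral_cong)
    fix z :: "int ^ 'n"
    show "(\<integral>\<^sup>+x. f x * ?I (x - t) * ?I (x - real_vec z) \<partial>lborel) =
      (\<integral>\<^sup>+x. f x * ?I (x - t + real_vec z) * ?I x \<partial>lborel)"
      using nn_integral_lborel_shift[of "\<lambda>x. f x * ?I (x - t) * ?I (x - real_vec z)" "real_vec z"]
        per[unfolded periodic_def]
      by (simp add: algebra_simps)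
  qed
  also have "\<dots> = (\<integral>\<^sup>+x. (\<integral>\<^sup>+z. f x * ?I (x - t + real_vec z) * ?I x \<partial>count_space UNIV) \<partial>lborel)"
    by (rule swap[symmetric]) measurable
  also have "\<dots> = (\<integral>\<^sup>+x. f x * ?I x \<partial>lborel)"
  proof (rule nn_integral_cong)
    fix x
    have "(\<integral>\<^sup>+z. ?I (x - t + real_vec z) \<partial>count_space UNIV) = (\<integral>\<^sup>+z. ?I (x - t - real_vec z) \<partial>count_space UNIV)"
    proof -
      have "bij_betw uminus (UNIV :: (int ^ 'n) set) UNIV" by (rule bij_uminus)
      from nn_integral_bij_count_space[OF this, of "\<lambda>z. ?I (x - t + real_vec z)"]
      show ?thesis by simp
    qed
    also have "\<dots> = 1" by (rule tile_sum)
    finally have "(\<integral>\<^sup>+z. f x * ?I x * ?I (x - t + real_vec z) \<partial>count_space UNIV) = f x * ?I x"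
      by (subst nn_integral_cmult) auto
    then show "(\<integral>\<^sup>+z. f x * ?I (x - t + real_vec z) * ?I x \<partial>count_space UNIV) = f x * ?I x"
      by (simp only: ac_simps)
  qed
  also have "\<dots> = (\<integral>\<^sup>+\<alpha>. f \<alpha> \<partial>tor)" by (rule nn_integral_tor[symmetric]) measurable
  finally show ?thesis .
qed

text \<open>
The tool behind all probability estimates below: an integral over the torus may be averaged over
shifts along any segment, and on a segment only one-dimensional integrals have to be computed.
\<close>

lemma nn_integral_tor_shift_average:
  fixes f :: "real ^ 'n \<Rightarrow> ennreal"
  assumes [measurable]: "f \<in> borel_measurable borel" and per: "periodic f" and "A \<in> sets borel"
  shows "emeasure lborel A * (\<integral>\<^sup>+\<alpha>. f \<alpha> \<partial>tor)
    = (\<integral>\<^sup>+\<alpha>. (\<integral>\<^sup>+\<beta>. f (\<alpha> + \<beta> *\<^sub>R w) * indicator A \<beta> \<partial>lborel) \<partial>tor)"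
proof -
  have [measurable]: "A \<in> sets borel" by fact
  interpret PS: pair_sigma_finite "tor :: (real ^ 'n) measure" "lborel :: real measure" ..
  have "emeasure lborel A * (\<integral>\<^sup>+\<alpha>. f \<alpha> \<partial>tor) =
     (\<integral>\<^sup>+\<beta>. (\<integral>\<^sup>+\<alpha>. f (\<alpha> + \<beta> *\<^sub>R w) * indicator A \<beta> \<partial>tor) \<partial>lborel)"
    by (simp add: nn_integral_multc nn_integral_tor_shift[OF _ per] nn_integral_cmult mult.commute)
  also have "\<dots> = (\<integral>\<^sup>+\<alpha>. (\<integral>\<^sup>+\<beta>. f (\<alpha> + \<beta> *\<^sub>R w) * indicator A \<beta> \<partial>lborel) \<partial>tor)"
    by (rule PS.Fubini') measurable
  finally show ?thesis .
qed

section \<open>Slabs around one integer vector\<close>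

text \<open>
That is, the distance from \<open>x\<close> to the nearest integer is at most \<open>\<delta>\<close>.
\<close>

definition near :: "real \<Rightarrow> real \<Rightarrow> bool" where
  "near \<delta> x \<longleftrightarrow> (\<exists>m::int. \<bar>x + of_int m\<bar> \<le> \<delta>)"

lemma near_measurable [measurable]: "Measurable.pred borel (near \<delta>)"
  unfolding near_def by measurable

lemma near_int_shift: "near \<delta> (x + of_int n) \<longleftrightarrow> near \<delta> x"
proof -
  have *: "near \<delta> (x + of_int n)" if "near \<delta> x" for x and n :: int
  proof -
    from that obtain m :: int where "\<bar>x + of_int m\<bar> \<le> \<delta>" by (auto simp: near_def)
    then have "\<bar>(x + of_int n) + of_int (m - n)\<bar> \<le> \<delta>" by simp
    then show ?thesis unfolding near_def by blast
  qed
  from *[of x n] *[of "x + of_int n" "- n"] show ?thesis by auto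
qed

lemma near_perturb:
  assumes "near \<delta> x" and "\<bar>y - x\<bar> \<le> \<epsilon>" and "\<delta> + \<epsilon> \<le> \<delta>'"
  shows "near \<delta>' y"
proof -
  from assms(1) obtain m :: int where "\<bar>x + of_int m\<bar> \<le> \<delta>" by (auto simp: near_def)
  with assms(2,3) have "\<bar>y + of_int m\<bar> \<le> \<delta>'" by linarith
  then show ?thesis by (auto simp: near_def)
qed

lemma near_minus: "near \<delta> (- x) \<longleftrightarrow> near \<delta> x"
proof -
  have *: "near \<delta> (- x)" if "near \<delta> x" for x
  proof -
    from that obtain m :: int where "\<bar>x + of_int m\<bar> \<le> \<delta>" by (auto simp: near_def)
    then have "\<bar>- x + of_int (- m)\<bar> \<le> \<delta>" by simp
    then show ?thesis unfolding near_def by blast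
  qed
  from *[of x] *[of "- x"] show ?thesis by auto
qed

lemma near_iff_frac:
  assumes "0 \<le> \<delta>" "\<delta> \<le> 1/2"
  shows "near \<delta> x \<longleftrightarrow> frac (x + \<delta>) \<le> 2 * \<delta>"
proof
  assume "near \<delta> x"
  then obtain m :: int where m: "\<bar>x + of_int m\<bar> \<le> \<delta>" by (auto simp: near_def)
  show "frac (x + \<delta>) \<le> 2 * \<delta>"
  proof (cases "\<delta> = 1/2")
    case True
    then show ?thesis using frac_lt_1[of "x + \<delta>"] by simp
  next
    case False
    with assms m have "\<lfloor>x + \<delta>\<rfloor> = - m" by (intro floor_unique) (auto simp: abs_le_iff)
    then show ?thesis using m by (auto simp: frac_def)
  qed
next
  assume "frac (x + \<delta>) \<le> 2 * \<delta>"
  then have "\<bar>x + of_int (- \<lfloor>x + \<delta>\<rfloor>)\<bar> \<le> \<delta>"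
    using frac_ge_0[of "x + \<delta>"] unfolding frac_def abs_le_iff of_int_minus by linarith
  then show "near \<delta> x" unfolding near_def by blast
qed

lemma emeasure_near_unit_interval:
  assumes d: "0 \<le> \<delta>" "\<delta> \<le> 1/2"
  shows "emeasure lborel {\<beta>. near \<delta> (x + \<beta>) \<and> 0 \<le> \<beta> \<and> \<beta> < 1} = ennreal (2 * \<delta>)"
proof -
  define v where "v = frac (x + \<delta>)"
  have v: "0 \<le> v" "v < 1" by (auto simp: v_def frac_lt_1)
  have fr: "near \<delta> (x + \<beta>) \<longleftrightarrow> (if \<beta> < 1 - v then v + \<beta> \<le> 2 * \<delta> else v + \<beta> - 1 \<le> 2 * \<delta>)"
    if "0 \<le> \<beta>" "\<beta> < 1" for \<beta>
  proof -
    have "frac \<beta> = \<beta>" using that by (simp add: frac_eq)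
    then have "frac (x + \<beta> + \<delta>) = (if \<beta> < 1 - v then v + \<beta> else v + \<beta> - 1)"
      using frac_add[of "x + \<delta>" \<beta>] by (auto simp: v_def algebra_simps)
    then show ?thesis using d by (simp add: near_iff_frac)
  qed
  show ?thesis
  proof (cases "v \<le> 2 * \<delta>")
    case True
    have "{\<beta>. near \<delta> (x + \<beta>) \<and> 0 \<le> \<beta> \<and> \<beta> < 1} =
       ({0..2*\<delta> - v} - {1 - v}) \<union> {1 - v..<1}"
      using True v d by (auto simp: fr split: if_splits)
    also have "emeasure lborel \<dots> = emeasure lborel ({0..2*\<delta> - v} - {1 - v}) + emeasure lborel {1 - v..<1}"
      using v d by (intro plus_emeasure[symmetric]) auto
    also have "emeasure lborel ({0..2*\<delta> - v} - {1 - v}) = emeasure lborel {0..2*\<delta> - v}"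
      by (rule emeasure_Diff_null_set) (auto simp: null_sets_def)
    finally show ?thesis using True v by (simp flip: ennreal_plus)
  next
    case False
    then have "{\<beta>. near \<delta> (x + \<beta>) \<and> 0 \<le> \<beta> \<and> \<beta> < 1} = {1 - v..2 * \<delta> + 1 - v}"
      using v d by (auto simp: fr split: if_splits)
    then show ?thesis using d by simp
  qed
qed

lemma nn_integral_near_period:
  assumes d: "0 \<le> \<delta>" "\<delta> \<le> 1/2" and "n \<noteq> 0"
  shows "(\<integral>\<^sup>+\<beta>. indicator {\<beta>. near \<delta> (x + \<beta> * n)} \<beta> * indicator {0..<1/\<bar>n\<bar>} \<beta> \<partial>lborel)
    = ennreal (2 * \<delta> / \<bar>n\<bar>)"
proof -
  have *: "(\<integral>\<^sup>+\<beta>. indicator {\<beta>. near \<delta> (x + \<beta> * n)} \<beta> * indicator {0..<1/n} \<beta> \<partial>lborel)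
      = ennreal (2 * \<delta> / n)" if n: "n > 0" for x n :: real
  proof -
    have "(\<integral>\<^sup>+\<beta>. indicator {\<beta>. near \<delta> (x + \<beta> * n)} \<beta> * indicator {0..<1/n} \<beta> \<partial>lborel)
      = ennreal \<bar>1/n\<bar> * (\<integral>\<^sup>+y. indicator {\<beta>. near \<delta> (x + \<beta> * n)} (0 + 1/n * y)
          * indicator {0..<1/n} (0 + 1/n * y) \<partial>lborel)"
      using n by (intro nn_integral_real_affine) auto
    also have "(\<integral>\<^sup>+y. indicator {\<beta>. near \<delta> (x + \<beta> * n)} (0 + 1/n * y)
          * indicator {0..<1/n} (0 + 1/n * y) \<partial>lborel)
       = (\<integral>\<^sup>+y. indicator {\<beta>. near \<delta> (x + \<beta>) \<and> 0 \<le> \<beta> \<and> \<beta> < 1} y \<partial>lborel)"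
      using n by (intro nn_integral_cong) (auto simp: indicator_def field_simps)
    also have "\<dots> = ennreal (2 * \<delta>)"
      by (subst nn_integral_indicator) (auto simp: emeasure_near_unit_interval[OF d])
    finally show ?thesis using n d by (simp flip: ennreal_mult)
  qed
  show ?thesis
  proof (cases "n > 0")
    case True
    then show ?thesis using *[of n x] by simp
  next
    case False
    have "near \<delta> (x + \<beta> * n) \<longleftrightarrow> near \<delta> (- x + \<beta> * (- n))" for \<beta>
      using near_minus[of \<delta> "x + \<beta> * n"] by simp
    then show ?thesis using *[of "- n" "- x"] False assms(3) by simp
  qed
qed

text \<open>
A shift that is too short to move from one integer to the next meets the neighbourhood of one
integer only.
\<close>

lemma nn_integral_near_le:
  assumes "2 * \<delta> + \<rho> * \<bar>n\<bar> < 1" "n \<noteq> 0" "0 \<le> \<delta>"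
  shows "(\<integral>\<^sup>+\<beta>. indicator {\<beta>. near \<delta> (x + \<beta> * n)} \<beta> * indicator {0..\<rho>} \<beta> \<partial>lborel)
    \<le> ennreal (2 * \<delta> / \<bar>n\<bar>)"
proof (cases "\<exists>\<beta>\<in>{0..\<rho>}. near \<delta> (x + \<beta> * n)")
  case True
  then obtain \<beta>0 and m :: int where b: "0 \<le> \<beta>0" "\<beta>0 \<le> \<rho>" and m: "\<bar>x + \<beta>0 * n + of_int m\<bar> \<le> \<delta>"
    by (auto simp: near_def)
  let ?c = "- (x + of_int m) / n"
  have "\<bar>\<beta> - ?c\<bar> \<le> \<delta> / \<bar>n\<bar>" if \<beta>: "0 \<le> \<beta>" "\<beta> \<le> \<rho>" and nr: "near \<delta> (x + \<beta> * n)" for \<beta>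
  proof -
    from nr obtain m' :: int where m': "\<bar>x + \<beta> * n + of_int m'\<bar> \<le> \<delta>" by (auto simp: near_def)
    have "\<bar>(\<beta> - \<beta>0) * n\<bar> \<le> \<rho> * \<bar>n\<bar>"
      unfolding abs_mult using b \<beta> by (intro mult_right_mono) auto
    moreover have "\<bar>of_int (m' - m)\<bar> \<le> 2 * \<delta> + \<bar>(\<beta> - \<beta>0) * n\<bar>"
      using m m' by (simp add: algebra_simps)
    ultimately have "\<bar>of_int (m' - m) :: real\<bar> < 1" using assms(1) by linarith
    then have "m' = m" by linarith
    have shift: "(\<beta> - ?c) * n = x + \<beta> * n + of_int m"
      using assms(2) by (simp add: field_simps)
    have "\<bar>\<beta> - ?c\<bar> * \<bar>n\<bar> \<le> \<delta>"
      unfolding abs_mult[symmetric] shift using m' \<open>m' = m\<close> by simp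
    then show ?thesis using assms(2) by (subst pos_le_divide_eq) auto
  qed
  then have "(\<integral>\<^sup>+\<beta>. indicator {\<beta>. near \<delta> (x + \<beta> * n)} \<beta> * indicator {0..\<rho>} \<beta> \<partial>lborel)
    \<le> (\<integral>\<^sup>+\<beta>. indicator {?c - \<delta> / \<bar>n\<bar> .. ?c + \<delta> / \<bar>n\<bar>} \<beta> \<partial>lborel)"
    by (intro nn_integral_mono) (auto simp: indicator_def abs_le_iff algebra_simps)
  also have "\<dots> = ennreal (2 * \<delta> / \<bar>n\<bar>)" using assms by simp
  finally show ?thesis .
next
  case False
  then have "(\<integral>\<^sup>+\<beta>. indicator {\<beta>. near \<delta> (x + \<beta> * n)} \<beta> * indicator {0..\<rho>} \<beta> \<partial>lborel) = (\<integral>\<^sup>+\<beta>. 0 \<partial>(lborel :: real measure))"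
    by (intro nn_integral_cong) (auto simp: indicator_def)
  then show ?thesis by simp
qed

text \<open>
The same set as \<open>prim_slab\<close> below, but without the condition that \<open>(k, m)\<close> be primitive.  It is
the more convenient one because its probability is explicit.
\<close>

definition slab :: "real \<Rightarrow> int ^ 'n \<Rightarrow> (real ^ 'n) set" where
  "slab \<delta> k = {\<alpha>. near \<delta> (real_vec k \<bullet> \<alpha>)}"

definition prim_slab :: "real \<Rightarrow> int ^ 'n \<Rightarrow> (real ^ 'n) set" where
  "prim_slab \<delta> k = {\<alpha>. \<exists>m::int. Gcd (insert m (range (\<lambda>i. k $ i))) = 1
      \<and> \<bar>real_vec k \<bullet> \<alpha> + of_int m\<bar> \<le> \<delta>}"

lemma slab_sets [measurable]: "slab \<delta> k \<in> sets borel"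
  unfolding slab_def by measurable

lemma prim_slab_sets [measurable]: "prim_slab \<delta> k \<in> sets borel"
  unfolding prim_slab_def by measurable

lemma prim_slab_subset: "prim_slab \<delta> k \<subseteq> slab \<delta> k"
  by (auto simp: prim_slab_def slab_def near_def)

lemma inner_real_vec: "real_vec k \<bullet> real_vec z = of_int (\<Sum>i\<in>UNIV. k $ i * z $ i)"
  by (simp add: inner_vec_def)

lemma slab_periodic: "\<alpha> + real_vec z \<in> slab \<delta> k \<longleftrightarrow> \<alpha> \<in> slab \<delta> k"
  unfolding slab_def mem_Collect_eq inner_add_right inner_real_vec by (rule near_int_shift)

lemma periodic_indicator:
  assumes "\<And>\<alpha> z. \<alpha> + real_vec z \<in> A \<longleftrightarrow> \<alpha> \<in> A"
  shows "periodic (indicator A :: real ^ 'n \<Rightarrow> ennreal)"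
  using assms by (auto simp: periodic_def indicator_def)

lemma periodic_mult:
  fixes f g :: "real ^ 'n \<Rightarrow> ennreal"
  shows "periodic f \<Longrightarrow> periodic g \<Longrightarrow> periodic (\<lambda>\<alpha>. f \<alpha> * g \<alpha>)"
  by (auto simp: periodic_def)

text \<open>
A shift along \<open>w\<close> fixes \<open>h\<close> and lets the inner product with \<open>k\<close> run through a full period, on which
the slabs occupy the proportion \<open>2 \<delta>\<close>.
\<close>

lemma nn_integral_slab_indep:
  fixes h :: "real ^ 'n \<Rightarrow> ennreal"
  assumes [measurable]: "h \<in> borel_measurable borel" and per: "periodic h"
    and w: "real_vec k \<bullet> w \<noteq> 0" and inv: "\<And>\<alpha> \<beta>. h (\<alpha> + \<beta> *\<^sub>R w) = h \<alpha>"
    and d: "0 \<le> \<delta>" "\<delta> \<le> 1/2"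
  shows "(\<integral>\<^sup>+\<alpha>. h \<alpha> * indicator (slab \<delta> k) \<alpha> \<partial>tor) = ennreal (2 * \<delta>) * (\<integral>\<^sup>+\<alpha>. h \<alpha> \<partial>tor)"
proof -
  define n where "n = real_vec k \<bullet> w"
  let ?A = "{0..<1/\<bar>n\<bar>}"
  let ?f = "\<lambda>\<alpha>. h \<alpha> * indicator (slab \<delta> k) \<alpha> :: ennreal"
  have n: "n \<noteq> 0" using w by (simp add: n_def)
  have "emeasure lborel ?A * (\<integral>\<^sup>+\<alpha>. ?f \<alpha> \<partial>tor)
      = (\<integral>\<^sup>+\<alpha>. (\<integral>\<^sup>+\<beta>. ?f (\<alpha> + \<beta> *\<^sub>R w) * indicator ?A \<beta> \<partial>lborel) \<partial>tor)"
    by (rule nn_integral_tor_shift_average)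
       (auto intro!: periodic_mult per periodic_indicator slab_periodic)
  also have "\<dots> = (\<integral>\<^sup>+\<alpha>. h \<alpha> * ennreal (2 * \<delta> / \<bar>n\<bar>) \<partial>tor)"
  proof (rule nn_integral_cong)
    fix \<alpha> :: "real ^ 'n"
    have "(\<integral>\<^sup>+\<beta>. ?f (\<alpha> + \<beta> *\<^sub>R w) * indicator ?A \<beta> \<partial>lborel) =
      (\<integral>\<^sup>+\<beta>. h \<alpha> * (indicator {\<beta>. near \<delta> (real_vec k \<bullet> \<alpha> + \<beta> * n)} \<beta> * indicator ?A \<beta>) \<partial>lborel)"
      by (intro nn_integral_cong) (auto simp: inv slab_def indicator_def inner_add_right n_def)
    also have "\<dots> = h \<alpha> * ennreal (2 * \<delta> / \<bar>n\<bar>)"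
      by (subst nn_integral_cmult) (auto simp: nn_integral_near_period[OF d n])
    finally show "(\<integral>\<^sup>+\<beta>. ?f (\<alpha> + \<beta> *\<^sub>R w) * indicator ?A \<beta> \<partial>lborel) = h \<alpha> * ennreal (2 * \<delta> / \<bar>n\<bar>)" .
  qed
  also have "\<dots> = ennreal (1 / \<bar>n\<bar>) * (ennreal (2 * \<delta>) * (\<integral>\<^sup>+\<alpha>. h \<alpha> \<partial>tor))"
    using d by (simp add: nn_integral_multc mult_ac flip: ennreal_mult mult.assoc)
  finally have "ennreal \<bar>n\<bar> * (ennreal (1 / \<bar>n\<bar>) * (\<integral>\<^sup>+\<alpha>. ?f \<alpha> \<partial>tor))
    = ennreal \<bar>n\<bar> * (ennreal (1 / \<bar>n\<bar>) * (ennreal (2 * \<delta>) * (\<integral>\<^sup>+\<alpha>. h \<alpha> \<partial>tor)))"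
    by simp
  then show ?thesis using n by (simp flip: ennreal_mult mult.assoc)
qed

lemma inner_real_vec_self_nonzero: "k \<noteq> 0 \<Longrightarrow> real_vec k \<bullet> real_vec k \<noteq> 0"
  by (auto simp: vec_eq_iff)

lemma prob_slab:
  fixes k :: "int ^ 'n"
  assumes "k \<noteq> 0" "0 \<le> \<delta>" "\<delta> \<le> 1/2"
  shows "tor.prob (slab \<delta> k) = 2 * \<delta>"
proof -
  have "emeasure tor (slab \<delta> k) = ennreal (2 * \<delta>)"
    using nn_integral_slab_indep[of "\<lambda>_. 1" k "real_vec k" \<delta>] assms
      inner_real_vec_self_nonzero[OF assms(1)] emeasure_tor_UNIV
    by (auto simp: periodic_def)
  then show ?thesis using assms by (simp add: measure_def)
qed

lemma prob_slab_le:
  fixes k :: "int ^ 'n"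
  assumes "k \<noteq> 0" "0 \<le> \<delta>"
  shows "tor.prob (slab \<delta> k) \<le> 2 * \<delta>"
  using prob_slab[of k \<delta>] assms
  by (cases "\<delta> \<le> 1/2") (auto intro: order_trans[OF tor.prob_le_1])

text \<open>
This covers all pairs that are not proportional: then a suitable \<open>w\<close> exists by
\<open>int_vec_cases\<close>.
\<close>

lemma prob_slab_pair_indep:
  fixes k k' :: "int ^ 'n"
  assumes w: "real_vec k \<bullet> w \<noteq> 0" "real_vec k' \<bullet> w = 0" and "0 \<le> \<delta>" "\<delta> \<le> 1/2"
  shows "tor.prob (slab \<delta> k \<inter> slab \<delta>' k') = 2 * \<delta> * tor.prob (slab \<delta>' k')"
proof -
  have "emeasure tor (slab \<delta> k \<inter> slab \<delta>' k') =
     (\<integral>\<^sup>+\<alpha>. indicator (slab \<delta>' k') \<alpha> * indicator (slab \<delta> k) \<alpha> \<partial>tor)"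
    by (simp add: nn_integral_indicator indicator_inter_arith[symmetric] Int_commute)
  also have "\<dots> = ennreal (2 * \<delta>) * (\<integral>\<^sup>+\<alpha>. indicator (slab \<delta>' k') \<alpha> \<partial>tor)"
  proof (rule nn_integral_slab_indep[OF _ _ w(1)])
    show "periodic (indicator (slab \<delta>' k') :: real ^ 'n \<Rightarrow> ennreal)"
      by (intro periodic_indicator slab_periodic)
  qed (use assms in \<open>auto simp: indicator_def slab_def inner_add_right\<close>)
  also have "\<dots> = ennreal (2 * \<delta> * tor.prob (slab \<delta>' k'))"
    using assms by (simp add: tor.emeasure_eq_measure ennreal_mult)
  finally show ?thesis using assms by (simp add: measure_def)
qed

section \<open>Two integer vectors\<close>

text \<open>
The vector \<open>w = (k' \<bullet> k') k - (k \<bullet> k') k'\<close> is orthogonal to \<open>k'\<close>, and \<open>w \<bullet> w\<close> is a multiple of \<open>k \<bullet> w\<close>.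
So if it is orthogonal to \<open>k\<close> too, it vanishes, which is a linear relation over the integers.
\<close>

lemma int_vec_cases:
  fixes k k' :: "int ^ 'n"
  assumes "k \<noteq> 0" "k' \<noteq> 0"
  obtains (independent) w where "real_vec k \<bullet> w \<noteq> 0" "real_vec k' \<bullet> w = 0"
  | (proportional) a b v where "coprime a b" "a \<noteq> 0" "b \<noteq> 0" "v \<noteq> 0" "k = a *s v" "k' = b *s v"
proof -
  define A where "A = (\<Sum>i\<in>UNIV. k' $ i * k' $ i)"
  define B where "B = (\<Sum>i\<in>UNIV. k $ i * k' $ i)"
  define w where "w = of_int A *\<^sub>R real_vec k - of_int B *\<^sub>R real_vec k'"
  have A: "real_vec k' \<bullet> real_vec k' = of_int A" by (simp add: inner_real_vec A_def)
  have B: "real_vec k \<bullet> real_vec k' = of_int B" by (simp add: inner_real_vec B_def)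
  have w0: "real_vec k' \<bullet> w = 0"
    by (simp add: w_def inner_diff_right A B inner_commute[of "real_vec k'" "real_vec k"])
  have "of_int A \<noteq> (0::real)" using inner_real_vec_self_nonzero[OF assms(2)] by (simp add: A)
  then have A0: "A \<noteq> 0" by simp
  show thesis
  proof (cases "real_vec k \<bullet> w = 0")
    case False
    then show thesis using w0 independent by blast
  next
    case True
    have "w \<bullet> w = of_int A * (real_vec k \<bullet> w) - of_int B * (real_vec k' \<bullet> w)"
      by (subst (1) w_def) (simp add: inner_diff_left)
    then have "w = 0" using True w0 by simp
    have AB: "A * k $ i = B * k' $ i" for i
    proof -
      have "w $ i = 0" using \<open>w = 0\<close> by simp
      then have "real_of_int (A * k $ i) = real_of_int (B * k' $ i)" by (simp add: w_def)
      then show ?thesis by (simp only: of_int_eq_iff)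
    qed
    define g where "g = gcd A B"
    have g: "g \<noteq> 0" using A0 by (simp add: g_def)
    obtain b a where ba: "A = g * b" "B = g * a" "coprime b a"
      using gcd_coprime_exists[of A B] A0 unfolding g_def by (metis mult.commute gcd_eq_0_iff)
    have b0: "b \<noteq> 0" using A0 ba by auto
    have eq: "b * k $ i = a * k' $ i" for i
      using AB[of i] g by (simp add: ba mult.assoc)
    have dv: "b dvd k' $ i" for i
      using eq[of i] ba(3) by (metis coprime_dvd_mult_right_iff dvd_triv_left)
    define v where "v = (\<chi> i. k' $ i div b)"
    have k': "k' = b *s v" using dv by (simp add: vec_eq_iff v_def)
    have "b * k $ i = b * (a * v $ i)" for i
      using eq[of i] by (subst (asm) k') simp
    then have k: "k = a *s v" using b0 by (simp add: vec_eq_iff)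
    have "v \<noteq> 0" "a \<noteq> 0" using k assms(1) by (auto simp: vec_eq_iff)
    then show thesis using proportional[of a b v] ba(3) b0 k k' by (simp add: coprime_commute)
  qed
qed

text \<open>
As \<open>a\<close> is invertible modulo \<open>n\<close>, distinct \<open>i\<close> yield distinct integers in an interval of length
\<open>2 \<delta> n\<close>.
\<close>

lemma card_near_progression:
  assumes "coprime a (int n)" "n > 0" "0 \<le> \<delta>"
  shows "real (card {i. i < n \<and> near \<delta> (x + of_int a * real i / real n)}) \<le> 2 * \<delta> * real n + 1"
proof -
  let ?S = "{i. i < n \<and> near \<delta> (x + of_int a * real i / real n)}"
  define lo hi where "lo = \<lceil>- (real n * x) - real n * \<delta>\<rceil>" and "hi = \<lfloor>- (real n * x) + real n * \<delta>\<rfloor>"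
  have "\<exists>m::int. a * int i + m * int n \<in> {lo..hi}" if i: "i \<in> ?S" for i
  proof -
    from i obtain m :: int where m: "\<bar>x + of_int a * real i / real n + of_int m\<bar> \<le> \<delta>"
      by (auto simp: near_def)
    have "real n * x + of_int (a * int i + m * int n) = (x + of_int a * real i / real n + of_int m) * real n"
      using assms(2) by (simp add: field_simps)
    then have "\<bar>real n * x + of_int (a * int i + m * int n)\<bar> \<le> \<delta> * real n"
      using m by (simp add: abs_mult mult_right_mono)
    then have "a * int i + m * int n \<in> {lo..hi}"
      by (auto simp: lo_def hi_def ceiling_le_iff le_floor_iff abs_le_iff algebra_simps)
    then show ?thesis by blast
  qed
  then have "\<exists>m. \<forall>i\<in>?S. a * int i + m i * int n \<in> {lo..hi}" by (intro bchoice ballI)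
  then obtain m :: "nat \<Rightarrow> int" where m: "\<And>i. i \<in> ?S \<Longrightarrow> a * int i + m i * int n \<in> {lo..hi}"
    by blast
  have "inj_on (\<lambda>i. a * int i + m i * int n) ?S"
  proof (rule inj_onI)
    fix i j assume i: "i \<in> ?S" and j: "j \<in> ?S" and eq: "a * int i + m i * int n = a * int j + m j * int n"
    then have "a * (int i - int j) = int n * (m j - m i)" by (simp add: algebra_simps)
    then have "int n dvd int i - int j"
      using assms(1) by (metis coprime_commute coprime_dvd_mult_right_iff dvd_triv_left)
    then have "int i mod int n = int j mod int n" by (simp add: mod_eq_dvd_iff)
    then show "i = j" using i j by simp
  qed
  then have "card ?S \<le> card {lo..hi}"
    using m by (intro card_inj_on_le[where f = "\<lambda>i. a * int i + m i * int n"]) auto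
  moreover have "real (card {lo..hi}) \<le> 2 * \<delta> * real n + 1"
  proof -
    have "of_int hi - of_int lo \<le> 2 * \<delta> * real n"
      using of_int_floor_le[of "- (real n * x) + real n * \<delta>"]
        le_of_int_ceiling[of "- (real n * x) - real n * \<delta>"] mult.commute[of "real n" \<delta>]
      unfolding lo_def hi_def by linarith
    moreover have "0 \<le> 2 * \<delta> * real n" using assms by simp
    ultimately show ?thesis by (auto simp: of_nat_nat)
  qed
  ultimately show ?thesis by linarith
qed

text \<open>
Shifts by \<open>i / b\<close> in the direction of \<open>v\<close> preserve the second set, and among the \<open>|b|\<close> shifts of the
first set a given point lies in at most \<open>2 \<delta> |b| + 1\<close>.
\<close>

lemma prob_slab_pair_proportional:
  fixes v :: "int ^ 'n"
  assumes cop: "coprime a b" and b: "b \<noteq> 0" and v: "v \<noteq> 0" and d: "0 \<le> \<delta>" "0 \<le> \<delta>'"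
  shows "tor.prob (slab \<delta> (a *s v) \<inter> slab \<delta>' (b *s v)) \<le> (2 * \<delta> + 1 / of_int \<bar>b\<bar>) * (2 * \<delta>')"
proof -
  define n where "n = nat \<bar>b\<bar>"
  define u where "u = (1 / (real_vec v \<bullet> real_vec v)) *\<^sub>R real_vec v"
  have n: "n > 0" "real n = of_int \<bar>b\<bar>" "int n = \<bar>b\<bar>" using b by (auto simp: n_def)
  have real_scale: "real_vec (c *s v) = of_int c *\<^sub>R real_vec v" for c by (simp add: vec_eq_iff)
  have vu: "real_vec v \<bullet> u = 1" using inner_real_vec_self_nonzero[OF v] by (simp add: u_def)
  have k0: "b *s v \<noteq> 0" using b v by (auto simp: vec_eq_iff)
  let ?E = "slab \<delta> (a *s v)" and ?E' = "slab \<delta>' (b *s v)"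
  let ?t = "\<lambda>i. (real i / of_int b) *\<^sub>R u"
  define s where "s = a * sgn b"
  have "coprime s (int n)" unfolding s_def n(3) using cop b by (cases "b > 0") auto
  have inE: "\<alpha> + ?t i \<in> ?E \<longleftrightarrow> near \<delta> (real_vec (a *s v) \<bullet> \<alpha> + of_int s * real i / real n)" for \<alpha> i
  proof -
    have "of_int a * (real i / of_int b) = of_int s * real i / real n"
      using b by (cases "b > 0") (auto simp: s_def n(2))
    then have "real_vec (a *s v) \<bullet> (\<alpha> + ?t i) = real_vec (a *s v) \<bullet> \<alpha> + of_int s * real i / real n"
      using vu by (simp add: inner_add_right real_scale distrib_left mult.commute)
    then show ?thesis by (simp add: slab_def)
  qed
  have inE': "\<alpha> + ?t i \<in> ?E' \<longleftrightarrow> \<alpha> \<in> ?E'" for \<alpha> i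
  proof -
    have "real_vec (b *s v) \<bullet> (\<alpha> + ?t i) = real_vec (b *s v) \<bullet> \<alpha> + of_int (int i)"
      using b by (simp add: inner_add_right real_scale vu)
    then show ?thesis unfolding slab_def mem_Collect_eq by (simp only: near_int_shift)
  qed
  let ?f = "indicator (?E \<inter> ?E') :: real ^ 'n \<Rightarrow> ennreal"
  have per: "periodic ?f" by (intro periodic_indicator) (auto simp: slab_periodic)
  have "of_nat n * emeasure tor (?E \<inter> ?E') = (\<Sum>i<n. \<integral>\<^sup>+\<alpha>. ?f (\<alpha> + ?t i) \<partial>tor)"
    by (subst nn_integral_tor_shift[OF _ per]) auto
  also have "\<dots> = (\<integral>\<^sup>+\<alpha>. (\<Sum>i<n. ?f (\<alpha> + ?t i)) \<partial>tor)"
    by (rule nn_integral_sum[symmetric]) measurable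
  also have "\<dots> \<le> (\<integral>\<^sup>+\<alpha>. ennreal (2 * \<delta> * real n + 1) * indicator ?E' \<alpha> \<partial>tor)"
  proof (rule nn_integral_mono)
    fix \<alpha> :: "real ^ 'n"
    let ?S = "{i. i < n \<and> near \<delta> (real_vec (a *s v) \<bullet> \<alpha> + of_int s * real i / real n)}"
    have "(\<Sum>i<n. ?f (\<alpha> + ?t i)) = (\<Sum>i<n. indicator ?S i * indicator ?E' \<alpha>)"
      by (intro sum.cong) (auto simp: indicator_def inE inE')
    also have "\<dots> = (\<Sum>i<n. indicator ?S i) * indicator ?E' \<alpha>"
      by (rule sum_distrib_right[symmetric])
    also have "(\<Sum>i<n. indicator ?S i :: ennreal) = (\<Sum>i\<in>?S. 1)"
      by (rule sum.mono_neutral_cong_right) (auto simp: indicator_def)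
    also have "\<dots> * indicator ?E' \<alpha> = of_nat (card ?S) * indicator ?E' \<alpha>" by simp
    also have "\<dots> \<le> ennreal (2 * \<delta> * real n + 1) * indicator ?E' \<alpha>"
      using card_near_progression[OF \<open>coprime s (int n)\<close> n(1) d(1)]
      by (intro mult_right_mono) (auto simp: ennreal_of_nat_eq_real_of_nat intro!: ennreal_leI)
    finally show "(\<Sum>i<n. ?f (\<alpha> + ?t i)) \<le> ennreal (2 * \<delta> * real n + 1) * indicator ?E' \<alpha>" .
  qed
  also have "\<dots> = ennreal (2 * \<delta> * real n + 1) * emeasure tor ?E'"
    by (simp add: nn_integral_cmult)
  also have "\<dots> \<le> ennreal ((2 * \<delta> * real n + 1) * (2 * \<delta>'))"
    using prob_slab_le[OF k0 d(2)] d unfolding tor.emeasure_eq_measure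
    by (subst ennreal_mult[symmetric]) (auto intro!: ennreal_leI mult_left_mono)
  finally have "real n * tor.prob (?E \<inter> ?E') \<le> (2 * \<delta> * real n + 1) * (2 * \<delta>')"
    using d by (simp add: tor.emeasure_eq_measure ennreal_of_nat_eq_real_of_nat flip: ennreal_mult)
  then show ?thesis using n by (simp add: field_simps)
qed

text \<open>
In the proportional case \<open>k = a v\<close>, \<open>k' = b v\<close> the integers \<open>m\<close>, \<open>m'\<close> of a common point satisfy
\<open>a m' \<noteq> b m\<close>, since \<open>(k, m)\<close> and \<open>(k', m')\<close> are primitive and distinct up to sign.  Hence
\<open>1 \<le> |a m' - b m| \<le> |a| \<delta>' + |b| \<delta>\<close>, and the error term \<open>1 / |b|\<close> of
\<open>prob_slab_pair_proportional\<close>, or the one with the roles exchanged, is at most twice the main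
term.
\<close>

lemma prob_prim_slab_pair:
  fixes k k' :: "int ^ 'n"
  assumes k: "k \<noteq> 0" "k' \<noteq> 0" "k \<noteq> k'" "k \<noteq> - k'" and d: "0 \<le> \<delta>" "\<delta> \<le> 1/2" "0 \<le> \<delta>'"
  shows "tor.prob (prim_slab \<delta> k \<inter> prim_slab \<delta>' k') \<le> 8 * \<delta> * \<delta>'"
proof -
  have le: "tor.prob (prim_slab \<delta> k \<inter> prim_slab \<delta>' k') \<le> tor.prob (slab \<delta> k \<inter> slab \<delta>' k')"
    using prim_slab_subset by (intro tor.finite_measure_mono) auto
  show ?thesis using k(1,2)
  proof (cases rule: int_vec_cases)
    case (independent w)
    then have "tor.prob (slab \<delta> k \<inter> slab \<delta>' k') \<le> 2 * \<delta> * (2 * \<delta>')"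
      using mult_left_mono[OF prob_slab_le[OF k(2) d(3)], of "2 * \<delta>"] d
      by (subst prob_slab_pair_indep) auto
    moreover have "0 \<le> \<delta> * \<delta>'" using d by simp
    ultimately show ?thesis using le by linarith
  next
    case (proportional a b v)
    show ?thesis
    proof (cases "1 \<le> of_int \<bar>a\<bar> * \<delta>' + of_int \<bar>b\<bar> * \<delta>")
      case True
      have "1 \<le> 2 * (of_int \<bar>b\<bar> * \<delta>) \<or> 1 \<le> 2 * (of_int \<bar>a\<bar> * \<delta>')"
        using True by linarith
      then consider "1 / of_int \<bar>b\<bar> \<le> 2 * \<delta>" | "1 / of_int \<bar>a\<bar> \<le> 2 * \<delta>'"
        using proportional(2,3) by (auto simp: pos_divide_le_eq mult_ac)
      then show ?thesis
      proof cases
        case 1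
        have "tor.prob (slab \<delta> k \<inter> slab \<delta>' k') \<le> (2 * \<delta> + 1 / of_int \<bar>b\<bar>) * (2 * \<delta>')"
          unfolding proportional(5,6) using proportional d by (intro prob_slab_pair_proportional)
        also have "\<dots> \<le> (2 * \<delta> + 2 * \<delta>) * (2 * \<delta>')" using 1 d by (intro mult_right_mono) auto
        finally show ?thesis using le by simp
      next
        case 2
        have "tor.prob (slab \<delta>' k' \<inter> slab \<delta> k) \<le> (2 * \<delta>' + 1 / of_int \<bar>a\<bar>) * (2 * \<delta>)"
          unfolding proportional(5,6) using proportional d
          by (intro prob_slab_pair_proportional) (auto simp: coprime_commute)
        also have "\<dots> \<le> (2 * \<delta>' + 2 * \<delta>') * (2 * \<delta>)" using 2 d by (intro mult_right_mono) auto
        finally show ?thesis using le by (simp add: Int_commute mult_ac)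
      qed
    next
      case False
      have "prim_slab \<delta> k \<inter> prim_slab \<delta>' k' = {}"
      proof (rule ccontr)
        assume "prim_slab \<delta> k \<inter> prim_slab \<delta>' k' \<noteq> {}"
        then obtain \<alpha> m m' where g: "Gcd (insert m (range (\<lambda>i. k $ i))) = 1"
          and g': "Gcd (insert m' (range (\<lambda>i. k' $ i))) = 1"
          and m: "\<bar>real_vec k \<bullet> \<alpha> + of_int m\<bar> \<le> \<delta>" and m': "\<bar>real_vec k' \<bullet> \<alpha> + of_int m'\<bar> \<le> \<delta>'"
          unfolding prim_slab_def by blast
        define x where "x = real_vec v \<bullet> \<alpha>"
        have kx: "real_vec k \<bullet> \<alpha> = of_int a * x" "real_vec k' \<bullet> \<alpha> = of_int b * x"
          by (simp_all add: x_def proportional inner_vec_def sum_distrib_left mult.assoc)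
        have "of_int (a * m' - b * m) =
           of_int a * (of_int b * x + of_int m') - of_int b * (of_int a * x + of_int m)"
          by (simp add: algebra_simps)
        also have "\<bar>\<dots>\<bar> \<le> of_int \<bar>a\<bar> * \<delta>' + of_int \<bar>b\<bar> * \<delta>"
          using m m' unfolding kx
          by (intro order_trans[OF abs_triangle_ineq4]) (auto simp: abs_mult intro!: add_mono mult_left_mono)
        also have "\<dots> < 1" using False by simp
        finally have "a * m' = b * m" by linarith
        have "a dvd m" using \<open>a * m' = b * m\<close> proportional(1)
          by (metis coprime_dvd_mult_right_iff dvd_triv_left)
        then have "a dvd Gcd (insert m (range (\<lambda>i. k $ i)))"
          by (intro Gcd_greatest) (auto simp: proportional)
        then have a: "\<bar>a\<bar> = 1" unfolding g by simp
        have "b dvd a * m'" using \<open>a * m' = b * m\<close> by simp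
        then have "b dvd m'" using proportional(1)
          by (simp add: coprime_commute coprime_dvd_mult_right_iff)
        then have "b dvd Gcd (insert m' (range (\<lambda>i. k' $ i)))"
          by (intro Gcd_greatest) (auto simp: proportional)
        then have "\<bar>b\<bar> = 1" unfolding g' by simp
        with a have "a = b \<or> a = - b" by auto
        then show False using k(3,4) by (auto simp: proportional vec_eq_iff)
      qed
      then show ?thesis using d by simp
    qed
  qed
qed

section \<open>Irregular points\<close>

definition int_box :: "nat \<Rightarrow> (int ^ 'n) set" where
  "int_box q = {k. k \<noteq> 0 \<and> (\<forall>i. \<bar>k $ i\<bar> \<le> 2 ^ q)}"

definition near_count :: "nat \<Rightarrow> real \<Rightarrow> real ^ 'n \<Rightarrow> nat" where
  "near_count q \<delta> \<alpha> = card {k \<in> int_box q. \<alpha> \<in> slab \<delta> k}"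

lemma vec_in_set_eq: "{v :: 'a ^ 'n. \<forall>i. v $ i \<in> A i} = vec_lambda ` (PiE UNIV A)"
proof (intro equalityI subsetI)
  fix v assume "v \<in> {v :: 'a ^ 'n. \<forall>i. v $ i \<in> A i}"
  then have "v = vec_lambda (vec_nth v)" "vec_nth v \<in> PiE UNIV A" by auto
  then show "v \<in> vec_lambda ` (PiE UNIV A)" by blast
qed auto

lemma card_vec_in_set: "card {v :: 'a ^ 'n. \<forall>i. v $ i \<in> A i} = (\<Prod>i\<in>UNIV. card (A i))"
  unfolding vec_in_set_eq
  by (subst card_image) (auto simp: inj_on_def vec_lambda_inject card_PiE)

lemma finite_vec_in_set: "(\<And>i. finite (A i)) \<Longrightarrow> finite {v :: 'a ^ 'n. \<forall>i. v $ i \<in> A i}"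
  unfolding vec_in_set_eq by (intro finite_imageI finite_PiE) auto

lemma finite_abs_le_box: "finite {v :: int ^ 'n. \<forall>i. \<bar>v $ i\<bar> \<le> N}"
  and card_abs_le_box: "0 \<le> N \<Longrightarrow> real (card {v :: int ^ 'n. \<forall>i. \<bar>v $ i\<bar> \<le> N}) = (2 * of_int N + 1) ^ CARD('n)"
proof -
  have *: "{v :: int ^ 'n. \<forall>i. \<bar>v $ i\<bar> \<le> N} = {v. \<forall>i. v $ i \<in> (\<lambda>_. {-N..N}) i}"
    by (auto simp: abs_le_iff minus_le_iff)
  show "finite {v :: int ^ 'n. \<forall>i. \<bar>v $ i\<bar> \<le> N}" unfolding * by (rule finite_vec_in_set) simp
  show "real (card {v :: int ^ 'n. \<forall>i. \<bar>v $ i\<bar> \<le> N}) = (2 * of_int N + 1) ^ CARD('n)" if "0 \<le> N"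
    unfolding * card_vec_in_set using that by (simp add: of_nat_nat)
qed

lemma finite_int_box [simp]: "finite (int_box q)"
  by (rule finite_subset[OF _ finite_abs_le_box[of "2 ^ q"]]) (auto simp: int_box_def)

lemma card_int_box_le: "real (card (int_box q :: (int ^ 'n) set)) \<le> (3 * 2 ^ q) ^ CARD('n)"
proof -
  have "card (int_box q :: (int ^ 'n) set) \<le> card {v :: int ^ 'n. \<forall>i. \<bar>v $ i\<bar> \<le> 2 ^ q}"
    by (intro card_mono finite_abs_le_box) (auto simp: int_box_def)
  then have "real (card (int_box q :: (int ^ 'n) set)) \<le> (2 * 2 ^ q + 1) ^ CARD('n)"
    using card_abs_le_box[of "2 ^ q", where 'n = 'n] by simp
  also have "\<dots> \<le> (3 * 2 ^ q) ^ CARD('n)" by (intro power_mono) auto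
  finally show ?thesis .
qed

lemma card_int_box_ge: "(2 ^ q) ^ CARD('n) \<le> real (card (int_box q :: (int ^ 'n) set))"
proof -
  have "{v :: int ^ 'n. \<forall>i. v $ i \<in> {1..2 ^ q}} \<subseteq> int_box q"
  proof
    fix v :: "int ^ 'n" assume v: "v \<in> {v. \<forall>i. v $ i \<in> {1..2 ^ q}}"
    have v': "1 \<le> v $ i" "v $ i \<le> 2 ^ q" for i using v by auto
    have "\<bar>v $ i\<bar> \<le> 2 ^ q" for i using v'[of i] by linarith
    moreover have "v \<noteq> 0" using v'(1)[of undefined] by auto
    ultimately show "v \<in> int_box q" by (simp add: int_box_def)
  qed
  then have "card {v :: int ^ 'n. \<forall>i. v $ i \<in> {1..2 ^ q}} \<le> card (int_box q :: (int ^ 'n) set)"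
    by (rule card_mono[OF finite_int_box])
  then have "real (card {v :: int ^ 'n. \<forall>i. v $ i \<in> {1..2 ^ q}}) \<le> real (card (int_box q :: (int ^ 'n) set))"
    by simp
  then show ?thesis by (subst (asm) card_vec_in_set) (simp add: of_nat_nat)
qed

text \<open>
For \<open>|a| > 2\<^sup>q\<close> there is no such \<open>v\<close>; otherwise the count is at most the \<open>d\<close>-th power of
\<open>3 \<cdot> 2\<^sup>q / |a|\<close>.
\<close>

lemma card_scaled_box_le:
  fixes a :: int
  assumes "a \<noteq> 0"
  shows "real (card {v :: int ^ 'n. v \<noteq> 0 \<and> (\<forall>i. \<bar>a\<bar> * \<bar>v $ i\<bar> \<le> 2 ^ q)})
    \<le> (3 * 2 ^ q) ^ CARD('n) / of_int \<bar>a\<bar>"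
proof -
  let ?W = "{v :: int ^ 'n. v \<noteq> 0 \<and> (\<forall>i. \<bar>a\<bar> * \<bar>v $ i\<bar> \<le> 2 ^ q)}"
  define N where "N = (2 ^ q :: int) div \<bar>a\<bar>"
  have a: "\<bar>a\<bar> \<ge> 1" using assms by simp
  have le: "\<bar>x\<bar> \<le> N" if "\<bar>a\<bar> * \<bar>x\<bar> \<le> 2 ^ q" for x
    using zdiv_mono1[OF that, of "\<bar>a\<bar>"] a by (simp add: N_def)
  show ?thesis
  proof (cases "N \<ge> 1")
    case False
    have "v = 0" if "\<forall>i. \<bar>a\<bar> * \<bar>v $ i\<bar> \<le> 2 ^ q" for v :: "int ^ 'n"
    proof -
      have "v $ i = 0" for i using le[of "v $ i"] that False by force
      then show ?thesis by (simp add: vec_eq_iff)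
    qed
    then have "?W = {}" by blast
    then show ?thesis by (simp only:) simp
  next
    case True
    have "?W \<subseteq> {v. \<forall>i. \<bar>v $ i\<bar> \<le> N}" using le by auto
    then have "real (card ?W) \<le> (2 * of_int N + 1) ^ CARD('n)"
      using card_mono[OF finite_abs_le_box] True by (subst card_abs_le_box[symmetric]) auto
    also have "\<dots> \<le> (3 * (2 ^ q / of_int \<bar>a\<bar>)) ^ CARD('n)"
    proof (intro power_mono)
      have "real_of_int N \<le> of_int (2 ^ q) / of_int \<bar>a\<bar>"
        unfolding N_def by (rule real_of_int_div4)
      then show "2 * of_int N + 1 \<le> 3 * (2 ^ q / real_of_int \<bar>a\<bar>)" using True by simp
    qed (use True in auto)
    also have "\<dots> = (3 * 2 ^ q) ^ CARD('n) / of_int \<bar>a\<bar> ^ CARD('n)"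
      by (simp add: power_mult_distrib power_divide)
    also have "\<dots> \<le> (3 * 2 ^ q) ^ CARD('n) / of_int \<bar>a\<bar>"
      using a self_le_power[of "real_of_int \<bar>a\<bar>" "CARD('n)"] by (intro divide_left_mono) auto
    finally show ?thesis .
  qed
qed

lemma harmonic_dyadic_le: "(\<Sum>a = 1..2 ^ q. 1 / real_of_int a) \<le> real q + 1"
proof (induction q)
  case (Suc q)
  have "{1..2 ^ Suc q} = {1..2 ^ q} \<union> {2 ^ q + 1..2 ^ Suc q :: int}" by auto
  then have "(\<Sum>a = 1..2 ^ Suc q. 1 / real_of_int a) =
     (\<Sum>a = 1..2 ^ q. 1 / real_of_int a) + (\<Sum>a = 2 ^ q + 1..2 ^ Suc q. 1 / real_of_int a)"
    by (simp only:) (rule sum.union_disjoint, auto)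
  also have "(\<Sum>a = 2 ^ q + 1..2 ^ Suc q. 1 / real_of_int a) \<le> (\<Sum>a = 2 ^ q + 1..2 ^ Suc q :: int. 1 / 2 ^ q)"
  proof (intro sum_mono divide_left_mono)
    fix a :: int assume "a \<in> {2 ^ q + 1..2 ^ Suc q}"
    then have "2 ^ q \<le> a" by simp
    then have "of_int (2 ^ q) \<le> real_of_int a" by (simp only: of_int_le_iff)
    then show "2 ^ q \<le> real_of_int a" by simp
    then show "0 < real_of_int a * 2 ^ q" by (smt (verit) mult_pos_pos zero_less_power)
  qed auto
  also have "\<dots> = 1" by (simp add: of_nat_nat)
  finally show ?case using Suc by simp
qed simp

lemma sum_inverse_abs_le: "(\<Sum>a\<in>{-(2 ^ q)..2 ^ q} - {0}. 1 / real_of_int \<bar>a\<bar>) \<le> 2 * (real q + 1)"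
proof -
  have "{-(2 ^ q)..2 ^ q} - {0} = {1..2 ^ q} \<union> uminus ` {1..2 ^ q :: int}"
    by (force simp: image_iff)
  then have "(\<Sum>a\<in>{-(2 ^ q)..2 ^ q} - {0}. 1 / real_of_int \<bar>a\<bar>) =
     (\<Sum>a\<in>{1..2 ^ q}. 1 / real_of_int \<bar>a\<bar>) + (\<Sum>a\<in>uminus ` {1..2 ^ q}. 1 / real_of_int \<bar>a\<bar>)"
    by (simp only:) (rule sum.union_disjoint, auto)
  also have "(\<Sum>a\<in>uminus ` {1..2 ^ q}. 1 / real_of_int \<bar>a\<bar>) = (\<Sum>a\<in>{1..2 ^ q}. 1 / real_of_int \<bar>a\<bar>)"
    by (subst sum.reindex) auto
  also have "(\<Sum>a\<in>{1..2 ^ q}. 1 / real_of_int \<bar>a\<bar>) = (\<Sum>a = 1..2 ^ q. 1 / real_of_int a)"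
    by (intro sum.cong) auto
  finally show ?thesis using harmonic_dyadic_le[of q] by simp
qed

text \<open>
The first summand is what independence of all pairs would give.  Only proportional pairs
\<open>(a v, b v)\<close> exceed it, each by at most \<open>2 \<delta> / |b|\<close>; there are at most \<open>(3 \<cdot> 2\<^sup>q)\<^sup>d / |a|\<close> choices of \<open>v\<close>, and
the sum over \<open>a\<close> and \<open>b\<close> is a product of two harmonic sums.
\<close>

lemma sum_prob_slab_pairs_le:
  fixes q :: nat
  defines "B \<equiv> (int_box q :: (int ^ 'n) set)"
  assumes d: "0 \<le> \<delta>" "\<delta> \<le> 1/2"
  shows "(\<Sum>k\<in>B. \<Sum>k'\<in>B. tor.prob (slab \<delta> k \<inter> slab \<delta> k'))
    \<le> (2 * \<delta> * real (card B))\<^sup>2 + 2 * \<delta> * (3 * 2 ^ q) ^ CARD('n) * (2 * (real q + 1))\<^sup>2"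
proof -
  define I where "I = {-(2 ^ q)..2 ^ q :: int} - {0}"
  define V :: "int \<Rightarrow> (int ^ 'n) set" where "V a = {v. v \<noteq> 0 \<and> (\<forall>i. \<bar>a\<bar> * \<bar>v $ i\<bar> \<le> 2 ^ q)}" for a
  have finV: "finite (V a)" if "a \<in> I" for a
  proof (rule finite_subset[OF _ finite_abs_le_box[of "2 ^ q"]], rule subsetI)
    fix v :: "int ^ 'n" assume v: "v \<in> V a"
    have "\<bar>v $ i\<bar> \<le> \<bar>a\<bar> * \<bar>v $ i\<bar>" for i using that by (auto simp: I_def mult_le_cancel_right1)
    then show "v \<in> {v. \<forall>i. \<bar>v $ i\<bar> \<le> 2 ^ q}" using v order_trans by (fastforce simp: V_def)
  qed
  define T where "T = Sigma (I \<times> I) (\<lambda>(a, b). V a \<inter> V b)"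
  define g :: "(int \<times> int) \<times> (int ^ 'n) \<Rightarrow> _" where "g = (\<lambda>((a, b), v). (a *s v, b *s v))"
  define e :: "(int \<times> int) \<times> (int ^ 'n) \<Rightarrow> real" where "e = (\<lambda>((a, b), v). 2 * \<delta> / of_int \<bar>b\<bar>)"
  have finI: "finite I" by (simp add: I_def)
  have finT: "finite T" unfolding T_def using finI finV by (intro finite_SigmaI) auto
  have e0: "e t \<ge> 0" for t using d by (auto simp: e_def split: prod.splits)
  have gT: "g ` T \<subseteq> B \<times> B"
    by (auto simp: g_def T_def I_def V_def B_def int_box_def abs_mult vec_eq_iff)
  have pair: "tor.prob (slab \<delta> k \<inter> slab \<delta> k') \<le> (2 * \<delta>)\<^sup>2 + (\<Sum>t\<in>{t\<in>T. g t = (k, k')}. e t)"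
    if k: "k \<in> B" "k' \<in> B" for k k'
  proof -
    have s0: "0 \<le> (\<Sum>t\<in>{t\<in>T. g t = (k, k')}. e t)" by (intro sum_nonneg e0)
    have "k \<noteq> 0" "k' \<noteq> 0" using k by (auto simp: B_def int_box_def)
    then show ?thesis
    proof (cases rule: int_vec_cases)
      case (independent w)
      then have "tor.prob (slab \<delta> k \<inter> slab \<delta> k') = (2 * \<delta>)\<^sup>2"
        using d \<open>k' \<noteq> 0\<close> by (simp add: prob_slab_pair_indep prob_slab power2_eq_square)
      then show ?thesis using s0 by simp
    next
      case (proportional a b v)
      have le: "\<bar>c\<bar> \<le> 2 ^ q" if "\<forall>i. \<bar>c\<bar> * \<bar>v $ i\<bar> \<le> 2 ^ q" for c
      proof -
        obtain i where "v $ i \<noteq> 0" using proportional(4) by (auto simp: vec_eq_iff)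
        then have "\<bar>c\<bar> \<le> \<bar>c\<bar> * \<bar>v $ i\<bar>" by (auto simp: mult_le_cancel_left1)
        then show ?thesis using that[rule_format, of i] by linarith
      qed
      have va: "v \<in> V a" "v \<in> V b"
        using k proportional by (auto simp: B_def int_box_def V_def abs_mult)
      have "\<bar>a\<bar> \<le> 2 ^ q" "\<bar>b\<bar> \<le> 2 ^ q"
        by (rule le, use va in \<open>simp add: V_def\<close>)+
      then have ab: "a \<in> I" "b \<in> I"
        using proportional(2,3) unfolding I_def abs_le_iff by (auto simp: minus_le_iff)
      have "((a, b), v) \<in> T" using va ab by (simp add: T_def)
      moreover have "g ((a, b), v) = (k, k')" by (simp add: g_def proportional(5,6))
      ultimately have t: "((a, b), v) \<in> {t\<in>T. g t = (k, k')}" by simp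
      have "tor.prob (slab \<delta> k \<inter> slab \<delta> k') \<le> (2 * \<delta> + 1 / of_int \<bar>b\<bar>) * (2 * \<delta>)"
        unfolding proportional(5,6) using proportional d by (intro prob_slab_pair_proportional) auto
      also have "\<dots> = (2 * \<delta>)\<^sup>2 + e ((a, b), v)" by (simp add: e_def power2_eq_square algebra_simps)
      also have "e ((a, b), v) \<le> (\<Sum>t\<in>{t\<in>T. g t = (k, k')}. e t)"
        using finT e0 by (intro member_le_sum[OF t]) auto
      finally show ?thesis by simp
    qed
  qed
  have "(\<Sum>k\<in>B. \<Sum>k'\<in>B. tor.prob (slab \<delta> k \<inter> slab \<delta> k'))
      \<le> (\<Sum>k\<in>B. \<Sum>k'\<in>B. (2 * \<delta>)\<^sup>2 + (\<Sum>t\<in>{t\<in>T. g t = (k, k')}. e t))"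
    by (intro sum_mono pair)
  also have "\<dots> = (\<Sum>k\<in>B. \<Sum>k'\<in>B. (2 * \<delta>)\<^sup>2) + (\<Sum>p\<in>B \<times> B. \<Sum>t\<in>{t\<in>T. g t = p}. e t)"
    by (simp only: sum.distrib sum.cartesian_product case_prod_eta split_def prod.collapse)
  also have "(\<Sum>p\<in>B \<times> B. \<Sum>t\<in>{t\<in>T. g t = p}. e t) = (\<Sum>t\<in>T. e t)"
    using gT finT by (intro sum.group) (auto simp: B_def)
  also have "(\<Sum>t\<in>T. e t) = (\<Sum>(a, b)\<in>I \<times> I. \<Sum>v\<in>V a \<inter> V b. 2 * \<delta> / of_int \<bar>b\<bar>)"
    unfolding T_def e_def using finI finV
    by (subst sum.Sigma[symmetric]) (auto intro!: sum.cong)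
  also have "\<dots> \<le> (\<Sum>(a, b)\<in>I \<times> I. (3 * 2 ^ q) ^ CARD('n) * (2 * \<delta>) * (1 / of_int \<bar>a\<bar> * (1 / of_int \<bar>b\<bar>)))"
  proof (intro sum_mono, clarify)
    fix a b assume ab: "a \<in> I" "b \<in> I"
    have "real (card (V a \<inter> V b)) \<le> real (card (V a))"
      using finV ab by (intro of_nat_mono card_mono) auto
    also have "\<dots> \<le> (3 * 2 ^ q) ^ CARD('n) / of_int \<bar>a\<bar>"
      unfolding V_def using ab by (intro card_scaled_box_le) (auto simp: I_def)
    finally have "real (card (V a \<inter> V b)) * (2 * \<delta> / of_int \<bar>b\<bar>)
      \<le> (3 * 2 ^ q) ^ CARD('n) / of_int \<bar>a\<bar> * (2 * \<delta> / of_int \<bar>b\<bar>)"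
      using d by (intro mult_right_mono) auto
    then show "(\<Sum>v\<in>V a \<inter> V b. 2 * \<delta> / of_int \<bar>b\<bar>)
      \<le> (3 * 2 ^ q) ^ CARD('n) * (2 * \<delta>) * (1 / of_int \<bar>a\<bar> * (1 / of_int \<bar>b\<bar>))"
      by simp
  qed
  also have "\<dots> = (3 * 2 ^ q) ^ CARD('n) * (2 * \<delta>) * (\<Sum>(a, b)\<in>I \<times> I. 1 / of_int \<bar>a\<bar> * (1 / of_int \<bar>b\<bar>))"
    by (simp only: sum_distrib_left split_def)
  also have "(\<Sum>(a, b)\<in>I \<times> I. 1 / of_int \<bar>a\<bar> * (1 / of_int \<bar>b\<bar>)) = (\<Sum>a\<in>I. 1 / real_of_int \<bar>a\<bar>)\<^sup>2"
    by (simp only: power2_eq_square sum_product sum.cartesian_product)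
  also have "(3 * 2 ^ q) ^ CARD('n) * (2 * \<delta>) * (\<Sum>a\<in>I. 1 / real_of_int \<bar>a\<bar>)\<^sup>2
      \<le> (3 * 2 ^ q) ^ CARD('n) * (2 * \<delta>) * (2 * (real q + 1))\<^sup>2"
    unfolding I_def using d
    by (intro mult_left_mono power_mono sum_inverse_abs_le sum_nonneg) auto
  finally show ?thesis by (simp add: power2_eq_square mult_ac)
qed

lemma near_count_eq_sum:
  "real (near_count q \<delta> \<alpha>) = (\<Sum>k\<in>int_box q. indicator (slab \<delta> k) \<alpha>)"
proof -
  have "real (near_count q \<delta> \<alpha>) = (\<Sum>k\<in>{k \<in> int_box q. \<alpha> \<in> slab \<delta> k}. 1)"
    by (simp add: near_count_def)
  also have "\<dots> = (\<Sum>k\<in>int_box q. indicator (slab \<delta> k) \<alpha>)"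
    by (rule sum.mono_neutral_cong_left) (auto simp: indicator_def)
  finally show ?thesis .
qed

lemma near_count_measurable [measurable]: "near_count q \<delta> \<in> borel \<rightarrow>\<^sub>M count_space UNIV"
proof -
  have "(\<lambda>\<alpha>. real (near_count q \<delta> \<alpha>)) \<in> borel_measurable borel"
    unfolding near_count_eq_sum by measurable
  then have *: "(\<lambda>\<alpha>. \<lfloor>real (near_count q \<delta> \<alpha>)\<rfloor>) \<in> borel \<rightarrow>\<^sub>M count_space UNIV"
    by measurable
  then have "(\<lambda>\<alpha>. nat \<lfloor>real (near_count q \<delta> \<alpha>)\<rfloor>) \<in> borel \<rightarrow>\<^sub>M count_space UNIV"
    by (rule measurable_compose) simp
  then show ?thesis by simp
qed

text \<open>
Chebyshev's inequality: by the preceding lemma the variance of the count is smaller than the square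
of its mean by a factor of order \<open>\<delta> (2\<^sup>q)\<^sup>d / q\<^sup>2\<close>.
\<close>

lemma prob_near_count_large:
  assumes d: "0 < \<delta>" "\<delta> \<le> 1/2"
  shows "tor.prob {\<alpha> :: real ^ 'n. real (near_count q \<delta> \<alpha>) > 4 * \<delta> * (3 * 2 ^ q) ^ CARD('n)}
    \<le> 2 * 3 ^ CARD('n) * (real q + 1)\<^sup>2 / (\<delta> * (2 ^ q) ^ CARD('n))"
proof -
  define B where "B = (int_box q :: (int ^ 'n) set)"
  define M where "M = real (card B)"
  define X where "X = (\<lambda>\<alpha> :: real ^ 'n. real (near_count q \<delta> \<alpha>))"
  let ?D = "(2 ^ q) ^ CARD('n) :: real"
  have M: "?D \<le> M" "M \<le> (3 * 2 ^ q) ^ CARD('n)"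
    unfolding M_def B_def by (rule card_int_box_ge, rule card_int_box_le)
  have D0: "?D > 0" by simp
  have M0: "M > 0" using M(1) D0 by linarith
  have finB: "finite B" by (simp add: B_def)
  have Xm [measurable]: "X \<in> borel_measurable tor" unfolding X_def by measurable
  have Xsum: "X \<alpha> = (\<Sum>k\<in>B. indicator (slab \<delta> k) \<alpha>)" for \<alpha>
    unfolding X_def B_def by (rule near_count_eq_sum)
  have Xle: "\<bar>X \<alpha>\<bar> \<le> M" for \<alpha>
    unfolding X_def M_def B_def near_count_def by (simp add: card_mono)
  have intX: "integrable tor X"
    by (rule tor.integrable_const_bound[where B = M]) (use Xle in auto)
  have "X \<alpha> ^ 2 \<le> M ^ 2" for \<alpha> using Xle[of \<alpha>] by (simp add: abs_le_square_iff[symmetric] M_def)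
  then have intX2: "integrable tor (\<lambda>\<alpha>. X \<alpha> ^ 2)"
    by (intro tor.integrable_const_bound[where B = "M ^ 2"]) auto
  have EX: "tor.expectation X = 2 * \<delta> * M"
  proof -
    have "tor.expectation X = (\<Sum>k\<in>B. tor.prob (slab \<delta> k))"
      unfolding Xsum by (subst Bochner_Integration.integral_sum) (auto simp: tor.emeasure_eq_measure)
    also have "\<dots> = (\<Sum>k\<in>B. 2 * \<delta>)"
      using d by (intro sum.cong prob_slab) (auto simp: B_def int_box_def)
    finally show ?thesis by (simp add: M_def)
  qed
  have "tor.expectation (\<lambda>\<alpha>. X \<alpha> ^ 2) = (\<Sum>k\<in>B. \<Sum>k'\<in>B. tor.prob (slab \<delta> k \<inter> slab \<delta> k'))"
  proof -
    have "X \<alpha> ^ 2 = (\<Sum>k\<in>B. \<Sum>k'\<in>B. indicator (slab \<delta> k \<inter> slab \<delta> k') \<alpha>)" for \<alpha>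
      by (simp only: Xsum power2_eq_square sum_product indicator_inter_arith)
    then show ?thesis
      by (simp add: Bochner_Integration.integral_sum tor.emeasure_eq_measure)
  qed
  also have "\<dots> \<le> (2 * \<delta> * M)\<^sup>2 + 2 * \<delta> * (3 * 2 ^ q) ^ CARD('n) * (2 * (real q + 1))\<^sup>2"
    unfolding B_def M_def using d by (intro sum_prob_slab_pairs_le) auto
  finally have var: "tor.variance X \<le> 2 * \<delta> * (3 * 2 ^ q) ^ CARD('n) * (2 * (real q + 1))\<^sup>2"
    using intX intX2 by (subst tor.variance_eq) (auto simp: EX)
  have "tor.prob {\<alpha> :: real ^ 'n. real (near_count q \<delta> \<alpha>) > 4 * \<delta> * (3 * 2 ^ q) ^ CARD('n)}
     \<le> tor.prob {\<alpha> \<in> space tor. 2 * \<delta> * M \<le> \<bar>X \<alpha> - tor.expectation X\<bar>}"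
  proof (intro tor.finite_measure_mono subsetI)
    fix \<alpha> :: "real ^ 'n" assume "\<alpha> \<in> {\<alpha>. real (near_count q \<delta> \<alpha>) > 4 * \<delta> * (3 * 2 ^ q) ^ CARD('n)}"
    moreover have "4 * \<delta> * M \<le> 4 * \<delta> * (3 * 2 ^ q) ^ CARD('n)" using M d by (intro mult_left_mono) auto
    ultimately have "X \<alpha> \<ge> 4 * \<delta> * M" by (simp add: X_def)
    then show "\<alpha> \<in> {\<alpha> \<in> space tor. 2 * \<delta> * M \<le> \<bar>X \<alpha> - tor.expectation X\<bar>}"
      unfolding EX by simp
  qed measurable
  also have "\<dots> \<le> tor.variance X / (2 * \<delta> * M)\<^sup>2"
    using intX2 d M0 by (intro tor.Chebyshev_inequality) auto
  also have "\<dots> \<le> (2 * \<delta> * (3 * 2 ^ q) ^ CARD('n) * (2 * (real q + 1))\<^sup>2) / (2 * \<delta> * ?D)\<^sup>2"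
    using var M d D0 by (intro frac_le) (auto intro!: power_mono mult_left_mono)
  also have "\<dots> = 2 * 3 ^ CARD('n) * (real q + 1)\<^sup>2 / (\<delta> * ?D)"
    using d by (simp add: power_mult_distrib power2_eq_square field_simps)
  finally show ?thesis .
qed

section \<open>Chains of hits\<close>

definition shell :: "nat \<Rightarrow> (int ^ 'n) set" where
  "shell q = {k. (\<forall>i. \<bar>k $ i\<bar> \<le> 2 ^ q) \<and> (\<exists>i. 2 ^ q < 2 * \<bar>k $ i\<bar>)}"

definition shell_hits :: "nat \<Rightarrow> real \<Rightarrow> real ^ 'n \<Rightarrow> nat" where
  "shell_hits q \<theta> \<alpha> = card {k \<in> shell q. \<alpha> \<in> slab (\<theta> / (2 ^ q) ^ CARD('n)) k}"

text \<open>
The points at which the number of \<open>k\<close> with \<open>k \<bullet> \<alpha>\<close> close to an integer has the expected order of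
magnitude.  The closeness is governed by \<open>\<gamma>\<close> and the bound by \<open>V\<close>, so that \<open>\<gamma>\<close> can shrink in the
course of an argument while the bound stays fixed.
\<close>

definition regular :: "real \<Rightarrow> real \<Rightarrow> nat \<Rightarrow> (real ^ 'n) set" where
  "regular V \<gamma> q = {\<alpha>. real (near_count q (\<gamma> / (2 ^ q) ^ CARD('n)) \<alpha>) \<le> 4 * 3 ^ CARD('n) * V}"

text \<open>
The number of ways to choose one hit, primitive or not, in each of the shells in \<open>qs\<close>, where points
that are irregular for one of these shells do not count.
\<close>

definition chain_weight :: "real \<Rightarrow> real \<Rightarrow> real \<Rightarrow> nat list \<Rightarrow> real ^ 'n \<Rightarrow> ennreal" where
  "chain_weight V \<theta> \<gamma> qs \<alpha> =
    (\<Prod>q\<leftarrow>qs. indicator (regular V \<gamma> q) \<alpha> * of_nat (shell_hits q \<theta> \<alpha>))"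

lemma shell_subset_int_box: "shell q \<subseteq> int_box q"
proof
  fix k :: "int ^ 'n" assume k: "k \<in> shell q"
  then obtain i where "2 ^ q < 2 * \<bar>k $ i\<bar>" by (auto simp: shell_def)
  then have "k \<noteq> 0" by (auto simp: not_less)
  then show "k \<in> int_box q" using k by (simp add: shell_def int_box_def)
qed

lemma finite_shell [simp]: "finite (shell q)"
  by (rule finite_subset[OF shell_subset_int_box finite_int_box])

lemma card_shell_le: "real (card (shell q :: (int ^ 'n) set)) \<le> (3 * 2 ^ q) ^ CARD('n)"
  using card_int_box_le[of q] card_mono[OF finite_int_box shell_subset_int_box]
  by (meson of_nat_le_iff order_trans)

lemma card_filter_eq_sum:
  "finite A \<Longrightarrow> of_nat (card {k \<in> A. x \<in> S k}) = (\<Sum>k\<in>A. indicator (S k) x :: 'b :: semiring_1)"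
  by (simp add: indicator_def sum.If_cases Int_def)

lemma shell_hits_eq_sum:
  "(of_nat (shell_hits q \<theta> \<alpha>) :: ennreal)
    = (\<Sum>k\<in>shell q. indicator (slab (\<theta> / (2 ^ q) ^ CARD('n)) k) (\<alpha> :: real ^ 'n))"
  unfolding shell_hits_def by (rule card_filter_eq_sum) simp

lemma shell_hits_measurable [measurable]:
  "(\<lambda>\<alpha> :: real ^ 'n. of_nat (shell_hits q \<theta> \<alpha>) :: ennreal) \<in> borel_measurable borel"
  unfolding shell_hits_eq_sum by measurable

lemma regular_sets [measurable]: "regular V \<gamma> q \<in> sets borel"
  unfolding regular_def by measurable

lemma chain_weight_measurable [measurable]: "chain_weight V \<theta> \<gamma> qs \<in> borel_measurable borel"
  unfolding chain_weight_def by (induction qs) auto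

lemma near_count_periodic: "near_count q \<delta> (\<alpha> + real_vec z) = near_count q \<delta> \<alpha>"
  by (simp add: near_count_def slab_periodic)

lemma regular_periodic: "\<alpha> + real_vec z \<in> regular V \<gamma> q \<longleftrightarrow> \<alpha> \<in> regular V \<gamma> q"
  by (simp add: regular_def near_count_periodic)

lemma chain_weight_periodic: "periodic (chain_weight V \<theta> \<gamma> qs)"
  by (auto simp: periodic_def chain_weight_def shell_hits_def slab_periodic regular_periodic
      indicator_def)

lemma chain_weight_Cons:
  "chain_weight V \<theta> \<gamma> (q # qs) \<alpha> =
    indicator (regular V \<gamma> q) \<alpha> * of_nat (shell_hits q \<theta> \<alpha>) * chain_weight V \<theta> \<gamma> qs \<alpha>"
  by (simp add: chain_weight_def)

lemma slab_shift:
  assumes "\<alpha> + \<beta> *\<^sub>R axis i 1 \<in> slab \<delta> k" and "\<bar>\<beta>\<bar> * of_int \<bar>k $ i\<bar> \<le> \<epsilon>" and "\<delta> + \<epsilon> \<le> \<delta>'"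
  shows "\<alpha> \<in> slab \<delta>' k"
proof -
  have "real_vec k \<bullet> (\<alpha> + \<beta> *\<^sub>R axis i 1) = real_vec k \<bullet> \<alpha> + \<beta> * of_int (k $ i)"
    by (simp add: inner_add_right inner_axis)
  moreover have "\<bar>real_vec k \<bullet> \<alpha> - (real_vec k \<bullet> \<alpha> + \<beta> * of_int (k $ i))\<bar> \<le> \<epsilon>"
    using assms(2) by (simp add: abs_mult)
  ultimately show ?thesis
    using assms(1,3) near_perturb unfolding slab_def mem_Collect_eq by metis
qed

text \<open>
A shift by \<open>\<beta>\<close> moves \<open>k \<bullet> \<alpha>\<close> by at most \<open>\<beta> 2\<^sup>q\<close>, so a point close to a regular one has no more \<open>k\<close> to
count, provided that the closeness demanded of \<open>k \<bullet> \<alpha>\<close> is halved.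
\<close>

lemma regular_shift:
  fixes \<alpha> :: "real ^ 'n"
  assumes "\<alpha> + \<beta> *\<^sub>R axis i 1 \<in> regular V \<gamma> q" "0 \<le> \<beta>" "\<beta> * 2 ^ q \<le> \<gamma> / 2 / (2 ^ q) ^ CARD('n)"
  shows "\<alpha> \<in> regular V (\<gamma> / 2) q"
proof -
  let ?D = "(2 ^ q) ^ CARD('n) :: real"
  have "\<alpha> + \<beta> *\<^sub>R axis i 1 \<in> slab (\<gamma> / ?D) k"
    if k: "k \<in> int_box q" "\<alpha> \<in> slab (\<gamma> / 2 / ?D) k" for k
  proof (rule slab_shift)
    show "(\<alpha> + \<beta> *\<^sub>R axis i 1) + (- \<beta>) *\<^sub>R axis i 1 \<in> slab (\<gamma> / 2 / ?D) k" using k by simp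
    have "\<bar>k $ i\<bar> \<le> 2 ^ q" using k by (simp add: int_box_def)
    then have "of_int \<bar>k $ i\<bar> \<le> real_of_int (2 ^ q)" by (simp only: of_int_le_iff)
    then have "\<bar>- \<beta>\<bar> * of_int \<bar>k $ i\<bar> \<le> \<beta> * 2 ^ q"
      using assms(2) by (auto intro: mult_left_mono)
    then show "\<bar>- \<beta>\<bar> * of_int \<bar>k $ i\<bar> \<le> \<gamma> / 2 / ?D" using assms(3) by simp
  qed (simp add: field_simps)
  then have "near_count q (\<gamma> / 2 / ?D) \<alpha> \<le> near_count q (\<gamma> / ?D) (\<alpha> + \<beta> *\<^sub>R axis i 1)"
    unfolding near_count_def by (intro card_mono) auto
  then show ?thesis using assms(1) by (simp add: regular_def)
qed

text \<open>
The inductive step for chains of hits.  Here \<open>h\<close> stands for hits in lower shells, and \<open>h'\<close> for the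
same hits with a larger tolerance, which makes them stable under the shifts considered.  For each
\<open>k\<close> in the shell the integral is averaged over shifts of length up to \<open>\<rho>\<close> along the coordinate in
which \<open>k\<close> is largest: during such a shift \<open>k \<bullet> \<alpha>\<close> is near an integer for a proportion of order
\<open>\<theta> / \<gamma>\<close> of the time, and this happens at all only if \<open>k\<close> is counted in the definition of
\<open>regular\<close>.
\<close>

lemma nn_integral_shell_hits_le:
  fixes h h' :: "real ^ 'n \<Rightarrow> ennreal"
  defines "D q \<equiv> (2 ^ q) ^ CARD('n) :: real"
  assumes [measurable]: "h \<in> borel_measurable borel" "h' \<in> borel_measurable borel" and per: "periodic h"
    and \<theta>: "0 < \<theta>" "4 * \<theta> \<le> \<gamma>" "\<gamma> \<le> D q" and V: "0 \<le> V"
    and stable: "\<And>\<alpha> \<beta> i. 0 \<le> \<beta> \<Longrightarrow> \<beta> \<le> \<gamma> / (4 * 2 ^ q * D q) \<Longrightarrow> h (\<alpha> + \<beta> *\<^sub>R axis i 1) \<le> h' \<alpha>"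
  shows "(\<integral>\<^sup>+\<alpha>. h \<alpha> * indicator (regular V \<gamma> q) \<alpha> * of_nat (shell_hits q \<theta> \<alpha>) \<partial>tor)
    \<le> ennreal (64 * 3 ^ CARD('n) * V * \<theta> / \<gamma>) * (\<integral>\<^sup>+\<alpha>. h' \<alpha> \<partial>tor)"
proof -
  define \<rho> where "\<rho> = \<gamma> / (4 * 2 ^ q * D q)"
  define \<eta> where "\<eta> = \<theta> / D q"
  define i where "i k = (SOME i. 2 ^ q < 2 * \<bar>k $ i\<bar>)" for k :: "int ^ 'n"
  let ?R = "indicator (regular V \<gamma> q) :: real ^ 'n \<Rightarrow> ennreal"
  let ?R' = "indicator (regular V (\<gamma> / 2) q) :: real ^ 'n \<Rightarrow> ennreal"
  define f where "f k \<alpha> = h \<alpha> * ?R \<alpha> * indicator (slab \<eta> k) \<alpha>" for k \<alpha>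
  have D: "D q \<ge> 1" by (simp add: D_def)
  have \<rho>: "\<rho> > 0" using \<theta> D by (simp add: \<rho>_def)
  have \<rho>Q: "\<rho> * 2 ^ q = \<gamma> / 4 / D q" by (simp add: \<rho>_def field_simps)
  have i: "2 ^ q < 2 * \<bar>k $ i k\<bar>" if "k \<in> shell q" for k
    unfolding i_def by (rule someI_ex) (use that in \<open>auto simp: shell_def\<close>)
  have step: "ennreal \<rho> * (\<integral>\<^sup>+\<alpha>. f k \<alpha> \<partial>tor)
      \<le> (\<integral>\<^sup>+\<alpha>. h' \<alpha> * ?R' \<alpha> * indicator (slab (\<gamma> / 2 / D q) k) \<alpha> * ennreal (4 * \<eta> / 2 ^ q) \<partial>tor)"
    if k: "k \<in> shell q" for k
  proof -
    let ?e = "axis (i k) (1 :: real)"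
    have ki: "real_of_int \<bar>k $ i k\<bar> \<le> 2 ^ q" "2 ^ q \<le> 2 * real_of_int \<bar>k $ i k\<bar>"
    proof -
      have "\<bar>k $ i k\<bar> \<le> 2 ^ q" using k by (simp add: shell_def)
      then have "real_of_int \<bar>k $ i k\<bar> \<le> of_int (2 ^ q)" by (simp only: of_int_le_iff)
      then show "real_of_int \<bar>k $ i k\<bar> \<le> 2 ^ q" by simp
      have "real_of_int (2 ^ q) \<le> of_int (2 * \<bar>k $ i k\<bar>)" using i[OF k] by (simp only: of_int_le_iff)
      then show "2 ^ q \<le> 2 * real_of_int \<bar>k $ i k\<bar>" by simp
    qed
    then have ki0: "real_of_int \<bar>k $ i k\<bar> > 0" by (smt (verit) zero_less_power)
    have "periodic (f k)"
      unfolding f_def by (intro periodic_mult per periodic_indicator slab_periodic regular_periodic)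
    moreover have "f k \<in> borel_measurable borel" unfolding f_def by measurable
    ultimately have "emeasure lborel {0..\<rho>} * (\<integral>\<^sup>+\<alpha>. f k \<alpha> \<partial>tor) =
      (\<integral>\<^sup>+\<alpha>. (\<integral>\<^sup>+\<beta>. f k (\<alpha> + \<beta> *\<^sub>R ?e) * indicator {0..\<rho>} \<beta> \<partial>lborel) \<partial>tor)"
      by (intro nn_integral_tor_shift_average) auto
    also have "\<dots> \<le> (\<integral>\<^sup>+\<alpha>. h' \<alpha> * ?R' \<alpha> * indicator (slab (\<gamma> / 2 / D q) k) \<alpha> * ennreal (4 * \<eta> / 2 ^ q) \<partial>tor)"
    proof (rule nn_integral_mono)
      fix \<alpha> :: "real ^ 'n"
      let ?c = "h' \<alpha> * ?R' \<alpha> * indicator (slab (\<gamma> / 2 / D q) k) \<alpha>"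
      let ?N = "{\<beta>. near \<eta> (real_vec k \<bullet> \<alpha> + \<beta> * of_int (k $ i k))}"
      have "f k (\<alpha> + \<beta> *\<^sub>R ?e) * indicator {0..\<rho>} \<beta> \<le> ?c * (indicator ?N \<beta> * indicator {0..\<rho>} \<beta>)" for \<beta>
      proof (cases "\<beta> \<in> {0..\<rho>} \<and> \<alpha> + \<beta> *\<^sub>R ?e \<in> regular V \<gamma> q \<and> \<alpha> + \<beta> *\<^sub>R ?e \<in> slab \<eta> k")
        case True
        then have \<beta>: "0 \<le> \<beta>" "\<beta> \<le> \<rho>" by auto
        have b: "\<beta> * 2 ^ q \<le> \<gamma> / 4 / D q"
          unfolding \<rho>Q[symmetric] using \<beta> by (intro mult_right_mono) auto
        have "0 \<le> \<gamma> / D q" using \<theta> D by simp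
        then have "\<alpha> \<in> regular V (\<gamma> / 2) q"
          using True \<beta> b by (intro regular_shift[of \<alpha> \<beta> "i k"]) (auto simp: D_def)
        moreover have "\<alpha> \<in> slab (\<gamma> / 2 / D q) k"
        proof (rule slab_shift)
          show "\<alpha> + \<beta> *\<^sub>R ?e \<in> slab \<eta> k" using True by simp
          have "\<bar>\<beta>\<bar> * of_int \<bar>k $ i k\<bar> \<le> \<beta> * 2 ^ q" using ki \<beta> by (auto intro: mult_left_mono)
          then show "\<bar>\<beta>\<bar> * of_int \<bar>k $ i k\<bar> \<le> \<gamma> / 4 / D q" using b by simp
          have "\<eta> \<le> \<gamma> / 4 / D q" unfolding \<eta>_def using \<theta> D by (intro divide_right_mono) auto
          then show "\<eta> + \<gamma> / 4 / D q \<le> \<gamma> / 2 / D q" by simp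
        qed
        moreover have "\<beta> \<in> ?N" using True by (simp add: slab_def inner_add_right inner_axis)
        moreover have "h (\<alpha> + \<beta> *\<^sub>R ?e) \<le> h' \<alpha>"
          using stable[of \<beta> \<alpha> "i k"] \<beta> by (simp add: \<rho>_def)
        ultimately show ?thesis using True by (simp add: f_def)
      qed (auto simp: f_def indicator_def)
      then have "(\<integral>\<^sup>+\<beta>. f k (\<alpha> + \<beta> *\<^sub>R ?e) * indicator {0..\<rho>} \<beta> \<partial>lborel)
        \<le> (\<integral>\<^sup>+\<beta>. ?c * (indicator ?N \<beta> * indicator {0..\<rho>} \<beta>) \<partial>lborel)"
        by (intro nn_integral_mono)
      also have "\<dots> = ?c * (\<integral>\<^sup>+\<beta>. indicator ?N \<beta> * indicator {0..\<rho>} \<beta> \<partial>lborel)"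
        by (rule nn_integral_cmult) measurable
      also have "\<dots> \<le> ?c * ennreal (2 * \<eta> / \<bar>of_int (k $ i k)\<bar>)"
      proof (intro mult_left_mono nn_integral_near_le)
        have "\<eta> \<le> \<gamma> / 4 / D q" unfolding \<eta>_def using \<theta> D by (intro divide_right_mono) auto
        moreover have "\<rho> * \<bar>real_of_int (k $ i k)\<bar> \<le> \<gamma> / 4 / D q"
          unfolding \<rho>Q[symmetric] using ki \<rho> by (intro mult_left_mono) auto
        moreover have "\<gamma> / D q \<le> 1" using \<theta> D by (simp add: divide_le_eq)
        ultimately show "2 * \<eta> + \<rho> * \<bar>real_of_int (k $ i k)\<bar> < 1" by simp
      qed (use ki0 \<theta> D in \<open>auto simp: \<eta>_def\<close>)
      also have "\<dots> \<le> ?c * ennreal (4 * \<eta> / 2 ^ q)"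
      proof (intro mult_left_mono ennreal_leI)
        have "\<eta> \<ge> 0" using \<theta> D by (simp add: \<eta>_def)
        then have "2 * \<eta> * 2 ^ q \<le> 2 * \<eta> * (2 * real_of_int \<bar>k $ i k\<bar>)" using ki by (intro mult_left_mono) auto
        then show "2 * \<eta> / \<bar>real_of_int (k $ i k)\<bar> \<le> 4 * \<eta> / 2 ^ q"
          using ki0 by (simp add: field_simps)
      qed auto
      finally show "(\<integral>\<^sup>+\<beta>. f k (\<alpha> + \<beta> *\<^sub>R ?e) * indicator {0..\<rho>} \<beta> \<partial>lborel) \<le> ?c * ennreal (4 * \<eta> / 2 ^ q)" .
    qed
    finally show ?thesis using \<rho> by simp
  qed
  have "ennreal \<rho> * (\<integral>\<^sup>+\<alpha>. h \<alpha> * ?R \<alpha> * of_nat (shell_hits q \<theta> \<alpha>) \<partial>tor)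
     = (\<Sum>k\<in>shell q. ennreal \<rho> * (\<integral>\<^sup>+\<alpha>. f k \<alpha> \<partial>tor))"
    unfolding f_def shell_hits_eq_sum sum_distrib_left \<eta>_def D_def
    by (subst nn_integral_sum) (auto simp: sum_distrib_left)
  also have "\<dots> \<le> (\<Sum>k\<in>shell q. \<integral>\<^sup>+\<alpha>. h' \<alpha> * ?R' \<alpha> * indicator (slab (\<gamma> / 2 / D q) k) \<alpha> * ennreal (4 * \<eta> / 2 ^ q) \<partial>tor)"
    by (intro sum_mono step)
  also have "\<dots> = (\<integral>\<^sup>+\<alpha>. (\<Sum>k\<in>shell q. h' \<alpha> * ?R' \<alpha> * indicator (slab (\<gamma> / 2 / D q) k) \<alpha> * ennreal (4 * \<eta> / 2 ^ q)) \<partial>tor)"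
    by (subst nn_integral_sum) auto
  also have "\<dots> \<le> (\<integral>\<^sup>+\<alpha>. ennreal (4 * 3 ^ CARD('n) * V * (4 * \<eta> / 2 ^ q)) * h' \<alpha> \<partial>tor)"
  proof (rule nn_integral_mono)
    fix \<alpha> :: "real ^ 'n"
    let ?n = "card {k \<in> shell q. \<alpha> \<in> slab (\<gamma> / 2 / D q) k}"
    have "(\<Sum>k\<in>shell q. h' \<alpha> * ?R' \<alpha> * indicator (slab (\<gamma> / 2 / D q) k) \<alpha> * ennreal (4 * \<eta> / 2 ^ q))
        = (\<Sum>k\<in>shell q. indicator (slab (\<gamma> / 2 / D q) k) \<alpha>) * (h' \<alpha> * ?R' \<alpha> * ennreal (4 * \<eta> / 2 ^ q))"
      by (subst sum_distrib_right, intro sum.cong refl, simp only: mult_ac)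
    also have "(\<Sum>k\<in>shell q. indicator (slab (\<gamma> / 2 / D q) k) \<alpha>) = (of_nat ?n :: ennreal)"
      by (rule card_filter_eq_sum[symmetric]) simp
    also have "of_nat ?n * (h' \<alpha> * ?R' \<alpha> * ennreal (4 * \<eta> / 2 ^ q))
        \<le> ennreal (4 * 3 ^ CARD('n) * V) * (h' \<alpha> * ennreal (4 * \<eta> / 2 ^ q))"
    proof (cases "\<alpha> \<in> regular V (\<gamma> / 2) q")
      case True
      have "?n \<le> near_count q (\<gamma> / 2 / D q) \<alpha>"
        unfolding near_count_def using shell_subset_int_box by (intro card_mono) auto
      then have "real ?n \<le> 4 * 3 ^ CARD('n) * V" using True by (simp add: regular_def D_def)
      then have "(of_nat ?n :: ennreal) \<le> ennreal (4 * 3 ^ CARD('n) * V)"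
        by (simp add: ennreal_of_nat_eq_real_of_nat ennreal_leI)
      then show ?thesis using True by (auto intro: mult_right_mono)
    qed simp
    also have "\<dots> = ennreal (4 * 3 ^ CARD('n) * V * (4 * \<eta> / 2 ^ q)) * h' \<alpha>"
      using V \<theta> D by (subst ennreal_mult) (auto simp: \<eta>_def mult_ac)
    finally show "(\<Sum>k\<in>shell q. h' \<alpha> * ?R' \<alpha> * indicator (slab (\<gamma> / 2 / D q) k) \<alpha> * ennreal (4 * \<eta> / 2 ^ q))
      \<le> ennreal (4 * 3 ^ CARD('n) * V * (4 * \<eta> / 2 ^ q)) * h' \<alpha>" .
  qed
  also have "\<dots> = ennreal (4 * 3 ^ CARD('n) * V * (4 * \<eta> / 2 ^ q)) * (\<integral>\<^sup>+\<alpha>. h' \<alpha> \<partial>tor)"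
    by (rule nn_integral_cmult) measurable
  also have "4 * 3 ^ CARD('n) * V * (4 * \<eta> / 2 ^ q) = \<rho> * (64 * 3 ^ CARD('n) * V * \<theta> / \<gamma>)"
    using \<theta> D by (simp add: \<rho>_def \<eta>_def field_simps)
  also have "ennreal \<dots> = ennreal \<rho> * ennreal (64 * 3 ^ CARD('n) * V * \<theta> / \<gamma>)"
    using \<rho> \<theta> V by (intro ennreal_mult) auto
  finally have "ennreal (1 / \<rho>) * (ennreal \<rho> * (\<integral>\<^sup>+\<alpha>. h \<alpha> * ?R \<alpha> * of_nat (shell_hits q \<theta> \<alpha>) \<partial>tor))
     \<le> ennreal (1 / \<rho>) * (ennreal \<rho> * ennreal (64 * 3 ^ CARD('n) * V * \<theta> / \<gamma>) * (\<integral>\<^sup>+\<alpha>. h' \<alpha> \<partial>tor))"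
    by (rule mult_left_mono) simp
  moreover have "ennreal (1 / \<rho>) * (ennreal \<rho> * x) = x" for x
    using \<rho> by (simp flip: mult.assoc ennreal_mult)
  ultimately show ?thesis by (simp only: mult.assoc)
qed

text \<open>
The shift allowed for the shell \<open>q\<close> is harmless for shells below \<open>q - w\<close>; it costs a factor \<open>2\<close> in
both tolerances.
\<close>

lemma chain_weight_shift:
  fixes \<alpha> :: "real ^ 'n"
  assumes \<beta>: "0 \<le> \<beta>" "\<beta> \<le> \<gamma> / (4 * 2 ^ q * (2 ^ q) ^ CARD('n))"
    and \<theta>: "0 < \<theta>" "0 < \<gamma>" "\<gamma> \<le> 4 * \<theta> * 2 ^ w" and qs: "\<forall>p\<in>set qs. p + w \<le> q"
  shows "chain_weight V \<theta> \<gamma> qs (\<alpha> + \<beta> *\<^sub>R axis i 1) \<le> chain_weight V (2 * \<theta>) (\<gamma> / 2) qs \<alpha>"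
  using qs
proof (induction qs)
  case (Cons p qs)
  let ?D = "\<lambda>p. (2 ^ p) ^ CARD('n) :: real"
  have pq: "p + w \<le> q" using Cons.prems by simp
  have D: "0 < ?D p" "?D p \<le> ?D q"
    using pq by (auto intro!: power_mono power_increasing)
  have b: "\<beta> * 2 ^ p \<le> \<gamma> / 4 / ?D p / 2 ^ w"
  proof -
    have "\<beta> * (2 ^ p * 2 ^ w) \<le> \<beta> * 2 ^ q"
      using \<beta> pq by (intro mult_left_mono) (auto simp flip: power_add)
    also have "\<dots> \<le> \<gamma> / (4 * 2 ^ q * ?D q) * 2 ^ q" using \<beta> by (intro mult_right_mono) auto
    also have "\<dots> = \<gamma> / 4 / ?D q" by simp
    also have "\<dots> \<le> \<gamma> / 4 / ?D p" using D \<theta> by (intro divide_left_mono) auto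
    finally show ?thesis by (simp add: field_simps)
  qed
  also have "\<dots> \<le> \<gamma> / 4 / ?D p / 1" using \<theta> D by (intro divide_left_mono) auto
  finally have b1: "\<beta> * 2 ^ p \<le> \<gamma> / 2 / ?D p" using \<theta> D by (auto simp: field_simps)
  have "\<gamma> / 4 / ?D p / 2 ^ w \<le> \<theta> / ?D p" using \<theta> D by (simp add: field_simps)
  with b have b2: "\<beta> * 2 ^ p \<le> \<theta> / ?D p" by simp
  have "indicator (regular V \<gamma> p) (\<alpha> + \<beta> *\<^sub>R axis i 1) \<le> (indicator (regular V (\<gamma> / 2) p) \<alpha> :: ennreal)"
    using regular_shift[OF _ \<beta>(1) b1] by (auto simp: indicator_def)
  moreover have "shell_hits p \<theta> (\<alpha> + \<beta> *\<^sub>R axis i 1) \<le> shell_hits p (2 * \<theta>) \<alpha>"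
    unfolding shell_hits_def
  proof (intro card_mono subsetI)
    fix k :: "int ^ 'n" assume k: "k \<in> {k \<in> shell p. \<alpha> + \<beta> *\<^sub>R axis i 1 \<in> slab (\<theta> / ?D p) k}"
    have "\<alpha> \<in> slab (2 * \<theta> / ?D p) k"
    proof (rule slab_shift)
      show "\<alpha> + \<beta> *\<^sub>R axis i 1 \<in> slab (\<theta> / ?D p) k" using k by simp
      have "\<bar>k $ i\<bar> \<le> 2 ^ p" using k by (simp add: shell_def)
      then have "of_int \<bar>k $ i\<bar> \<le> real_of_int (2 ^ p)" by (simp only: of_int_le_iff)
      then have "\<bar>\<beta>\<bar> * of_int \<bar>k $ i\<bar> \<le> \<beta> * 2 ^ p" using \<beta> by (auto intro: mult_left_mono)
      then show "\<bar>\<beta>\<bar> * of_int \<bar>k $ i\<bar> \<le> \<theta> / ?D p" using b2 by simp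
    qed (simp add: field_simps)
    then show "k \<in> {k \<in> shell p. \<alpha> \<in> slab (2 * \<theta> / ?D p) k}" using k by simp
  qed simp
  ultimately show ?case
    unfolding chain_weight_Cons using Cons by (intro mult_mono) auto
qed (simp add: chain_weight_def)

text \<open>
The list is in decreasing order, so the highest shell is averaged out first, with a shift that is
tiny for the remaining ones.  The sets \<open>S t\<close> are successive enlargements that absorb these
shifts.
\<close>

lemma nn_integral_chain_weight_le:
  fixes S :: "nat \<Rightarrow> (real ^ 'n) set"
  assumes S [measurable]: "\<And>t. S t \<in> sets borel"
    and per: "\<And>t \<alpha> z. \<alpha> + real_vec z \<in> S t \<longleftrightarrow> \<alpha> \<in> S t"
    and fat: "\<And>t \<alpha> \<beta> i. 0 \<le> \<beta> \<Longrightarrow> \<beta> \<le> \<rho> \<Longrightarrow> \<alpha> + \<beta> *\<^sub>R axis i 1 \<in> S t \<Longrightarrow> \<alpha> \<in> S (Suc t)"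
    and V: "0 \<le> V"
    and "sorted_wrt (\<lambda>p q. q + w \<le> p) qs"
    and "\<forall>q\<in>set qs. \<gamma> \<le> (2 ^ q) ^ CARD('n) \<and> \<gamma> / (4 * 2 ^ q * (2 ^ q) ^ CARD('n)) \<le> \<rho>"
    and "0 < \<theta>" "\<gamma> \<le> 4 * \<theta> * 2 ^ w" "4 * 4 ^ length qs * \<theta> \<le> \<gamma>"
  shows "(\<integral>\<^sup>+\<alpha>. indicator (S t) \<alpha> * chain_weight V \<theta> \<gamma> qs \<alpha> \<partial>tor)
    \<le> ennreal ((64 * 3 ^ CARD('n) * V * 4 ^ length qs * \<theta> / \<gamma>) ^ length qs)
        * emeasure tor (S (t + length qs))"
  using assms(5-9)
proof (induction qs arbitrary: \<theta> \<gamma> t)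
  case (Cons q qs)
  have g: "4 * \<theta> \<le> \<gamma>" "0 < \<gamma>"
  proof -
    have "4 * \<theta> * 1 \<le> 4 * \<theta> * 4 ^ length (q # qs)"
      using Cons.prems(3) by (intro mult_left_mono one_le_power) auto
    then show "4 * \<theta> \<le> \<gamma>" using Cons.prems(5) by (simp add: mult_ac)
    then show "0 < \<gamma>" using Cons.prems(3) by simp
  qed
  let ?h = "\<lambda>\<alpha>. indicator (S t) \<alpha> * chain_weight V \<theta> \<gamma> qs \<alpha>"
  let ?h' = "\<lambda>\<alpha>. indicator (S (Suc t)) \<alpha> * chain_weight V (2 * \<theta>) (\<gamma> / 2) qs \<alpha>"
  let ?C = "64 * 3 ^ CARD('n) * V * 4 ^ length (q # qs) * \<theta> / \<gamma>"
  have C0: "0 \<le> ?C" using V Cons.prems(3) g by simp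
  have "(\<integral>\<^sup>+\<alpha>. indicator (S t) \<alpha> * chain_weight V \<theta> \<gamma> (q # qs) \<alpha> \<partial>tor)
      = (\<integral>\<^sup>+\<alpha>. ?h \<alpha> * indicator (regular V \<gamma> q) \<alpha> * of_nat (shell_hits q \<theta> \<alpha>) \<partial>tor)"
    by (simp add: chain_weight_Cons mult_ac)
  also have "\<dots> \<le> ennreal (64 * 3 ^ CARD('n) * V * \<theta> / \<gamma>) * (\<integral>\<^sup>+\<alpha>. ?h' \<alpha> \<partial>tor)"
  proof (rule nn_integral_shell_hits_le)
    show "periodic ?h" by (intro periodic_mult periodic_indicator per chain_weight_periodic)
    fix \<alpha> :: "real ^ 'n" and \<beta> i assume \<beta>: "0 \<le> \<beta>" "\<beta> \<le> \<gamma> / (4 * 2 ^ q * (2 ^ q) ^ CARD('n))"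
    then have "\<beta> \<le> \<rho>" using Cons.prems(2) by auto
    then have "indicator (S t) (\<alpha> + \<beta> *\<^sub>R axis i 1) \<le> (indicator (S (Suc t)) \<alpha> :: ennreal)"
      using fat \<beta> by (auto simp: indicator_def)
    moreover have "chain_weight V \<theta> \<gamma> qs (\<alpha> + \<beta> *\<^sub>R axis i 1) \<le> chain_weight V (2 * \<theta>) (\<gamma> / 2) qs \<alpha>"
      using \<beta> Cons.prems g by (intro chain_weight_shift[where w = w and q = q]) auto
    ultimately show "?h (\<alpha> + \<beta> *\<^sub>R axis i 1) \<le> ?h' \<alpha>" by (intro mult_mono) auto
  qed (use Cons.prems g V in auto)
  also have "\<dots> \<le> ennreal ?C * (ennreal (?C ^ length qs) * emeasure tor (S (Suc t + length qs)))"
  proof (intro mult_mono ennreal_leI)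
    have "64 * 3 ^ CARD('n) * V * \<theta> / \<gamma> * 1 \<le> 64 * 3 ^ CARD('n) * V * \<theta> / \<gamma> * 4 ^ length (q # qs)"
      using V Cons.prems(3) g by (intro mult_left_mono one_le_power) auto
    then show "64 * 3 ^ CARD('n) * V * \<theta> / \<gamma> \<le> ?C" by (simp add: mult_ac)
    have "(\<integral>\<^sup>+\<alpha>. ?h' \<alpha> \<partial>tor) \<le> ennreal ((64 * 3 ^ CARD('n) * V * 4 ^ length qs * (2 * \<theta>) / (\<gamma> / 2)) ^ length qs)
        * emeasure tor (S (Suc t + length qs))"
    proof (rule Cons.IH)
      show "\<forall>q\<in>set qs. \<gamma> / 2 \<le> (2 ^ q) ^ CARD('n) \<and> \<gamma> / 2 / (4 * 2 ^ q * (2 ^ q) ^ CARD('n)) \<le> \<rho>"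
      proof
        fix p assume "p \<in> set qs"
        then have p: "\<gamma> \<le> (2 ^ p) ^ CARD('n)" "\<gamma> / (4 * 2 ^ p * (2 ^ p) ^ CARD('n)) \<le> \<rho>"
          using Cons.prems(2) by auto
        have "\<gamma> / 2 / (4 * 2 ^ p * (2 ^ p) ^ CARD('n)) \<le> \<gamma> / (4 * 2 ^ p * (2 ^ p) ^ CARD('n))"
          using g by (intro divide_right_mono) auto
        then show "\<gamma> / 2 \<le> (2 ^ p) ^ CARD('n) \<and> \<gamma> / 2 / (4 * 2 ^ p * (2 ^ p) ^ CARD('n)) \<le> \<rho>"
          using p g by auto
      qed
    qed (use Cons.prems g in auto)
    also have "64 * 3 ^ CARD('n) * V * 4 ^ length qs * (2 * \<theta>) / (\<gamma> / 2) = ?C" by simp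
    finally show "(\<integral>\<^sup>+\<alpha>. ?h' \<alpha> \<partial>tor) \<le> ennreal (?C ^ length qs) * emeasure tor (S (Suc t + length qs))" .
  qed auto
  also have "\<dots> = ennreal (?C ^ length (q # qs)) * emeasure tor (S (t + length (q # qs)))"
  proof -
    have "ennreal C * (ennreal (C ^ m) * x) = ennreal (C ^ Suc m) * x" if "0 \<le> C" for C m x
      using that by (simp add: ennreal_mult mult.assoc)
    from this[OF C0] show ?thesis by simp
  qed
  finally show ?case .
qed (simp add: chain_weight_def)

section \<open>The probability of many hits\<close>

lemma shell_unique:
  assumes "k \<in> shell p" "k \<in> shell q"
  shows "p = q"
proof -
  have *: False if "p < q" "k \<in> shell p" "k \<in> shell q" for p q
  proof -
    from that obtain i where "2 ^ q < 2 * \<bar>k $ i\<bar>" "\<bar>k $ i\<bar> \<le> 2 ^ p" by (auto simp: shell_def)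
    then have "(2::int) ^ q < 2 ^ Suc p" by simp
    then have "q < Suc p" by (subst (asm) power_strict_increasing_iff) auto
    with that show False by simp
  qed
  show ?thesis using *[of p q] *[of q p] assms by (meson linorder_neqE_nat)
qed

lemma minus_in_shell: "- k \<in> shell q \<longleftrightarrow> k \<in> shell q"
  by (simp add: shell_def)

lemma ex_shell:
  fixes k :: "int ^ 'n"
  assumes "k \<noteq> 0" "\<forall>i. \<bar>k $ i\<bar> \<le> 2 ^ n"
  shows "\<exists>q\<le>n. k \<in> shell q"
proof -
  define q where "q = (LEAST q. \<forall>i. \<bar>k $ i\<bar> \<le> 2 ^ q)"
  have q: "\<forall>i. \<bar>k $ i\<bar> \<le> 2 ^ q" unfolding q_def by (rule LeastI[of "\<lambda>q. \<forall>i. \<bar>k $ i\<bar> \<le> 2 ^ q", OF assms(2)])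
  have "q \<le> n" unfolding q_def by (rule Least_le[of "\<lambda>q. \<forall>i. \<bar>k $ i\<bar> \<le> 2 ^ q", OF assms(2)])
  moreover have "\<exists>i. 2 ^ q < 2 * \<bar>k $ i\<bar>"
  proof (cases q)
    case 0
    obtain i where "k $ i \<noteq> 0" using assms(1) by (auto simp: vec_eq_iff)
    then show ?thesis using 0 by (intro exI[of _ i]) auto
  next
    case (Suc p)
    then have "\<not> (\<forall>i. \<bar>k $ i\<bar> \<le> 2 ^ p)" 
      using not_less_Least[of p "\<lambda>q. \<forall>i. \<bar>k $ i\<bar> \<le> 2 ^ q"] unfolding q_def by simp
    then show ?thesis using Suc by (auto simp: not_le)
  qed
  ultimately show ?thesis using q by (auto simp: shell_def)
qed

text \<open>
From here on \<open>2 ^ l\<close> is comparable to \<open>ln N\<close>.  The value \<open>V = 2 ^ (8 * l)\<close> is a power of \<open>ln N\<close> that is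
large enough to make the irregular points of all shells together negligible.
\<close>

lemma prob_irregular_le:
  assumes "1 \<le> l"
  shows "tor.prob (\<Union>q\<in>{9 * l..2 ^ l}. - regular (2 ^ (8 * l)) (2 ^ (8 * l)) q :: (real ^ 'n) set)
    \<le> 8 * 3 ^ CARD('n) / (2 ^ l) ^ 5"
proof -
  let ?V = "2 ^ (8 * l) :: real"
  have one: "tor.prob (- regular ?V ?V q :: (real ^ 'n) set) \<le> 8 * 3 ^ CARD('n) * (2 ^ l)\<^sup>2 / ?V"
    if q: "q \<in> {9 * l..2 ^ l}" for q
  proof -
    let ?D = "(2 ^ q) ^ CARD('n) :: real"
    have "2 * ?V = 2 ^ (1 + 8 * l)" by simp
    also have "\<dots> \<le> 2 ^ q" using q assms by (intro power_increasing) auto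
    also have "\<dots> \<le> ?D" by (intro self_le_power) auto
    finally have D: "2 * ?V \<le> ?D" .
    have "- regular ?V ?V q = {\<alpha> :: real ^ 'n. real (near_count q (?V / ?D) \<alpha>) > 4 * (?V / ?D) * (3 * 2 ^ q) ^ CARD('n)}"
      by (auto simp: regular_def not_le power_mult_distrib mult_ac)
    also have "tor.prob \<dots> \<le> 2 * 3 ^ CARD('n) * (real q + 1)\<^sup>2 / (?V / ?D * ?D)"
      using D by (intro prob_near_count_large) (auto simp: field_simps)
    also have "\<dots> \<le> 2 * 3 ^ CARD('n) * (2 * 2 ^ l)\<^sup>2 / ?V"
    proof -
      have "real q \<le> real (2 ^ l)" using q by (subst of_nat_le_iff) auto
      moreover have "1 \<le> (2 :: real) ^ l" by simp
      ultimately have "real q + 1 \<le> 2 * 2 ^ l" unfolding of_nat_power of_nat_numeral by linarith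
      then show ?thesis by (intro frac_le mult_left_mono power_mono) auto
    qed
    finally show ?thesis by (simp add: power_mult_distrib)
  qed
  have "tor.prob (\<Union>q\<in>{9 * l..2 ^ l}. - regular ?V ?V q :: (real ^ 'n) set)
     \<le> (\<Sum>q\<in>{9 * l..2 ^ l}. tor.prob (- regular ?V ?V q :: (real ^ 'n) set))"
    by (intro tor.finite_measure_subadditive_finite) auto
  also have "\<dots> \<le> (\<Sum>q\<in>{9 * l..2 ^ l}. 8 * 3 ^ CARD('n) * (2 ^ l)\<^sup>2 / ?V)"
    by (intro sum_mono one)
  also have "\<dots> = real (card {9 * l..2 ^ l}) * (8 * 3 ^ CARD('n) * (2 ^ l)\<^sup>2 / ?V)" by simp
  also have "\<dots> \<le> 2 ^ l * (8 * 3 ^ CARD('n) * (2 ^ l)\<^sup>2 / ?V)"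
  proof (intro mult_right_mono)
    have "card {9 * l..2 ^ l} \<le> 2 ^ l" using assms by simp
    then have "real (card {9 * l..2 ^ l}) \<le> real (2 ^ l)" by (rule of_nat_mono)
    then show "real (card {9 * l..2 ^ l}) \<le> 2 ^ l" by simp
  qed auto
  also have "\<dots> = 8 * 3 ^ CARD('n) / (2 ^ l) ^ 5"
    by (simp add: field_simps flip: power_mult power_add)
  finally show ?thesis .
qed

lemma sum_prob_prim_slab_pairs_le:
  fixes p q :: nat and \<theta> :: real and A A' :: "(int ^ 'n) set"
  assumes A: "A \<subseteq> shell p" "A' \<subseteq> shell q" and \<theta>: "0 \<le> \<theta>" "\<theta> \<le> 1/2"
  shows "(\<Sum>k\<in>A. \<Sum>k'\<in>A' - {k, - k}. tor.prob (prim_slab (\<theta> / (2 ^ p) ^ CARD('n)) k \<inter> prim_slab (\<theta> / (2 ^ q) ^ CARD('n)) k'))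
    \<le> 8 * 9 ^ CARD('n) * \<theta>\<^sup>2"
proof -
  let ?D = "\<lambda>p. (2 ^ p) ^ CARD('n) :: real"
  have D: "1 \<le> ?D p" for p by simp
  have fin: "finite A" "finite A'" using A finite_subset[OF _ finite_shell] by auto
  have card_le: "real (card B) \<le> 3 ^ CARD('n) * ?D p" if "B \<subseteq> shell p" for B :: "(int ^ 'n) set" and p
    using card_mono[OF finite_shell that] card_shell_le[of p, where 'n = 'n]
    by (simp add: power_mult_distrib)
  have nz: "k \<noteq> 0" if "k \<in> shell p" for k :: "int ^ 'n" and p
    using that shell_subset_int_box by (auto simp: int_box_def)
  have "\<theta> / ?D p \<le> 1/2 / 1" using \<theta> D by (intro frac_le) auto
  then have pair: "tor.prob (prim_slab (\<theta> / ?D p) k \<inter> prim_slab (\<theta> / ?D q) k') \<le> 8 * (\<theta> / ?D p) * (\<theta> / ?D q)"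
    if "k \<in> A" "k' \<in> A' - {k, - k}" for k k'
    using that A nz \<theta> by (intro prob_prim_slab_pair) auto
  have "(\<Sum>k\<in>A. \<Sum>k'\<in>A' - {k, - k}. tor.prob (prim_slab (\<theta> / ?D p) k \<inter> prim_slab (\<theta> / ?D q) k'))
      \<le> (\<Sum>k\<in>A. \<Sum>k'\<in>A' - {k, - k}. 8 * (\<theta> / ?D p) * (\<theta> / ?D q))"
    by (intro sum_mono pair)
  also have "\<dots> \<le> (\<Sum>k\<in>A. \<Sum>k'\<in>A'. 8 * (\<theta> / ?D p) * (\<theta> / ?D q))"
    using fin \<theta> by (intro sum_mono sum_mono2) auto
  also have "\<dots> = (real (card A) * (\<theta> / ?D p)) * (real (card A') * (\<theta> / ?D q)) * 8"
    by simp
  also have "\<dots> \<le> (3 ^ CARD('n) * ?D p * (\<theta> / ?D p)) * (3 ^ CARD('n) * ?D q * (\<theta> / ?D q)) * 8"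
    using A card_le \<theta> by (intro mult_right_mono mult_mono) auto
  also have "\<dots> = 8 * 9 ^ CARD('n) * \<theta>\<^sup>2"
  proof -
    have "(9 :: real) ^ CARD('n) = 3 ^ CARD('n) * 3 ^ CARD('n)" by (simp flip: power_mult_distrib)
    then show ?thesis by (simp add: power2_eq_square)
  qed
  finally show ?thesis .
qed

lemma sum_prob_slab_shell_le:
  assumes "A \<subseteq> (shell q :: (int ^ 'n) set)" "0 \<le> \<theta>"
  shows "(\<Sum>k\<in>A. tor.prob (slab (\<theta> / (2 ^ q) ^ CARD('n)) k)) \<le> 2 * 3 ^ CARD('n) * \<theta>"
proof -
  let ?D = "(2 ^ q) ^ CARD('n) :: real"
  have "(\<Sum>k\<in>A. tor.prob (slab (\<theta> / ?D) k)) \<le> (\<Sum>k\<in>A. 2 * (\<theta> / ?D))"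
    using assms shell_subset_int_box by (intro sum_mono prob_slab_le) (auto simp: int_box_def)
  also have "\<dots> = real (card A) * (2 * (\<theta> / ?D))" by simp
  also have "\<dots> \<le> (3 * 2 ^ q) ^ CARD('n) * (2 * (\<theta> / ?D))"
    using card_shell_le[of q, where 'n = 'n] card_mono[OF finite_shell assms(1)] assms(2)
    by (intro mult_right_mono) (auto intro: order_trans)
  also have "\<dots> = 2 * 3 ^ CARD('n) * \<theta>" by (simp add: power_mult_distrib)
  finally show ?thesis .
qed

text \<open>
The elements of \<open>D_set\<close>, with a threshold that depends on the shell of \<open>k\<close> only.
\<close>

definition hits :: "nat \<Rightarrow> real \<Rightarrow> real ^ 'n \<Rightarrow> (int ^ 'n) set" where
  "hits n \<theta> \<alpha> = (\<Union>q\<le>n. {k \<in> shell q. \<alpha> \<in> prim_slab (\<theta> / (2 ^ q) ^ CARD('n)) k})"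

text \<open>
The gap \<open>10 * l\<close> between the shells makes up for the ratio between \<open>V = 2 ^ (8 * l)\<close> and
\<open>\<theta> \<ge> 1 / 4 ^ l\<close>.
\<close>

lemma nn_integral_separated_chain_le:
  fixes \<theta> :: real and S :: "nat \<Rightarrow> (real ^ 'n) set"
  assumes l: "1 \<le> l" "r \<le> 2 * l" and \<theta>: "1 / 4 ^ l \<le> \<theta>" "\<theta> \<le> 1"
    and qs: "sorted_wrt (\<lambda>p q. q + 10 * l \<le> p) qs" "set qs \<subseteq> {9 * l..2 ^ l}" "length qs = r"
    and S: "\<And>t. S t \<in> sets borel" "\<And>t \<alpha> z. \<alpha> + real_vec z \<in> S t \<longleftrightarrow> \<alpha> \<in> S t"
    and fat: "\<And>t \<alpha> \<beta> i. 0 \<le> \<beta> \<Longrightarrow> \<beta> \<le> \<rho> \<Longrightarrow> \<alpha> + \<beta> *\<^sub>R axis i 1 \<in> S t \<Longrightarrow> \<alpha> \<in> S (Suc t)"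
    and \<rho>: "\<And>q. q \<in> set qs \<Longrightarrow> 2 ^ (8 * l) / (4 * 2 ^ q * (2 ^ q) ^ CARD('n)) \<le> \<rho>"
  shows "(\<integral>\<^sup>+\<alpha>. indicator (S 0) \<alpha> * chain_weight (2 ^ (8 * l)) \<theta> (2 ^ (8 * l)) qs (\<alpha> :: real ^ 'n) \<partial>tor)
    \<le> ennreal ((64 * 3 ^ CARD('n) * 4 ^ r * \<theta>) ^ r) * emeasure tor (S r)"
proof -
  let ?V = "2 ^ (8 * l) :: real"
  have \<theta>0: "\<theta> > 0" using \<theta>(1) by (rule less_le_trans[rotated]) simp
  have "(\<integral>\<^sup>+\<alpha>. indicator (S 0) \<alpha> * chain_weight ?V \<theta> ?V qs (\<alpha> :: real ^ 'n) \<partial>tor)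
    \<le> ennreal ((64 * 3 ^ CARD('n) * ?V * 4 ^ length qs * \<theta> / ?V) ^ length qs)
        * emeasure tor (S (0 + length qs))"
  proof (rule nn_integral_chain_weight_le[where S = S and \<rho> = \<rho> and w = "10 * l", OF S fat _ qs(1)])
    show "\<forall>q\<in>set qs. ?V \<le> (2 ^ q) ^ CARD('n) \<and> ?V / (4 * 2 ^ q * (2 ^ q) ^ CARD('n)) \<le> \<rho>"
    proof
      fix q assume q: "q \<in> set qs"
      then have "8 * l \<le> q" using qs(2) by auto
      then have "?V \<le> 2 ^ q" by (intro power_increasing) auto
      also have "\<dots> \<le> (2 ^ q) ^ CARD('n)" by (intro self_le_power) auto
      finally show "?V \<le> (2 ^ q) ^ CARD('n) \<and> ?V / (4 * 2 ^ q * (2 ^ q) ^ CARD('n)) \<le> \<rho>"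
        using \<rho>[OF q] by simp
    qed
    have "1 \<le> \<theta> * 4 ^ l" using \<theta> by (simp add: field_simps)
    then have "2 ^ (8 * l) * 1 \<le> 2 ^ (8 * l) * (4 * (\<theta> * 4 ^ l))" by (intro mult_left_mono) auto
    also have "\<dots> = 4 * \<theta> * 2 ^ (10 * l)"
    proof -
      have "(4 :: real) ^ l = 2 ^ (2 * l)" by (simp add: power_mult)
      then show ?thesis by (simp add: mult_ac flip: power_add)
    qed
    finally show "?V \<le> 4 * \<theta> * 2 ^ (10 * l)" by simp
    have "4 * 4 ^ length qs * \<theta> \<le> 4 ^ Suc r * 1"
      unfolding qs(3) using \<theta> by (simp add: mult_left_le)
    also have "\<dots> \<le> (4 :: real) ^ (4 * l)" using l by (simp add: power_increasing del: power_Suc)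
    also have "\<dots> = ?V" using power_mult[of "2 :: real" 2 "4 * l"] by simp
    finally show "4 * 4 ^ length qs * \<theta> \<le> ?V" .
  qed (use \<theta>0 in auto)
  moreover have "64 * 3 ^ CARD('n) * ?V * 4 ^ length qs * \<theta> / ?V = 64 * 3 ^ CARD('n) * 4 ^ r * \<theta>"
    by (simp add: qs(3))
  ultimately show ?thesis by (simp only: qs(3)) simp
qed

lemma prob_chain_le:
  fixes \<theta> :: real
  assumes l: "1 \<le> l" "r \<le> 2 * l" and \<theta>: "1 / 4 ^ l \<le> \<theta>" "\<theta> \<le> 1"
    and qs: "sorted_wrt (\<lambda>p q. q + 10 * l \<le> p) qs" "set qs \<subseteq> {9 * l..2 ^ l}" "length qs = r"
  shows "(\<integral>\<^sup>+\<alpha>. chain_weight (2 ^ (8 * l)) \<theta> (2 ^ (8 * l)) qs (\<alpha> :: real ^ 'n) \<partial>tor)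
    \<le> ennreal ((64 * 3 ^ CARD('n) * 4 ^ r * \<theta>) ^ r)"
proof -
  have "2 ^ (8 * l) / (4 * 2 ^ q * (2 ^ q) ^ CARD('n)) \<le> (2 ^ (8 * l) / 1 :: real)" for q
  proof (intro divide_left_mono)
    have "1 * 1 \<le> 4 * 2 ^ q * (2 ^ q :: real) ^ CARD('n)"
      by (intro mult_mono) (auto intro: order_trans[of _ 4])
    then show "1 \<le> 4 * 2 ^ q * (2 ^ q :: real) ^ CARD('n)" by simp
  qed auto
  then show ?thesis
    using nn_integral_separated_chain_le[OF l \<theta> qs, of "\<lambda>_. UNIV :: (real ^ 'n) set" "2 ^ (8 * l)"]
    by simp
qed

lemma one_le_chain_weight:
  assumes "\<forall>q\<in>set qs. \<alpha> \<in> regular V \<gamma> q \<and> 1 \<le> shell_hits q \<theta> \<alpha>"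
  shows "1 \<le> chain_weight V \<theta> \<gamma> qs \<alpha>"
  using assms
proof (induction qs)
  case (Cons q qs)
  then have "of_nat 1 \<le> (of_nat (shell_hits q \<theta> \<alpha>) :: ennreal)" by (intro of_nat_mono) auto
  then have "1 * 1 \<le> of_nat (shell_hits q \<theta> \<alpha>) * chain_weight V \<theta> \<gamma> qs \<alpha>"
    using Cons by (intro mult_mono) auto
  then show ?case using Cons by (simp add: chain_weight_Cons)
qed (simp add: chain_weight_def)

lemma one_le_shell_hits:
  fixes \<alpha> :: "real ^ 'n"
  assumes "k \<in> shell q" "\<alpha> \<in> prim_slab (\<theta> / (2 ^ q) ^ CARD('n)) k"
  shows "1 \<le> shell_hits q \<theta> \<alpha>"
proof -
  have "{k} \<subseteq> {k \<in> shell q. \<alpha> \<in> slab (\<theta> / (2 ^ q) ^ CARD('n)) k}"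
    using assms prim_slab_subset by auto
  from card_mono[OF _ this] show ?thesis by (simp add: shell_hits_def)
qed

text \<open>
If hits in nearby shells agree up to sign, every shell contains at most one pair \<open>k\<close>, \<open>- k\<close> of hits,
and the shells that are hit are far apart.
\<close>

lemma separated_chain_of_hits:
  fixes \<alpha> :: "real ^ 'n"
  assumes hits: "2 * r \<le> card (hits n \<theta> \<alpha>)"
    and large: "\<And>q k. q < m \<Longrightarrow> k \<in> shell q \<Longrightarrow> \<alpha> \<notin> prim_slab (\<theta> / (2 ^ q) ^ CARD('n)) k"
    and apart: "\<And>p q k k'. p \<le> n \<Longrightarrow> p \<le> q \<Longrightarrow> q < p + w \<Longrightarrow> k \<in> shell p \<Longrightarrow> k' \<in> shell q \<Longrightarrow>
      \<alpha> \<in> prim_slab (\<theta> / (2 ^ p) ^ CARD('n)) k \<Longrightarrow> \<alpha> \<in> prim_slab (\<theta> / (2 ^ q) ^ CARD('n)) k' \<Longrightarrow> k' = k \<or> k' = - k"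
    and w: "0 < w"
  obtains qs where "sorted_wrt (\<lambda>p q. q + w \<le> p) qs" "set qs \<subseteq> {m..n}" "length qs = r"
    "\<forall>q\<in>set qs. 1 \<le> shell_hits q \<theta> \<alpha>"
proof -
  let ?hit = "\<lambda>q k. k \<in> shell q \<and> \<alpha> \<in> prim_slab (\<theta> / (2 ^ q) ^ CARD('n)) k"
  define T where "T = {q \<in> {m..n}. \<exists>k. ?hit q k}"
  have "\<exists>f. \<forall>q\<in>T. ?hit q (f q)" by (intro bchoice) (auto simp: T_def)
  then obtain f where f: "\<And>q. q \<in> T \<Longrightarrow> ?hit q (f q)" by blast
  have "hits n \<theta> \<alpha> \<subseteq> f ` T \<union> (\<lambda>q. - f q) ` T"
  proof
    fix k assume "k \<in> hits n \<theta> \<alpha>"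
    then obtain q where q: "q \<le> n" "?hit q k" by (auto simp: hits_def)
    then have "q \<ge> m" using large by (meson not_le)
    then have "q \<in> T" using q by (auto simp: T_def)
    then have "k = f q \<or> k = - f q"
      using apart[of q q "f q" k] f[of q] q w by auto
    then show "k \<in> f ` T \<union> (\<lambda>q. - f q) ` T" using \<open>q \<in> T\<close> by auto
  qed
  moreover have finT: "finite T" by (simp add: T_def)
  ultimately have "card (hits n \<theta> \<alpha>) \<le> card (f ` T \<union> (\<lambda>q. - f q) ` T)" by (intro card_mono) auto
  also have "\<dots> \<le> card (f ` T) + card ((\<lambda>q. - f q) ` T)" by (rule card_Un_le)
  also have "\<dots> \<le> card T + card T" using finT by (intro add_mono card_image_le)
  finally have "r \<le> card T" using hits by simp
  then obtain T' where T': "T' \<subseteq> T" "card T' = r" by (meson obtain_subset_with_card_n)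
  have finT': "finite T'" using T' finT finite_subset by blast
  define qs where "qs = rev (sorted_list_of_set T')"
  have set: "set qs = T'" using finT' by (simp add: qs_def)
  have "sorted_wrt (\<lambda>p q. p + w \<le> q) (sorted_list_of_set T')"
  proof (rule sorted_wrt_mono_rel[OF _ strict_sorted_list_of_set[of T']])
    fix p q assume pq: "p \<in> set (sorted_list_of_set T')" "q \<in> set (sorted_list_of_set T')" "p < q"
    then have T: "p \<in> T" "q \<in> T" using T' finT' by auto
    show "p + w \<le> q"
    proof (rule ccontr)
      assume "\<not> p + w \<le> q"
      moreover have "p \<le> n" using T by (simp add: T_def)
      ultimately have "f q = f p \<or> f q = - f p" using apart[of p q "f p" "f q"] f[OF T(1)] f[OF T(2)] pq by auto
      then have "f q \<in> shell p" using f[OF T(1)] by (elim disjE) (simp_all add: minus_in_shell)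
      then have "p = q" using shell_unique f[OF T(2)] by blast
      then show False using pq by simp
    qed
  qed
  then have "sorted_wrt (\<lambda>p q. q + w \<le> p) qs" by (simp add: qs_def sorted_wrt_rev)
  moreover have "set qs \<subseteq> {m..n}" unfolding set using T' by (auto simp: T_def)
  moreover have "length qs = r" using T' by (simp add: qs_def)
  moreover have "\<forall>q\<in>set qs. 1 \<le> shell_hits q \<theta> \<alpha>"
    unfolding set using T' f one_le_shell_hits by blast
  ultimately show thesis using that by blast
qed

text \<open>
The four summands bound, in this order, the hits in the low shells \<open>q < 9 * l\<close>, where the chain
estimate does not apply; two hits in shells closer than \<open>10 * l\<close>; irregular points; and chains of
\<open>r\<close> separated hits.  Only the last one is decisive.
\<close>

lemma prob_many_hits_le:
  fixes \<theta> :: real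
  assumes l: "1 \<le> l" "r \<le> 2 * l" and \<theta>: "1 / 4 ^ l \<le> \<theta>" "\<theta> \<le> 1 / 2"
  shows "\<exists>B\<in>sets borel. (\<forall>\<alpha> :: real ^ 'n. 2 * r \<le> card (hits (2 ^ l) \<theta> \<alpha>) \<longrightarrow> \<alpha> \<in> B) \<and>
    tor.prob B \<le> 18 * 3 ^ CARD('n) * (real l * \<theta>) + 160 * 9 ^ CARD('n) * (real l * 2 ^ l * \<theta>\<^sup>2)
      + 8 * 3 ^ CARD('n) / (2 ^ l) ^ 5 + (64 * 3 ^ CARD('n) * 4 ^ r * (\<theta> * 2 ^ l)) ^ r"
proof -
  let ?D = "\<lambda>q. (2 ^ q) ^ CARD('n) :: real"
  let ?V = "2 ^ (8 * l) :: real"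
  define n where "n = (2 :: nat) ^ l"
  have \<theta>0: "0 \<le> \<theta>" using \<theta>(1) by (rule order_trans[rotated]) simp
  define B1 :: "(real ^ 'n) set" where "B1 = (\<Union>q<9 * l. \<Union>k\<in>shell q. slab (\<theta> / ?D q) k)"
  define C where "C p q = (\<Union>k\<in>shell p. \<Union>k'\<in>shell q - {k, - k}.
      prim_slab (\<theta> / ?D p) k \<inter> prim_slab (\<theta> / ?D q) k' :: (real ^ 'n) set)" for p q
  define B2 where "B2 = (\<Union>p\<le>n. \<Union>q\<in>{p..<p + 10 * l}. C p q)"
  define B3 :: "(real ^ 'n) set" where "B3 = (\<Union>q\<in>{9 * l..2 ^ l}. - regular ?V ?V q)"
  define Q where "Q = {qs. sorted_wrt (\<lambda>p q. q + 10 * l \<le> p) qs \<and> set qs \<subseteq> {9 * l..n} \<and> length qs = r}"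
  define B4 :: "(real ^ 'n) set" where "B4 = (\<Union>qs\<in>Q. {\<alpha>. 1 \<le> chain_weight ?V \<theta> ?V qs \<alpha>})"
  have finQ: "finite Q"
    by (rule finite_subset[OF _ finite_lists_length_eq[of "{9 * l..n}" r]]) (auto simp: Q_def)
  have C_sets [measurable]: "C p q \<in> sets borel" for p q
    unfolding C_def by (intro sets.finite_UN sets.Int) auto
  have B1_sets [measurable]: "B1 \<in> sets borel"
    unfolding B1_def by (intro sets.finite_UN) auto
  have B2_sets [measurable]: "B2 \<in> sets borel"
    unfolding B2_def by (intro sets.finite_UN) auto
  have B3_sets [measurable]: "B3 \<in> sets borel"
    unfolding B3_def by (intro sets.finite_UN borel_comp) auto
  have B4_sets [measurable]: "B4 \<in> sets borel"
    unfolding B4_def using finQ by (intro sets.finite_UN) auto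
  have "\<alpha> \<in> B1 \<union> B2 \<union> B3 \<union> B4" if hits: "2 * r \<le> card (hits n \<theta> \<alpha>)" for \<alpha> :: "real ^ 'n"
  proof (rule ccontr)
    assume "\<alpha> \<notin> B1 \<union> B2 \<union> B3 \<union> B4"
    then have nB: "\<alpha> \<notin> B1" "\<alpha> \<notin> B2" "\<alpha> \<notin> B3" "\<alpha> \<notin> B4" by auto
    obtain qs where qs: "sorted_wrt (\<lambda>p q. q + 10 * l \<le> p) qs" "set qs \<subseteq> {9 * l..n}" "length qs = r"
      "\<forall>q\<in>set qs. 1 \<le> shell_hits q \<theta> \<alpha>"
    proof (rule separated_chain_of_hits[OF hits])
      show "\<alpha> \<notin> prim_slab (\<theta> / ?D q) k" if "q < 9 * l" "k \<in> shell q" for q k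
        using nB(1) that prim_slab_subset unfolding B1_def by blast
      show "k' = k \<or> k' = - k" if "p \<le> n" "p \<le> q" "q < p + 10 * l" "k \<in> shell p" "k' \<in> shell q"
        "\<alpha> \<in> prim_slab (\<theta> / ?D p) k" "\<alpha> \<in> prim_slab (\<theta> / ?D q) k'" for p q k k'
      proof (rule ccontr)
        assume "\<not> ?thesis"
        then have "\<alpha> \<in> C p q" using that unfolding C_def by blast
        then show False using nB(2) that unfolding B2_def by auto
      qed
    qed (use l in auto)
    have "\<alpha> \<in> regular ?V ?V q" if "q \<in> set qs" for q
      using nB(3) qs(2) that unfolding B3_def n_def by auto
    then have "1 \<le> chain_weight ?V \<theta> ?V qs \<alpha>" using qs(4) by (intro one_le_chain_weight) auto
    then show False using nB(4) qs unfolding B4_def Q_def by auto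
  qed
  moreover have "tor.prob (B1 \<union> B2 \<union> B3 \<union> B4) \<le> 18 * 3 ^ CARD('n) * (real l * \<theta>)
      + 160 * 9 ^ CARD('n) * (real l * 2 ^ l * \<theta>\<^sup>2)
      + 8 * 3 ^ CARD('n) / (2 ^ l) ^ 5 + (64 * 3 ^ CARD('n) * 4 ^ r * (\<theta> * 2 ^ l)) ^ r"
  proof -
    have "tor.prob (B1 \<union> B2 \<union> B3 \<union> B4) \<le> tor.prob B1 + tor.prob B2 + tor.prob B3 + tor.prob B4"
      by (intro order_trans[OF measure_Un_le] add_mono order_refl) auto
    moreover have "tor.prob B1 \<le> 18 * 3 ^ CARD('n) * (real l * \<theta>)"
    proof -
      have "tor.prob B1 \<le> (\<Sum>q<9 * l. tor.prob (\<Union>k\<in>shell q. slab (\<theta> / ?D q) k :: (real ^ 'n) set))"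
        unfolding B1_def by (intro tor.finite_measure_subadditive_finite) (auto intro!: sets.finite_UN)
      also have "\<dots> \<le> (\<Sum>q<9 * l. \<Sum>k\<in>(shell q :: (int ^ 'n) set). tor.prob (slab (\<theta> / ?D q) k))"
        by (intro sum_mono tor.finite_measure_subadditive_finite) auto
      also have "\<dots> \<le> (\<Sum>q<9 * l. 2 * 3 ^ CARD('n) * \<theta>)"
        using \<theta>0 by (intro sum_mono sum_prob_slab_shell_le) auto
      finally show ?thesis by (simp add: mult_ac)
    qed
    moreover have "tor.prob B2 \<le> 160 * 9 ^ CARD('n) * (real l * 2 ^ l * \<theta>\<^sup>2)"
    proof -
      have "tor.prob (C p q) \<le> 8 * 9 ^ CARD('n) * \<theta>\<^sup>2" for p q
      proof -
        have "tor.prob (C p q) \<le> (\<Sum>k\<in>(shell p :: (int ^ 'n) set). tor.prob (\<Union>k'\<in>shell q - {k, - k}.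
           prim_slab (\<theta> / ?D p) k \<inter> prim_slab (\<theta> / ?D q) k'))"
          unfolding C_def by (intro tor.finite_measure_subadditive_finite) (auto intro!: sets.finite_UN)
        also have "\<dots> \<le> (\<Sum>k\<in>(shell p :: (int ^ 'n) set). \<Sum>k'\<in>shell q - {k, - k}. tor.prob
           (prim_slab (\<theta> / ?D p) k \<inter> prim_slab (\<theta> / ?D q) k'))"
          by (intro sum_mono tor.finite_measure_subadditive_finite) auto
        also have "\<dots> \<le> 8 * 9 ^ CARD('n) * \<theta>\<^sup>2"
          using \<theta> \<theta>0 by (intro sum_prob_prim_slab_pairs_le) auto
        finally show ?thesis .
      qed
      then have "(\<Sum>p\<le>n. \<Sum>q\<in>{p..<p + 10 * l}. tor.prob (C p q)) \<le> (\<Sum>p\<le>n. \<Sum>q\<in>{p..<p + 10 * l}. 8 * 9 ^ CARD('n) * \<theta>\<^sup>2)"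
        by (intro sum_mono)
      moreover have "tor.prob B2 \<le> (\<Sum>p\<le>n. tor.prob (\<Union>q\<in>{p..<p + 10 * l}. C p q))"
        unfolding B2_def by (intro tor.finite_measure_subadditive_finite) (auto intro!: sets.finite_UN)
      moreover have "\<dots> \<le> (\<Sum>p\<le>n. \<Sum>q\<in>{p..<p + 10 * l}. tor.prob (C p q))"
        by (intro sum_mono tor.finite_measure_subadditive_finite) auto
      ultimately have "tor.prob B2 \<le> (2 ^ l + 1) * (80 * 9 ^ CARD('n) * (real l * \<theta>\<^sup>2))"
        by (simp add: n_def mult_ac add.commute[of 1])
      also have "\<dots> \<le> (2 * 2 ^ l) * (80 * 9 ^ CARD('n) * (real l * \<theta>\<^sup>2))"
        by (intro mult_right_mono) auto
      finally show ?thesis by (simp add: mult_ac)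
    qed
    moreover have "tor.prob B3 \<le> 8 * 3 ^ CARD('n) / (2 ^ l) ^ 5"
      unfolding B3_def by (rule prob_irregular_le[OF l(1)])
    moreover have "tor.prob B4 \<le> (64 * 3 ^ CARD('n) * 4 ^ r * (\<theta> * 2 ^ l)) ^ r"
    proof -
      let ?C = "64 * 3 ^ CARD('n) * 4 ^ r * \<theta> :: real"
      have "tor.prob {\<alpha> :: real ^ 'n. 1 \<le> chain_weight ?V \<theta> ?V qs \<alpha>} \<le> ?C ^ r" if "qs \<in> Q" for qs
      proof -
        let ?A = "{\<alpha> :: real ^ 'n. 1 \<le> chain_weight ?V \<theta> ?V qs \<alpha>}"
        have "emeasure tor ?A = (\<integral>\<^sup>+\<alpha>. indicator ?A \<alpha> \<partial>tor)"
          by (rule nn_integral_indicator[symmetric]) measurable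
        also have "\<dots> \<le> (\<integral>\<^sup>+\<alpha>. chain_weight ?V \<theta> ?V qs (\<alpha> :: real ^ 'n) \<partial>tor)"
          by (intro nn_integral_mono) (auto simp: indicator_def)
        also have "\<dots> \<le> ennreal (?C ^ r)"
          using l \<theta> that by (intro prob_chain_le) (auto simp: Q_def n_def)
        finally show ?thesis
          using \<theta>0 by (simp add: tor.emeasure_eq_measure ennreal_le_iff)
      qed
      then have "(\<Sum>qs\<in>Q. tor.prob {\<alpha> :: real ^ 'n. 1 \<le> chain_weight ?V \<theta> ?V qs \<alpha>}) \<le> (\<Sum>qs\<in>Q. ?C ^ r)"
        by (rule sum_mono)
      moreover have "tor.prob B4 \<le> (\<Sum>qs\<in>Q. tor.prob {\<alpha> :: real ^ 'n. 1 \<le> chain_weight ?V \<theta> ?V qs \<alpha>})"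
        unfolding B4_def using finQ by (intro tor.finite_measure_subadditive_finite) auto
      moreover have "(\<Sum>qs\<in>Q. ?C ^ r) \<le> (2 ^ l) ^ r * ?C ^ r"
      proof -
        have "card Q \<le> card {qs. set qs \<subseteq> {9 * l..n} \<and> length qs = r}"
          by (intro card_mono finite_lists_length_eq) (auto simp: Q_def)
        also have "\<dots> = card {9 * l..n} ^ r" by (rule card_lists_length_eq) simp
        also have "\<dots> \<le> (2 ^ l) ^ r" using l by (intro power_mono) (auto simp: n_def)
        finally have "real (card Q) \<le> real ((2 ^ l) ^ r)" by (rule of_nat_mono)
        then show ?thesis using \<theta>0 by (simp add: mult_right_mono)
      qed
      ultimately have "tor.prob B4 \<le> (2 ^ l) ^ r * ?C ^ r" by linarith
      then show ?thesis by (simp add: mult_ac flip: power_mult_distrib)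
    qed
    ultimately show ?thesis by linarith
  qed
  moreover have "B1 \<union> B2 \<union> B3 \<union> B4 \<in> sets borel" by measurable
  ultimately show ?thesis unfolding n_def by blast
qed

section \<open>The convergence case\<close>

lemma AE_torus:
  assumes "AE \<alpha> in (tor :: (real ^ 'n) measure). P \<alpha>"
  shows "AE \<alpha> in (torus :: (real ^ 'n) measure). P \<alpha>"
proof -
  have "AE \<alpha> in lborel. \<alpha> \<in> unit_cube \<longrightarrow> P (\<alpha> :: real ^ 'n)"
    using assms unfolding tor_def by (subst (asm) AE_density) (auto simp: indicator_def split: if_splits)
  then have "AE \<alpha> in lebesgue. \<alpha> \<in> unit_cube \<longrightarrow> P (\<alpha> :: real ^ 'n)" by (rule AE_completion)
  then show ?thesis
    unfolding torus_def unit_cube_def[symmetric] by (subst AE_restrict_space_iff) auto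
qed

text \<open>
The Lebesgue measure is complete, so every subset of a null set, in particular the set of
approximable vectors, is measurable.
\<close>

lemma null_sets_torus:
  assumes "AE \<alpha> in (torus :: (real ^ 'n) measure). \<not> P \<alpha>"
  shows "{\<alpha> \<in> space (torus :: (real ^ 'n) measure). P \<alpha>} \<in> null_sets torus"
proof -
  from assms obtain N where N: "{\<alpha> \<in> space (torus :: (real ^ 'n) measure). P \<alpha>} \<subseteq> N" "N \<in> null_sets torus"
    by (auto elim!: AE_E3 simp: subset_eq) 
  have cube: "unit_cube \<in> sets (lebesgue :: (real ^ 'n) measure)" by simp
  have eq: "A \<in> null_sets torus \<longleftrightarrow> A \<subseteq> unit_cube \<and> A \<in> null_sets lebesgue" for A :: "(real ^ 'n) set"
    unfolding torus_def unit_cube_def[symmetric] by (subst null_sets_restrict_space) (auto simp: cube)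
  show ?thesis using N null_sets_completion_subset[OF N(1)] by (auto simp: eq)
qed

lemma norm_real_vec_ge: "real_of_int \<bar>k $ i\<bar> \<le> norm (real_vec k)"
  using component_le_norm_cart[of "real_vec k" i] by simp

lemma D_set_subset_hits:
  fixes \<alpha> :: "real ^ 'n"
  assumes N: "N \<le> 2 ^ n" and \<theta>: "2 ^ CARD('n) * (c / (ln (real N) * ln (ln (real N)) powr s)) \<le> \<theta>"
  shows "D_set \<alpha> s c N \<subseteq> hits n \<theta> \<alpha>"
proof
  define \<epsilon> where "\<epsilon> = c / (ln (real N) * ln (ln (real N)) powr s)"
  fix k assume "k \<in> D_set \<alpha> s c N"
  then obtain m :: int where k0: "k \<noteq> 0" and kN: "norm (real_vec k) \<le> real N"
    and g: "Gcd (insert m (range (\<lambda>i. k $ i))) = 1"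
    and m: "norm (real_vec k) ^ CARD('n) * \<bar>real_vec k \<bullet> \<alpha> + of_int m\<bar> \<le> \<epsilon>"
    unfolding D_set_def mem_Collect_eq \<epsilon>_def by blast
  have "\<bar>k $ i\<bar> \<le> 2 ^ n" for i
  proof -
    have "real_of_int \<bar>k $ i\<bar> \<le> real (2 ^ n)"
      using norm_real_vec_ge[of k i] kN N by (meson of_nat_le_iff order_trans)
    then have "real_of_int \<bar>k $ i\<bar> \<le> of_int (2 ^ n)" by simp
    then show ?thesis by (simp only: of_int_le_iff)
  qed
  then obtain q where q: "q \<le> n" "k \<in> shell q" using ex_shell[OF k0] by blast
  let ?x = "\<bar>real_vec k \<bullet> \<alpha> + of_int m\<bar>"
  obtain i where "2 ^ q < 2 * \<bar>k $ i\<bar>" using q by (auto simp: shell_def)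
  then have "real_of_int (2 ^ q) \<le> of_int (2 * \<bar>k $ i\<bar>)" by (simp only: of_int_le_iff)
  then have "2 ^ q / 2 \<le> norm (real_vec k)" using norm_real_vec_ge[of k i] by simp
  then have "(2 ^ q / 2) ^ CARD('n) * ?x \<le> norm (real_vec k) ^ CARD('n) * ?x"
    by (intro mult_right_mono power_mono) auto
  also have "\<dots> \<le> \<epsilon>" by (rule m)
  finally have "(2 ^ q) ^ CARD('n) * ?x \<le> 2 ^ CARD('n) * \<epsilon>"
    by (simp add: power_divide field_simps)
  also have "\<dots> \<le> \<theta>" using \<theta> by (simp add: \<epsilon>_def)
  finally have "?x \<le> \<theta> / (2 ^ q) ^ CARD('n)" by (simp add: field_simps)
  then have "\<alpha> \<in> prim_slab (\<theta> / (2 ^ q) ^ CARD('n)) k"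
    using g unfolding prim_slab_def by blast
  then show "k \<in> hits n \<theta> \<alpha>" using q by (auto simp: hits_def)
qed

text \<open>
A constant multiple of the order of magnitude of \<open>1 / (ln N (ln (ln N))\<^sup>s)\<close> at \<open>N = 2 ^ 2 ^ l\<close>.
\<close>

definition block_threshold :: "real \<Rightarrow> real \<Rightarrow> nat \<Rightarrow> real" where
  "block_threshold K s l = K / (2 ^ l * real l powr s)"

lemma threshold_in_block:
  assumes l: "4 \<le> l" and N: "2 ^ 2 ^ (l - 1) < N" and s: "0 \<le> s"
  shows "1 / (ln (real N) * ln (ln (real N)) powr s) \<le> block_threshold (4 * 4 powr s) s l"
proof -
  have ln2: "1 / 2 \<le> ln (2 :: real)" using ln2_ge_two_thirds by linarith
  have p: "(2 :: real) ^ l = 2 * 2 ^ (l - 1)" using l by (simp flip: power_Suc)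
  have "real (2 ^ 2 ^ (l - 1)) \<le> real N" using N by (intro of_nat_mono) simp
  then have "ln ((2 :: real) ^ 2 ^ (l - 1)) \<le> ln (real N)" by (intro ln_mono) auto
  then have "2 ^ (l - 1) * ln 2 \<le> ln (real N)" by (simp add: ln_realpow)
  moreover have "(2 :: real) ^ (l - 1) * (1 / 2) \<le> 2 ^ (l - 1) * ln 2"
    using ln2 by (intro mult_left_mono) auto
  ultimately have N1: "2 ^ l / 4 \<le> ln (real N)" using p by linarith
  have "real l / 4 \<le> (real l - 2) * (1 / 2)" using l by (simp add: field_simps)
  also have "\<dots> \<le> (real l - 2) * ln 2" using ln2 l by (intro mult_left_mono) auto
  also have "\<dots> = ln ((2 :: real) ^ l / 4)"
    using ln_realpow[of 2 2] by (simp add: ln_div ln_realpow algebra_simps)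
  also have "\<dots> \<le> ln (ln (real N))" using N1 by (intro ln_mono) auto
  finally have N2: "real l / 4 \<le> ln (ln (real N))" .
  have le: "(2 ^ l / 4) * (real l / 4) powr s \<le> ln (real N) * ln (ln (real N)) powr s"
    using N1 N2 s l order_trans[OF _ N1, of 0] by (intro mult_mono powr_mono2) auto
  have "1 / (ln (real N) * ln (ln (real N)) powr s) \<le> 1 / ((2 ^ l / 4) * (real l / 4) powr s)"
  proof (rule divide_left_mono[OF le])
    have pos: "0 < (2 ^ l / 4) * (real l / 4) powr s" using l by simp
    show "0 < ln (real N) * ln (ln (real N)) powr s * ((2 ^ l / 4) * (real l / 4) powr s)"
      by (rule mult_pos_pos[OF less_le_trans[OF pos le] pos])
  qed simp
  also have "\<dots> = block_threshold (4 * 4 powr s) s l"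
    using l by (simp add: block_threshold_def powr_divide)
  finally show ?thesis .
qed

text \<open>
It suffices to consider \<open>c = 1\<close> and to group the \<open>N\<close> between \<open>2 ^ 2 ^ (l - 1)\<close> and \<open>2 ^ 2 ^ l\<close>; the
probabilities for these groups are summable because \<open>r s > 1\<close>.
\<close>

lemma AE_not_approximable:
  assumes r: "1 \<le> r" and s: "1 / real r < s"
  shows "AE \<alpha> in (tor :: (real ^ 'n) measure). \<not> approximable r s \<alpha>"
proof -
  define K where "K = 2 ^ CARD('n) * (4 * 4 powr s)"
  define \<theta> where "\<theta> = block_threshold K s"
  define b where "b l = 18 * 3 ^ CARD('n) * (real l * \<theta> l) + 160 * 9 ^ CARD('n) * (real l * 2 ^ l * (\<theta> l)\<^sup>2)
      + 8 * 3 ^ CARD('n) / (2 ^ l) ^ 5 + (64 * 3 ^ CARD('n) * 4 ^ r * (\<theta> l * 2 ^ l)) ^ r" for l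
  have s0: "s > 0" using r by (intro less_trans[OF _ s]) simp
  have K0: "K > 0" by (simp add: K_def)
  have "eventually (\<lambda>l. 1 / 4 ^ l \<le> \<theta> l) sequentially"
    unfolding \<theta>_def block_threshold_def using K0 s0 by real_asymp
  moreover have "eventually (\<lambda>l. \<theta> l \<le> 1 / 2) sequentially"
    unfolding \<theta>_def block_threshold_def using K0 s0 by real_asymp
  moreover have "eventually (\<lambda>l. max 4 r \<le> l) sequentially" by (rule eventually_ge_at_top)
  ultimately have ev: "eventually (\<lambda>l. 4 \<le> l \<and> r \<le> l \<and> 1 / 4 ^ l \<le> \<theta> l \<and> \<theta> l \<le> 1 / 2) sequentially"
    by eventually_elim auto
  then obtain l0 where l0: "\<And>l. l \<ge> l0 \<Longrightarrow> 4 \<le> l \<and> r \<le> l \<and> 1 / 4 ^ l \<le> \<theta> l \<and> \<theta> l \<le> 1 / 2"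
    unfolding eventually_sequentially by blast
  have "\<forall>l. \<exists>B\<in>sets borel. l \<ge> l0 \<longrightarrow> (\<forall>\<alpha> :: real ^ 'n. 2 * r \<le> card (hits (2 ^ l) (\<theta> l) \<alpha>) \<longrightarrow> \<alpha> \<in> B) \<and> tor.prob B \<le> b l"
  proof
    fix l
    show "\<exists>B\<in>sets borel. l \<ge> l0 \<longrightarrow> (\<forall>\<alpha> :: real ^ 'n. 2 * r \<le> card (hits (2 ^ l) (\<theta> l) \<alpha>) \<longrightarrow> \<alpha> \<in> B) \<and> tor.prob B \<le> b l"
    proof (cases "l \<ge> l0")
      case True
      then show ?thesis
        using l0[OF True] prob_many_hits_le[of l r "\<theta> l", where 'n = 'n] unfolding b_def by auto
    next
      case False
      then show ?thesis by (intro bexI[of _ "{}"]) auto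
    qed
  qed
  then obtain B where B: "\<And>l. B l \<in> sets borel"
    "\<And>l \<alpha>. l \<ge> l0 \<Longrightarrow> 2 * r \<le> card (hits (2 ^ l) (\<theta> l) (\<alpha> :: real ^ 'n)) \<Longrightarrow> \<alpha> \<in> B l"
    "\<And>l. l \<ge> l0 \<Longrightarrow> tor.prob (B l) \<le> b l"
    by metis
  have inv_sq: "summable (\<lambda>l. norm (1 / real l ^ 2))" using inverse_power_summable[of 2, where 'a = real] by (simp add: inverse_eq_divide)
  have "(\<lambda>l. real l * \<theta> l) \<in> O(\<lambda>l. 1 / real l ^ 2)"
    unfolding \<theta>_def block_threshold_def using K0 s0 by real_asymp
  then have s1: "summable (\<lambda>l. real l * \<theta> l)" by (rule summable_comparison_test_bigo[OF inv_sq])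
  have "(\<lambda>l. real l * 2 ^ l * (\<theta> l)\<^sup>2) \<in> O(\<lambda>l. 1 / real l ^ 2)"
    unfolding \<theta>_def block_threshold_def using K0 s0 by real_asymp
  then have s2: "summable (\<lambda>l. real l * 2 ^ l * (\<theta> l)\<^sup>2)" by (rule summable_comparison_test_bigo[OF inv_sq])
  have "(\<lambda>l. 8 * 3 ^ CARD('n) / (2 ^ l) ^ 5) \<in> O(\<lambda>l. 1 / real l ^ 2)"
    by real_asymp
  then have s3: "summable (\<lambda>l. 8 * 3 ^ CARD('n) / ((2 :: real) ^ l) ^ 5)" by (rule summable_comparison_test_bigo[OF inv_sq])
  have s4: "summable (\<lambda>l. (64 * 3 ^ CARD('n) * 4 ^ r * (\<theta> l * 2 ^ l)) ^ r)"
  proof -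
    have "1 < s * real r" using s r by (simp add: field_simps)
    then have "summable (\<lambda>l. (64 * 3 ^ CARD('n) * 4 ^ r * K) ^ r * real l powr (- (s * real r)))"
      by (intro summable_mult) (simp add: summable_real_powr_iff)
    moreover have "(64 * 3 ^ CARD('n) * 4 ^ r * (\<theta> l * 2 ^ l)) ^ r
        = (64 * 3 ^ CARD('n) * 4 ^ r * K) ^ r * real l powr (- (s * real r))" if "l \<ge> 1" for l
    proof -
      have "\<theta> l * 2 ^ l = K * real l powr (- s)"
        by (simp add: \<theta>_def block_threshold_def powr_minus divide_simps)
      then show ?thesis using that by (simp add: power_mult_distrib powr_powr flip: powr_realpow)
    qed
    ultimately show ?thesis
      by (subst summable_cong[where g = "\<lambda>l. (64 * 3 ^ CARD('n) * 4 ^ r * K) ^ r * real l powr (- (s * real r))"])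
         (auto intro!: eventually_sequentiallyI[of 1])
  qed
  have "summable b" unfolding b_def by (intro summable_add summable_mult s1 s2 s3 s4)
  then have "summable (\<lambda>l. tor.prob (B l))"
  proof (rule summable_comparison_test'[where N = l0])
    show "norm (tor.prob (B l)) \<le> b l" if "l \<ge> l0" for l using B(3)[OF that] by simp
  qed
  then have "AE \<alpha> in tor. eventually (\<lambda>l. \<alpha> \<in> space tor - B l) sequentially"
    using B(1) by (intro borel_cantelli_AE1) (auto simp: tor.emeasure_eq_measure)
  then show ?thesis
  proof (rule AE_mp, intro AE_I2 impI notI)
    fix \<alpha> :: "real ^ 'n"
    assume "eventually (\<lambda>l. \<alpha> \<in> space tor - B l) sequentially" and app: "approximable r s \<alpha>"
    then obtain l1 where l1: "\<And>l. l \<ge> l1 \<Longrightarrow> \<alpha> \<notin> B l" unfolding eventually_sequentially by auto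
    define l2 where "l2 = max l0 l1"
    have "infinite {N. card (D_set \<alpha> s 1 N) \<ge> 2 * r}" using app unfolding approximable_def by auto
    then obtain N where N: "N > 2 ^ 2 ^ l2" "card (D_set \<alpha> s 1 N) \<ge> 2 * r"
      unfolding infinite_nat_iff_unbounded by blast
    define l where "l = (LEAST l. N \<le> 2 ^ 2 ^ l)"
    have ex: "N \<le> 2 ^ 2 ^ N"
      by (meson less_exp less_imp_le order_trans)
    have Nl: "N \<le> 2 ^ 2 ^ l" unfolding l_def by (rule LeastI[of "\<lambda>l. N \<le> 2 ^ 2 ^ l", OF ex])
    have "l > l2"
    proof (rule ccontr)
      assume "\<not> l > l2"
      then have "(2 :: nat) ^ 2 ^ l \<le> 2 ^ 2 ^ l2" by (intro power_increasing) auto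
      then show False using N(1) Nl by (meson leD order_trans)
    qed
    then have ll: "l \<ge> l0" "l \<ge> l1" "l > 0" by (auto simp: l2_def)
    then have Nl': "2 ^ 2 ^ (l - 1) < N"
      using not_less_Least[of "l - 1" "\<lambda>l. N \<le> 2 ^ 2 ^ l"] by (auto simp: l_def not_le)
    have "1 / (ln (real N) * ln (ln (real N)) powr s) \<le> block_threshold (4 * 4 powr s) s l"
      using l0[OF ll(1)] Nl' s0 by (intro threshold_in_block) auto
    then have "2 ^ CARD('n) * (1 / (ln (real N) * ln (ln (real N)) powr s))
        \<le> 2 ^ CARD('n) * block_threshold (4 * 4 powr s) s l"
      by (rule mult_left_mono) simp
    also have "\<dots> = \<theta> l" by (simp add: \<theta>_def K_def block_threshold_def)
    finally have "2 ^ CARD('n) * (1 / (ln (real N) * ln (ln (real N)) powr s)) \<le> \<theta> l" .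
    from D_set_subset_hits[OF Nl this] have "D_set \<alpha> s 1 N \<subseteq> hits (2 ^ l) (\<theta> l) \<alpha>" .
    moreover have "finite (hits (2 ^ l) (\<theta> l) \<alpha>)" unfolding hits_def by auto
    ultimately have "2 * r \<le> card (hits (2 ^ l) (\<theta> l) \<alpha>)" using N(2) card_mono order_trans by blast
    then show False using B(2)[OF ll(1)] l1[OF ll(2)] by blast
  qed
qed

section \<open>Equidistribution in unions of grid cubes\<close>

text \<open>
The periodic unions of cubes of the grid of mesh \<open>1 / 2 ^ p\<close>.
\<close>

definition grid_set :: "nat \<Rightarrow> (real ^ 'n) set \<Rightarrow> bool" where
  "grid_set p S \<longleftrightarrow> (\<forall>\<alpha> z. \<alpha> + real_vec z \<in> S \<longleftrightarrow> \<alpha> \<in> S) \<and>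
    (\<forall>\<alpha> \<alpha>'. (\<forall>i. \<lfloor>2 ^ p * \<alpha> $ i\<rfloor> = \<lfloor>2 ^ p * \<alpha>' $ i\<rfloor>) \<longrightarrow> \<alpha> \<in> S \<longrightarrow> \<alpha>' \<in> S)"

text \<open>
The neighbourhood of the faces of the cubes, of relative size \<open>\<epsilon>\<close>; written with slabs, so that their
measure and their behaviour under shifts are available.
\<close>

definition grid_boundary :: "real \<Rightarrow> nat \<Rightarrow> (real ^ 'n) set" where
  "grid_boundary \<epsilon> p = (\<Union>i. slab \<epsilon> (axis i (2 ^ p)))"

lemma grid_set_periodic: "grid_set p S \<Longrightarrow> \<alpha> + real_vec z \<in> S \<longleftrightarrow> \<alpha> \<in> S"
  by (simp add: grid_set_def)

lemma grid_set_cell: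
  "grid_set p S \<Longrightarrow> (\<And>i. \<lfloor>2 ^ p * \<alpha> $ i\<rfloor> = \<lfloor>2 ^ p * \<alpha>' $ i\<rfloor>) \<Longrightarrow> \<alpha> \<in> S \<longleftrightarrow> \<alpha>' \<in> S"
  unfolding grid_set_def by metis

lemma grid_set_sets:
  fixes S :: "(real ^ 'n) set"
  assumes "grid_set p S"
  shows "S \<in> sets borel"
proof -
  define c where "c \<alpha> = (\<chi> i. \<lfloor>2 ^ p * \<alpha> $ i\<rfloor>)" for \<alpha> :: "real ^ 'n"
  have "S = (\<Union>z\<in>c ` S. {\<alpha>. \<forall>i. \<lfloor>2 ^ p * \<alpha> $ i\<rfloor> = z $ i})"
  proof (intro equalityI subsetI)
    fix \<alpha> :: "real ^ 'n" assume "\<alpha> \<in> (\<Union>z\<in>c ` S. {\<alpha>. \<forall>i. \<lfloor>2 ^ p * \<alpha> $ i\<rfloor> = z $ i})"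
    then obtain \<alpha>' where "\<alpha>' \<in> S" "\<And>i. \<lfloor>2 ^ p * \<alpha> $ i\<rfloor> = \<lfloor>2 ^ p * \<alpha>' $ i\<rfloor>"
      by (auto simp: c_def)
    then show "\<alpha> \<in> S" using grid_set_cell[OF assms, of \<alpha> \<alpha>'] by blast
  qed (auto simp: c_def)
  moreover have "(\<Union>z\<in>c ` S. {\<alpha> :: real ^ 'n. \<forall>i. \<lfloor>2 ^ p * \<alpha> $ i\<rfloor> = z $ i}) \<in> sets borel"
    by (intro sets.countable_UN') auto
  ultimately show ?thesis by simp
qed

lemma grid_boundary_sets [measurable]: "grid_boundary \<epsilon> p \<in> sets borel"
  unfolding grid_boundary_def by (intro sets.finite_UN) auto

lemma grid_boundary_periodic: "\<alpha> + real_vec z \<in> grid_boundary \<epsilon> p \<longleftrightarrow> \<alpha> \<in> grid_boundary \<epsilon> p"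
  by (simp add: grid_boundary_def slab_periodic)

lemma prob_grid_boundary_le:
  assumes "0 \<le> \<epsilon>"
  shows "tor.prob (grid_boundary \<epsilon> p :: (real ^ 'n) set) \<le> 2 * real CARD('n) * \<epsilon>"
proof -
  have "tor.prob (grid_boundary \<epsilon> p :: (real ^ 'n) set)
      \<le> (\<Sum>i\<in>(UNIV :: 'n set). tor.prob (slab \<epsilon> (axis i (2 ^ p))))"
    unfolding grid_boundary_def by (intro tor.finite_measure_subadditive_finite) auto
  also have "\<dots> \<le> (\<Sum>i\<in>(UNIV :: 'n set). 2 * \<epsilon>)"
    using assms by (intro sum_mono prob_slab_le) (auto simp: axis_eq_0_iff)
  finally show ?thesis by simp
qed

lemma floor_eq_or_near:
  assumes "0 \<le> \<beta>" "\<beta> \<le> \<epsilon>"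
  shows "\<lfloor>x + \<beta>\<rfloor> = \<lfloor>x :: real\<rfloor> \<or> near \<epsilon> x"
proof (cases "x + \<beta> < of_int (\<lfloor>x\<rfloor> + 1)")
  case True
  then have "\<lfloor>x + \<beta>\<rfloor> = \<lfloor>x\<rfloor>" using assms by (intro floor_unique) linarith+
  then show ?thesis by simp
next
  case False
  have "x < of_int (\<lfloor>x\<rfloor> + 1)" by linarith
  then have "\<bar>x + of_int (- (\<lfloor>x\<rfloor> + 1))\<bar> \<le> \<epsilon>"
    using False assms unfolding of_int_minus by linarith
  then show ?thesis unfolding near_def by blast
qed

lemma grid_set_shift:
  fixes \<alpha> :: "real ^ 'n"
  assumes "grid_set p S" "0 \<le> \<beta>" "2 ^ p * \<beta> \<le> \<epsilon>" "\<alpha> \<notin> grid_boundary \<epsilon> p"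
  shows "\<alpha> + \<beta> *\<^sub>R axis i 1 \<in> S \<longleftrightarrow> \<alpha> \<in> S"
proof (rule grid_set_cell[OF assms(1)])
  fix j
  have "\<not> near \<epsilon> (2 ^ p * \<alpha> $ i)"
    using assms(4) by (auto simp: grid_boundary_def slab_def real_vec_def inner_vec_def axis_def if_distrib
        if_distribR cong: if_cong)
  then have "\<lfloor>2 ^ p * \<alpha> $ i + 2 ^ p * \<beta>\<rfloor> = \<lfloor>2 ^ p * \<alpha> $ i\<rfloor>"
    using floor_eq_or_near[of "2 ^ p * \<beta>" \<epsilon> "2 ^ p * \<alpha> $ i"] assms(2,3) by auto
  then show "\<lfloor>2 ^ p * (\<alpha> + \<beta> *\<^sub>R axis i 1) $ j\<rfloor> = \<lfloor>2 ^ p * \<alpha> $ j\<rfloor>"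
    by (cases "j = i") (auto simp: axis_def distrib_left)
qed

lemma grid_boundary_shift:
  assumes "0 \<le> \<beta>" "2 ^ p * \<beta> \<le> \<epsilon>" "\<alpha> + \<beta> *\<^sub>R axis i 1 \<in> grid_boundary \<delta> p" "\<delta> + \<epsilon> \<le> \<delta>'"
  shows "\<alpha> \<in> grid_boundary \<delta>' p"
proof -
  from assms(3) obtain j where j: "\<alpha> + \<beta> *\<^sub>R axis i 1 \<in> slab \<delta> (axis j (2 ^ p))"
    by (auto simp: grid_boundary_def)
  have "0 \<le> \<epsilon>" using assms(1,2) by (meson mult_nonneg_nonneg order_trans zero_le_numeral zero_le_power)
  then have "\<bar>\<beta>\<bar> * of_int \<bar>axis j (2 ^ p) $ i\<bar> \<le> \<epsilon>"
    using assms(1,2) by (simp add: axis_def mult.commute)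
  from slab_shift[OF j this assms(4)] show ?thesis by (auto simp: grid_boundary_def)
qed

text \<open>
A shift along a coordinate by \<open>1 / |k\<^sub>i|\<close> lets \<open>k \<bullet> \<alpha>\<close> run through one period, and off a
neighbourhood of the boundary it does not leave \<open>S\<close> nor enter it.
\<close>

lemma
  fixes k :: "int ^ 'n"
  assumes S: "grid_set p S" and k: "k $ i \<noteq> 0" and d: "0 \<le> \<delta>" "\<delta> \<le> 1/2"
  defines "\<epsilon> \<equiv> 2 ^ p / real_of_int \<bar>k $ i\<bar>"
  shows prob_grid_slab_ge: "2 * \<delta> * (tor.prob S - 2 * real CARD('n) * \<epsilon>) \<le> tor.prob (S \<inter> slab \<delta> k)"
    and prob_grid_slab_le: "tor.prob (S \<inter> slab \<delta> k) \<le> 2 * \<delta> * (tor.prob S + 2 * real CARD('n) * \<epsilon>)"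
proof -
  define n where "n = real_of_int (k $ i)"
  have n: "n \<noteq> 0" using k by (simp add: n_def)
  have \<epsilon>: "0 \<le> \<epsilon>" "\<epsilon> = 2 ^ p * (1 / \<bar>n\<bar>)" by (simp_all add: \<epsilon>_def n_def)
  let ?A = "{0..<1/\<bar>n\<bar>}" and ?e = "axis i (1 :: real)"
  let ?B = "grid_boundary \<epsilon> p :: (real ^ 'n) set"
  let ?f = "indicator (S \<inter> slab \<delta> k) :: real ^ 'n \<Rightarrow> ennreal"
  let ?g = "\<lambda>\<alpha>. (\<integral>\<^sup>+\<beta>. ?f (\<alpha> + \<beta> *\<^sub>R ?e) * indicator ?A \<beta> \<partial>lborel)"
  have [measurable]: "S \<in> sets borel" by (rule grid_set_sets[OF S])
  have "periodic ?f"
    by (intro periodic_indicator) (auto simp: slab_periodic grid_set_periodic[OF S])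
  then have avg: "ennreal (1 / \<bar>n\<bar>) * emeasure tor (S \<inter> slab \<delta> k) = (\<integral>\<^sup>+\<alpha>. ?g \<alpha> \<partial>tor)"
    using nn_integral_tor_shift_average[of ?f ?A ?e] by simp
  have inner: "?g \<alpha> = indicator S \<alpha> * ennreal (2 * \<delta> / \<bar>n\<bar>)" if \<alpha>: "\<alpha> \<notin> ?B" for \<alpha>
  proof -
    have "?g \<alpha> = (\<integral>\<^sup>+\<beta>. indicator S \<alpha> * (indicator {\<beta>. near \<delta> (real_vec k \<bullet> \<alpha> + \<beta> * n)} \<beta> * indicator ?A \<beta>) \<partial>lborel)"
    proof (intro nn_integral_cong)
      fix \<beta> :: real
      have "\<alpha> + \<beta> *\<^sub>R ?e \<in> S \<longleftrightarrow> \<alpha> \<in> S" if "\<beta> \<in> ?A"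
        using that \<alpha> mult_left_mono[of \<beta> "1 / \<bar>n\<bar>" "2 ^ p"] unfolding \<epsilon>(2)
        by (intro grid_set_shift[OF S]) auto
      then show "?f (\<alpha> + \<beta> *\<^sub>R ?e) * indicator ?A \<beta>
        = indicator S \<alpha> * (indicator {\<beta>. near \<delta> (real_vec k \<bullet> \<alpha> + \<beta> * n)} \<beta> * indicator ?A \<beta>)"
        by (auto simp: indicator_def slab_def inner_add_right inner_axis n_def)
    qed
    also have "\<dots> = indicator S \<alpha> * ennreal (2 * \<delta> / \<bar>n\<bar>)"
      by (subst nn_integral_cmult) (auto simp: nn_integral_near_period[OF d n])
    finally show ?thesis .
  qed
  have inner_le: "?g \<alpha> \<le> ennreal (2 * \<delta> / \<bar>n\<bar>)" for \<alpha>
  proof -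
    have "?g \<alpha> \<le> (\<integral>\<^sup>+\<beta>. indicator {\<beta>. near \<delta> (real_vec k \<bullet> \<alpha> + \<beta> * n)} \<beta> * indicator ?A \<beta> \<partial>lborel)"
      by (intro nn_integral_mono) (auto simp: indicator_def slab_def inner_add_right inner_axis n_def)
    then show ?thesis by (simp add: nn_integral_near_period[OF d n])
  qed
  have cancel: "ennreal (1 / \<bar>n\<bar>) * emeasure tor X = ennreal (1 / \<bar>n\<bar> * tor.prob X)" for X :: "(real ^ 'n) set"
    unfolding tor.emeasure_eq_measure by (rule ennreal_mult[symmetric]) auto
  have int_ind: "(\<integral>\<^sup>+\<alpha>. indicator X \<alpha> * ennreal (2 * \<delta> / \<bar>n\<bar>) \<partial>tor) = ennreal (1 / \<bar>n\<bar> * (2 * \<delta> * tor.prob X))"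
    if [measurable]: "X \<in> sets borel" for X :: "(real ^ 'n) set"
  proof -
    have "(\<integral>\<^sup>+\<alpha>. indicator X \<alpha> * ennreal (2 * \<delta> / \<bar>n\<bar>) \<partial>tor) = ennreal (tor.prob X) * ennreal (2 * \<delta> / \<bar>n\<bar>)"
      by (subst nn_integral_multc) (auto simp: tor.emeasure_eq_measure)
    also have "\<dots> = ennreal (tor.prob X * (2 * \<delta> / \<bar>n\<bar>))"
      using d by (intro ennreal_mult[symmetric]) auto
    also have "tor.prob X * (2 * \<delta> / \<bar>n\<bar>) = 1 / \<bar>n\<bar> * (2 * \<delta> * tor.prob X)" by simp
    finally show ?thesis .
  qed
  have B: "tor.prob ?B \<le> 2 * real CARD('n) * \<epsilon>" by (rule prob_grid_boundary_le[OF \<epsilon>(1)])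
  have "(\<integral>\<^sup>+\<alpha>. indicator (S - ?B) \<alpha> * ennreal (2 * \<delta> / \<bar>n\<bar>) \<partial>tor) \<le> (\<integral>\<^sup>+\<alpha>. ?g \<alpha> \<partial>tor)"
  proof (rule nn_integral_mono)
    fix \<alpha> :: "real ^ 'n"
    show "indicator (S - ?B) \<alpha> * ennreal (2 * \<delta> / \<bar>n\<bar>) \<le> ?g \<alpha>"
    proof (cases "\<alpha> \<in> ?B")
      case False
      show ?thesis unfolding inner[OF False] by (auto simp: indicator_def)
    qed simp
  qed
  then have "ennreal (1 / \<bar>n\<bar> * (2 * \<delta> * tor.prob (S - ?B))) \<le> ennreal (1 / \<bar>n\<bar> * tor.prob (S \<inter> slab \<delta> k))"
    unfolding avg[symmetric] cancel by (subst (asm) int_ind) auto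
  then have "1 / \<bar>n\<bar> * (2 * \<delta> * tor.prob (S - ?B)) \<le> 1 / \<bar>n\<bar> * tor.prob (S \<inter> slab \<delta> k)"
    by (subst (asm) ennreal_le_iff) auto
  then have "2 * \<delta> * tor.prob (S - ?B) \<le> tor.prob (S \<inter> slab \<delta> k)"
    using n by (subst (asm) mult_le_cancel_left_pos) auto
  moreover have "tor.prob S - tor.prob ?B \<le> tor.prob (S - ?B)"
    using tor.finite_measure_mono[of "S \<inter> ?B" ?B] by (subst tor.finite_measure_Diff') auto
  then have "2 * \<delta> * (tor.prob S - 2 * real CARD('n) * \<epsilon>) \<le> 2 * \<delta> * tor.prob (S - ?B)"
    using B d by (intro mult_left_mono) auto
  ultimately show "2 * \<delta> * (tor.prob S - 2 * real CARD('n) * \<epsilon>) \<le> tor.prob (S \<inter> slab \<delta> k)" by linarith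
  have "(\<integral>\<^sup>+\<alpha>. ?g \<alpha> \<partial>tor) \<le> (\<integral>\<^sup>+\<alpha>. indicator (S \<union> ?B) \<alpha> * ennreal (2 * \<delta> / \<bar>n\<bar>) \<partial>tor)"
  proof (rule nn_integral_mono)
    fix \<alpha> :: "real ^ 'n"
    show "?g \<alpha> \<le> indicator (S \<union> ?B) \<alpha> * ennreal (2 * \<delta> / \<bar>n\<bar>)"
    proof (cases "\<alpha> \<in> ?B")
      case True
      then have "indicator (S \<union> ?B) \<alpha> * ennreal (2 * \<delta> / \<bar>n\<bar>) = ennreal (2 * \<delta> / \<bar>n\<bar>)" by simp
      then show ?thesis using inner_le[of \<alpha>] by (simp only:)
    next
      case False
      show ?thesis unfolding inner[OF False] by (auto simp: indicator_def)
    qed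
  qed
  then have "ennreal (1 / \<bar>n\<bar> * tor.prob (S \<inter> slab \<delta> k)) \<le> ennreal (1 / \<bar>n\<bar> * (2 * \<delta> * tor.prob (S \<union> ?B)))"
    unfolding avg[symmetric] cancel by (subst (asm) int_ind) auto
  then have "1 / \<bar>n\<bar> * tor.prob (S \<inter> slab \<delta> k) \<le> 1 / \<bar>n\<bar> * (2 * \<delta> * tor.prob (S \<union> ?B))"
    using d by (subst (asm) ennreal_le_iff) auto
  then have "tor.prob (S \<inter> slab \<delta> k) \<le> 2 * \<delta> * tor.prob (S \<union> ?B)"
    using n by (subst (asm) mult_le_cancel_left_pos) auto
  also have "\<dots> \<le> 2 * \<delta> * (tor.prob S + 2 * real CARD('n) * \<epsilon>)"
    using measure_Un_le[of S tor ?B] B d by (intro mult_left_mono) auto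
  finally show "tor.prob (S \<inter> slab \<delta> k) \<le> 2 * \<delta> * (tor.prob S + 2 * real CARD('n) * \<epsilon>)" .
qed

text \<open>
A part of the shell of positive proportion that contains no two opposite vectors and has product
structure.
\<close>

definition quadrant_shell :: "'n :: finite \<Rightarrow> nat \<Rightarrow> (int ^ 'n) set" where
  "quadrant_shell i q = {k. (\<forall>j. 1 \<le> k $ j \<and> k $ j \<le> 2 ^ q) \<and> 2 ^ q < 2 * k $ i}"

lemma quadrant_shell_subset: "quadrant_shell i q \<subseteq> shell q"
proof
  fix k assume k: "k \<in> quadrant_shell i q"
  then have pos: "1 \<le> k $ j" for j by (simp add: quadrant_shell_def)
  have "\<bar>k $ j\<bar> = k $ j" for j using pos[of j] by linarith
  then show "k \<in> shell q" using k by (auto simp: quadrant_shell_def shell_def)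
qed

lemma quadrant_shell_pos:
  assumes "k \<in> quadrant_shell i q"
  shows "0 < k $ j"
proof -
  have "1 \<le> k $ j" using assms by (simp add: quadrant_shell_def)
  then show ?thesis by linarith
qed

lemma finite_quadrant_shell [simp]: "finite (quadrant_shell i q)"
  by (rule finite_subset[OF quadrant_shell_subset finite_shell])

lemma sum_quadrant_shell:
  fixes F :: "int \<Rightarrow> real" and i :: "'n :: finite"
  assumes "1 \<le> q"
  shows "(\<Sum>k\<in>quadrant_shell i q. F (k $ i)) = (2 ^ q) ^ (CARD('n) - 1) * (\<Sum>\<kappa>=2 ^ (q - 1) + 1..2 ^ q. F \<kappa>)"
proof -
  let ?T = "{2 ^ (q - 1) + 1..2 ^ q :: int}"
  have q: "(2 :: int) ^ q = 2 * 2 ^ (q - 1)" using assms by (simp flip: power_Suc)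
  have T: "\<kappa> \<in> ?T \<longleftrightarrow> 2 ^ q < 2 * \<kappa> \<and> \<kappa> \<le> 2 ^ q" for \<kappa> unfolding q by auto
  have group: "(\<Sum>\<kappa>\<in>?T. \<Sum>k\<in>{k \<in> quadrant_shell i q. k $ i = \<kappa>}. F (k $ i)) = (\<Sum>k\<in>quadrant_shell i q. F (k $ i))"
  proof (rule sum.group)
    show "(\<lambda>k. k $ i) ` quadrant_shell i q \<subseteq> ?T"
      by (rule image_subsetI) (simp only: T, simp add: quadrant_shell_def)
  qed auto
  have "(\<Sum>k\<in>{k \<in> quadrant_shell i q. k $ i = \<kappa>}. F (k $ i)) = (2 ^ q) ^ (CARD('n) - 1) * F \<kappa>"
    if "\<kappa> \<in> ?T" for \<kappa>
  proof -
    have "2 ^ q < 2 * \<kappa>" "1 \<le> \<kappa>" "\<kappa> \<le> 2 ^ q" using that zero_le_power[of "2 :: int" q] unfolding T by linarith+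
    note \<kappa> = this
    have eq: "{k \<in> quadrant_shell i q. k $ i = \<kappa>} = {k :: int ^ 'n. \<forall>j. k $ j \<in> (if j = i then {\<kappa>} else {1..2 ^ q})}"
    proof (intro equalityI subsetI)
      fix k assume k: "k \<in> {k :: int ^ 'n. \<forall>j. k $ j \<in> (if j = i then {\<kappa>} else {1..2 ^ q})}"
      then have "k $ i \<in> (if i = i then {\<kappa>} else {1..2 ^ q})" by blast
      then have ki: "k $ i = \<kappa>" by simp
      have "1 \<le> k $ j \<and> k $ j \<le> 2 ^ q" for j
      proof (cases "j = i")
        case False
        have "k $ j \<in> (if j = i then {\<kappa>} else {1..2 ^ q})" using k by blast
        then show ?thesis using False by simp
      qed (use ki \<kappa> in simp)
      then show "k \<in> {k \<in> quadrant_shell i q. k $ i = \<kappa>}"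
        using ki \<kappa> by (simp add: quadrant_shell_def)
    qed (auto simp: quadrant_shell_def)
    have "card {k \<in> quadrant_shell i q. k $ i = \<kappa>} = (\<Prod>j\<in>UNIV. card (if j = i then {\<kappa>} else {1..2 ^ q}))"
      unfolding eq by (rule card_vec_in_set)
    also have "\<dots> = (\<Prod>j\<in>UNIV - {i}. 2 ^ q)"
      by (subst prod.remove[of _ i]) (auto intro!: prod.cong simp: nat_power_eq)
    also have "\<dots> = (2 ^ q) ^ (CARD('n) - 1)" by simp
    finally show ?thesis by simp
  qed
  then show ?thesis unfolding group[symmetric] sum_distrib_left by (rule sum.cong[OF refl])
qed

section \<open>The expected number of primitive hits\<close>

lemma card_multiples_le:
  fixes g h :: int
  assumes "1 \<le> g" "0 \<le> h"
  shows "real (card {\<kappa> \<in> {h + 1..2 * h}. g dvd \<kappa>}) \<le> of_int h / of_int g + 1"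
proof -
  have "(\<lambda>\<kappa>. \<kappa> div g) ` {\<kappa> \<in> {h + 1..2 * h}. g dvd \<kappa>} \<subseteq> {h div g + 1..2 * h div g}"
  proof clarify
    fix \<kappa> assume k: "\<kappa> \<in> {h + 1..2 * h}" "g dvd \<kappa>"
    then obtain t where t: "\<kappa> = g * t" by blast
    have "h div g * g \<le> h" 
      using assms minus_mod_eq_div_mult[of h g] pos_mod_sign[of g h] by linarith
    then have "h div g * g < t * g" using k t by (simp add: mult.commute)
    then have "h div g < t" using assms by (simp add: mult_less_cancel_right)
    moreover have "t \<le> 2 * h div g"
      using zdiv_mono1[of "g * t" "2 * h" g] k t assms by simp
    ultimately show "\<kappa> div g \<in> {h div g + 1..2 * h div g}" using t assms by simp
  qed
  moreover have "inj_on (\<lambda>\<kappa>. \<kappa> div g) {\<kappa> \<in> {h + 1..2 * h}. g dvd \<kappa>}"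
    by (auto simp: inj_on_def dvd_div_eq_iff)
  ultimately have "card {\<kappa> \<in> {h + 1..2 * h}. g dvd \<kappa>} \<le> card {h div g + 1..2 * h div g}"
    by (intro card_inj_on_le[where f = "\<lambda>\<kappa>. \<kappa> div g"]) auto
  also have "\<dots> = nat (2 * h div g - h div g)" by simp
  finally have "real (card {\<kappa> \<in> {h + 1..2 * h}. g dvd \<kappa>}) \<le> real (nat (2 * h div g - h div g))"
    by (rule of_nat_mono)
  also have "\<dots> = of_int (2 * h div g) - of_int (h div g)"
    using zdiv_mono1[of h "2 * h" g] assms by simp
  also have "of_int (2 * h div g) \<le> real_of_int (2 * h) / of_int g" by (rule real_of_int_div4)
  also have "real_of_int (2 * h) / of_int g - of_int (h div g) \<le> of_int h / of_int g + 1"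
  proof -
    have "real_of_int (2 * h) / of_int g = of_int h / of_int g + of_int h / of_int g"
      by (simp flip: add_divide_distrib)
    then show ?thesis using real_of_int_div3[of h g] by linarith
  qed
  finally show ?thesis by simp
qed

text \<open>
What matters is that the bound is below \<open>1\<close>: it limits the proportion of non-primitive pairs
\<open>(k, m)\<close>.
\<close>

lemma sum_inverse_squares_le:
  fixes n :: int
  assumes "2 \<le> n"
  shows "(\<Sum>g=2..n. 1 / (real_of_int g)\<^sup>2) \<le> 3 / 4 - 1 / of_int n"
  using assms
proof (induction n rule: int_ge_induct)
  case (step n)
  have "{2..n + 1} = insert (n + 1) {2..n}" using step.hyps by auto
  then have "(\<Sum>g=2..n + 1. 1 / (real_of_int g)\<^sup>2) = 1 / (of_int n + 1)\<^sup>2 + (\<Sum>g=2..n. 1 / (real_of_int g)\<^sup>2)"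
    by simp
  also have "1 / (of_int n + 1)\<^sup>2 \<le> 1 / real_of_int n - 1 / (of_int n + 1)"
  proof -
    have "1 / (of_int n + 1)\<^sup>2 \<le> 1 / (real_of_int n * (of_int n + 1))"
      using step.hyps by (intro divide_left_mono) (auto simp: power2_eq_square intro!: mult_right_mono)
    also have "\<dots> = 1 / real_of_int n - 1 / (of_int n + 1)"
      using step.hyps by (simp add: field_simps)
    finally show ?thesis .
  qed
  finally show ?case using step.IH by simp
qed simp

lemma sum_over_divisors_le:
  fixes q :: nat
  assumes q: "1 \<le> q"
  defines "h \<equiv> 2 ^ (q - 1) :: int"
  shows sum_inverse_divisors_le:
      "(\<Sum>\<kappa>=h + 1..2 ^ q. \<Sum>g\<in>{g \<in> {2..2 ^ q}. g dvd \<kappa>}. 1 / real_of_int g) \<le> 3 / 4 * of_int h + real q"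
    and sum_card_divisors_le:
      "(\<Sum>\<kappa>=h + 1..2 ^ q. real (card {g \<in> {2..2 ^ q}. g dvd \<kappa>})) \<le> of_int h * (real q + 2)"
proof -
  have h: "2 ^ q = 2 * h" "1 \<le> h" using q by (auto simp: h_def simp flip: power_Suc)
  let ?T = "{h + 1..2 ^ q}" and ?G = "{2..2 ^ q :: int}"
  have swap: "(\<Sum>\<kappa>\<in>?T. \<Sum>g\<in>{g \<in> ?G. g dvd \<kappa>}. w g) = (\<Sum>g\<in>?G. w g * real (card {\<kappa> \<in> ?T. g dvd \<kappa>}))"
    for w :: "int \<Rightarrow> real"
    by (subst sum.swap_restrict) (auto simp: mult.commute)
  have card: "real (card {\<kappa> \<in> ?T. g dvd \<kappa>}) \<le> of_int h / of_int g + 1" if "g \<in> ?G" for g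
    using card_multiples_le[of g h] that h by simp
  have harm: "(\<Sum>g\<in>?G. 1 / real_of_int g) \<le> real q"
  proof -
    have "{1..2 ^ q} = insert 1 ?G" by auto
    then have "(\<Sum>g=1..2 ^ q. 1 / real_of_int g) = 1 + (\<Sum>g\<in>?G. 1 / real_of_int g)" by simp
    then show ?thesis using harmonic_dyadic_le[of q] by simp
  qed
  have "(\<Sum>\<kappa>\<in>?T. \<Sum>g\<in>{g \<in> ?G. g dvd \<kappa>}. 1 / real_of_int g)
      \<le> (\<Sum>g\<in>?G. 1 / of_int g * (of_int h / of_int g + 1))"
    unfolding swap by (intro sum_mono mult_left_mono card) auto
  also have "\<dots> = of_int h * (\<Sum>g\<in>?G. 1 / (real_of_int g)\<^sup>2) + (\<Sum>g\<in>?G. 1 / real_of_int g)"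
    by (simp add: sum_distrib_left distrib_left sum.distrib power2_eq_square)
  also have "\<dots> \<le> of_int h * (3 / 4) + real q"
  proof (intro add_mono mult_left_mono harm)
    have "2 \<le> 2 * h" using h by simp
    then have "(\<Sum>g\<in>?G. 1 / (real_of_int g)\<^sup>2) \<le> 3 / 4 - 1 / of_int (2 * h)"
      unfolding h(1) by (rule sum_inverse_squares_le)
    also have "\<dots> \<le> 3 / 4" using h by simp
    finally show "(\<Sum>g\<in>?G. 1 / (real_of_int g)\<^sup>2) \<le> 3 / 4" .
  qed (use h in auto)
  finally show "(\<Sum>\<kappa>\<in>?T. \<Sum>g\<in>{g \<in> ?G. g dvd \<kappa>}. 1 / real_of_int g) \<le> 3 / 4 * of_int h + real q"
    by simp
  have "(\<Sum>\<kappa>\<in>?T. real (card {g \<in> ?G. g dvd \<kappa>})) = (\<Sum>\<kappa>\<in>?T. \<Sum>g\<in>{g \<in> ?G. g dvd \<kappa>}. 1)" by simp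
  also have "\<dots> \<le> (\<Sum>g\<in>?G. 1 * (of_int h / of_int g + 1))"
    unfolding swap by (intro sum_mono mult_left_mono card) auto
  also have "\<dots> = of_int h * (\<Sum>g\<in>?G. 1 / real_of_int g) + real (card ?G)"
    by (simp add: sum_distrib_left sum.distrib)
  also have "\<dots> \<le> of_int h * real q + 2 * of_int h"
    using harm h by (intro add_mono mult_left_mono) auto
  finally show "(\<Sum>\<kappa>\<in>?T. real (card {g \<in> ?G. g dvd \<kappa>})) \<le> of_int h * (real q + 2)"
    by (simp add: algebra_simps)
qed

text \<open>
Dividing \<open>(k, m)\<close> by its greatest common divisor \<open>g\<close> leads to a thinner slab for a shorter vector.
\<close>

lemma slab_subset_prim_slabs:
  fixes k :: "int ^ 'n"
  assumes i: "0 < k $ i" "k $ i \<le> n"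
  shows "slab \<delta> k \<subseteq> prim_slab \<delta> k \<union>
    (\<Union>g\<in>{g \<in> {2..n}. \<forall>j. g dvd k $ j}. slab (\<delta> / of_int g) (\<chi> j. k $ j div g))"
proof
  fix \<alpha> assume "\<alpha> \<in> slab \<delta> k"
  then obtain m :: int where m: "\<bar>real_vec k \<bullet> \<alpha> + of_int m\<bar> \<le> \<delta>" by (auto simp: slab_def near_def)
  define g where "g = Gcd (insert m (range (\<lambda>j. k $ j)))"
  have g: "g dvd m" "g dvd k $ j" for j unfolding g_def by (rule Gcd_dvd, simp)+
  have g0: "g \<ge> 0" by (simp add: g_def)
  have "g \<le> k $ i" using g(2)[of i] i(1) by (rule zdvd_imp_le)
  moreover have "g \<noteq> 0" using g(2)[of i] i(1) by auto
  ultimately have gn: "1 \<le> g" "g \<le> n" using g0 i by auto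
  show "\<alpha> \<in> prim_slab \<delta> k \<union> (\<Union>g\<in>{g \<in> {2..n}. \<forall>j. g dvd k $ j}. slab (\<delta> / of_int g) (\<chi> j. k $ j div g))"
  proof (cases "g = 1")
    case True
    then have "Gcd (insert m (range (\<lambda>j. k $ j))) = 1" unfolding g_def .
    then have "\<alpha> \<in> prim_slab \<delta> k" unfolding prim_slab_def using m by blast
    then show ?thesis by simp
  next
    case False
    have "real_vec k = of_int g *\<^sub>R real_vec (\<chi> j. k $ j div g)"
    proof -
      have "real_of_int (k $ j) = of_int g * of_int (k $ j div g)" for j
        using arg_cong[OF dvd_mult_div_cancel[OF g(2)[of j]], of real_of_int] by simp
      then show ?thesis by (simp add: vec_eq_iff)
    qed
    moreover have "real_of_int m = of_int g * of_int (m div g)"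
      using arg_cong[OF dvd_mult_div_cancel[OF g(1)], of real_of_int] by simp
    ultimately have "real_vec k \<bullet> \<alpha> + of_int m = of_int g * (real_vec (\<chi> j. k $ j div g) \<bullet> \<alpha> + of_int (m div g))"
      by (simp add: distrib_left)
    then have "of_int g * \<bar>real_vec (\<chi> j. k $ j div g) \<bullet> \<alpha> + of_int (m div g)\<bar> \<le> \<delta>"
      using m gn by (simp add: abs_mult)
    then have "\<bar>real_vec (\<chi> j. k $ j div g) \<bullet> \<alpha> + of_int (m div g)\<bar> \<le> \<delta> / of_int g"
      using gn by (simp add: field_simps)
    then have "\<alpha> \<in> slab (\<delta> / of_int g) (\<chi> j. k $ j div g)" unfolding slab_def near_def by blast
    moreover have "g \<in> {g \<in> {2..n}. \<forall>j. g dvd k $ j}" using False gn g(2) by simp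
    ultimately show ?thesis by blast
  qed
qed

lemma prob_grid_prim_slab_ge:
  fixes k :: "int ^ 'n"
  assumes S: "grid_set p S" and k: "0 < k $ i" "k $ i \<le> n" and d: "0 \<le> \<delta>" "\<delta> \<le> 1/2"
  defines "c \<equiv> 2 * real CARD('n) * 2 ^ p"
  shows "2 * \<delta> * (tor.prob S - c / of_int (k $ i)
      - (\<Sum>g\<in>{g \<in> {2..n}. g dvd k $ i}. tor.prob S * (1 / of_int g) + c / of_int (k $ i)))
    \<le> tor.prob (S \<inter> prim_slab \<delta> k)"
proof -
  let ?G = "{g \<in> {2..n}. g dvd k $ i}" and ?G' = "{g \<in> {2..n}. \<forall>j. g dvd k $ j}"
  let ?s = "\<lambda>g. slab (\<delta> / of_int g) (\<chi> j. k $ j div g) :: (real ^ 'n) set"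
  have [measurable]: "S \<in> sets borel" by (rule grid_set_sets[OF S])
  have fin: "finite ?G" "finite ?G'" by (auto intro: finite_subset[of _ "{2..n}"])
  have c0: "c \<ge> 0" by (simp add: c_def)
  have one: "tor.prob (S \<inter> ?s g) \<le> 2 * \<delta> * (tor.prob S * (1 / of_int g) + c / of_int (k $ i))" if "g \<in> ?G'" for g
  proof -
    have g: "2 \<le> g" "g dvd k $ i" using that by auto
    then obtain t where t: "k $ i = g * t" by blast
    have "t > 0" using k(1) g t by (simp add: zero_less_mult_iff)
    have "\<delta> / of_int g \<le> \<delta> / 1" using g d by (intro divide_left_mono) auto
    then have "tor.prob (S \<inter> ?s g) \<le> 2 * (\<delta> / of_int g) * (tor.prob S + 2 * real CARD('n) * (2 ^ p / real_of_int \<bar>(\<chi> j. k $ j div g) $ i\<bar>))"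
      using S d g t \<open>t > 0\<close> by (intro prob_grid_slab_le) auto
    also have "\<dots> = 2 * \<delta> * (tor.prob S * (1 / of_int g) + c / of_int (k $ i))"
      using g t \<open>t > 0\<close> by (simp add: c_def field_simps)
    finally show ?thesis .
  qed
  have "S \<inter> slab \<delta> k \<subseteq> (S \<inter> prim_slab \<delta> k) \<union> (\<Union>g\<in>?G'. S \<inter> ?s g)"
    using slab_subset_prim_slabs[OF k, of \<delta>] by blast
  then have "tor.prob (S \<inter> slab \<delta> k) \<le> tor.prob ((S \<inter> prim_slab \<delta> k) \<union> (\<Union>g\<in>?G'. S \<inter> ?s g))"
    using fin by (intro tor.finite_measure_mono) (auto intro!: sets.finite_UN)
  also have "\<dots> \<le> tor.prob (S \<inter> prim_slab \<delta> k) + tor.prob (\<Union>g\<in>?G'. S \<inter> ?s g)"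
    using fin by (intro measure_Un_le) (auto intro!: sets.finite_UN)
  also have "tor.prob (\<Union>g\<in>?G'. S \<inter> ?s g) \<le> (\<Sum>g\<in>?G'. tor.prob (S \<inter> ?s g))"
    using fin by (intro tor.finite_measure_subadditive_finite) auto
  also have "\<dots> \<le> (\<Sum>g\<in>?G'. 2 * \<delta> * (tor.prob S * (1 / of_int g) + c / of_int (k $ i)))"
    by (intro sum_mono one)
  also have "\<dots> \<le> (\<Sum>g\<in>?G. 2 * \<delta> * (tor.prob S * (1 / of_int g) + c / of_int (k $ i)))"
    using fin d c0 k by (intro sum_mono2) (auto intro!: mult_nonneg_nonneg add_nonneg_nonneg)
  also have "\<dots> = 2 * \<delta> * (\<Sum>g\<in>?G. tor.prob S * (1 / of_int g) + c / of_int (k $ i))"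
    by (rule sum_distrib_left[symmetric])
  finally have "tor.prob (S \<inter> slab \<delta> k) \<le> tor.prob (S \<inter> prim_slab \<delta> k)
     + 2 * \<delta> * (\<Sum>g\<in>?G. tor.prob S * (1 / of_int g) + c / of_int (k $ i))" by simp
  moreover have "2 * \<delta> * (tor.prob S - c / of_int (k $ i)) \<le> tor.prob (S \<inter> slab \<delta> k)"
    using prob_grid_slab_ge[OF S, of k i \<delta>] k d by (simp add: c_def)
  ultimately show ?thesis unfolding right_diff_distrib[of "2 * \<delta>" _ "sum _ _"] by linarith
qed

text \<open>
The expected number of hits in \<open>S\<close>.  The slabs of \<open>k\<close> with a common divisor \<open>g \<ge> 2\<close> of \<open>k\<close> and \<open>m\<close>
account for the proportion \<open>1 / g\<close> at most, and only every \<open>g\<close>-th value of \<open>k\<^sub>i\<close> is concerned, so they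
make up no more than \<open>\<Sum> 1 / g\<^sup>2 \<le> 3 / 4\<close> of all, up to a boundary term.
\<close>

lemma sum_prob_grid_prim_slab_ge:
  fixes i :: "'n :: finite"
  assumes S: "grid_set p (S :: (real ^ 'n) set)" and q: "1 \<le> q" and \<theta>: "0 \<le> \<theta>" "\<theta> \<le> 1/2"
  shows "\<theta> * (tor.prob S / 4 - 4 * real CARD('n) * 2 ^ p * (2 * real q + 3) / 2 ^ q)
    \<le> (\<Sum>k\<in>quadrant_shell i q. tor.prob (S \<inter> prim_slab (\<theta> / (2 ^ q) ^ CARD('n)) k))"
proof -
  define h where "h = (2 ^ (q - 1) :: int)"
  define c where "c = 2 * real CARD('n) * 2 ^ p"
  define \<delta> where "\<delta> = \<theta> / (2 ^ q) ^ CARD('n)"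
  define P where "P = tor.prob S"
  define G where "G \<kappa> = {g \<in> {2..2 ^ q}. g dvd \<kappa>}" for \<kappa> :: int
  have h: "2 ^ q = 2 * h" "1 \<le> h" using q by (auto simp: h_def simp flip: power_Suc)
  have hr: "2 ^ q = 2 * real_of_int h" using arg_cong[OF h(1), of real_of_int] by simp
  have P: "0 \<le> P" "P \<le> 1" by (simp_all add: P_def)
  have card1: "1 \<le> real CARD('n)" by (simp add: Suc_le_eq)
  have "1 * 1 \<le> 2 * real CARD('n) * (2 :: real) ^ p"
    using card1 by (intro mult_mono) (linarith | simp)+
  then have c: "1 \<le> c" by (simp add: c_def)
  have "\<theta> / (2 ^ q) ^ CARD('n) \<le> (1 / 2) / 1" using \<theta> by (intro frac_le) auto
  then have d: "0 \<le> \<delta>" "\<delta> \<le> 1 / 2" using \<theta> by (auto simp: \<delta>_def)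
  define F where "F \<kappa> = 2 * \<delta> * (P - c / of_int \<kappa> - (\<Sum>g\<in>G \<kappa>. P * (1 / of_int g) + c / of_int \<kappa>))" for \<kappa>
  have "(\<Sum>k\<in>quadrant_shell i q. F (k $ i)) \<le> (\<Sum>k\<in>quadrant_shell i q. tor.prob (S \<inter> prim_slab \<delta> k))"
  proof (intro sum_mono)
    fix k assume k: "k \<in> quadrant_shell i q"
    then have "k $ i \<le> 2 ^ q" by (simp add: quadrant_shell_def)
    from prob_grid_prim_slab_ge[OF S quadrant_shell_pos[OF k] this d]
    show "F (k $ i) \<le> tor.prob (S \<inter> prim_slab \<delta> k)" unfolding F_def P_def G_def c_def .
  qed
  moreover have "2 * \<delta> * (of_int h * P / 4 - c * (2 * real q + 3)) \<le> (\<Sum>\<kappa>=h + 1..2 ^ q. F \<kappa>)"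
  proof -
    let ?T = "{h + 1..2 ^ q}"
    have T: "real (card ?T) = of_int h" using h by simp
    have inv: "c / of_int \<kappa> \<le> c / of_int h" if "\<kappa> \<in> ?T" for \<kappa>
      using that h c by (intro divide_left_mono) auto
    have "(\<Sum>\<kappa>\<in>?T. P - c / of_int \<kappa> - (\<Sum>g\<in>G \<kappa>. P * (1 / of_int g) + c / of_int \<kappa>))
       \<ge> (\<Sum>\<kappa>\<in>?T. P - c / of_int h - (P * (\<Sum>g\<in>G \<kappa>. 1 / of_int g) + c / of_int h * real (card (G \<kappa>))))"
    proof (intro sum_mono diff_mono)
      fix \<kappa> assume k: "\<kappa> \<in> ?T"
      have "(\<Sum>g\<in>G \<kappa>. P * (1 / of_int g) + c / of_int \<kappa>) \<le> (\<Sum>g\<in>G \<kappa>. P * (1 / of_int g) + c / of_int h)"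
        using inv[OF k] by (intro sum_mono) auto
      then show "(\<Sum>g\<in>G \<kappa>. P * (1 / of_int g) + c / of_int \<kappa>) \<le> P * (\<Sum>g\<in>G \<kappa>. 1 / of_int g) + c / of_int h * real (card (G \<kappa>))"
        by (simp only: sum.distrib sum_distrib_left sum_constant mult.commute[of "of_nat _"])
    qed (use inv in auto)
    moreover have "(\<Sum>\<kappa>\<in>?T. P - c / of_int h - (P * (\<Sum>g\<in>G \<kappa>. 1 / of_int g) + c / of_int h * real (card (G \<kappa>))))
      = of_int h * (P - c / of_int h) - (P * (\<Sum>\<kappa>\<in>?T. \<Sum>g\<in>G \<kappa>. 1 / of_int g) + c / of_int h * (\<Sum>\<kappa>\<in>?T. real (card (G \<kappa>))))"
      by (simp only: sum_subtractf sum.distrib sum_distrib_left[symmetric] sum_constant T right_diff_distrib)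
    moreover have "P * (\<Sum>\<kappa>\<in>?T. \<Sum>g\<in>G \<kappa>. 1 / of_int g) \<le> P * (3 / 4 * of_int h + real q)"
      using sum_inverse_divisors_le[OF q] P unfolding G_def h_def by (intro mult_left_mono) auto
    moreover have "P * real q \<le> c * real q" using P c by (intro mult_right_mono) auto
    moreover have "c / of_int h * (\<Sum>\<kappa>\<in>?T. real (card (G \<kappa>))) \<le> c / of_int h * (of_int h * (real q + 2))"
      using sum_card_divisors_le[OF q] c h unfolding G_def h_def by (intro mult_left_mono) auto
    moreover have "c / of_int h * (of_int h * (real q + 2)) = c * (real q + 2)" "of_int h * (P - c / of_int h) = of_int h * P - c"
      using h by (simp_all add: right_diff_distrib)
    ultimately have "of_int h * P / 4 - c * (2 * real q + 3)
      \<le> (\<Sum>\<kappa>\<in>?T. P - c / of_int \<kappa> - (\<Sum>g\<in>G \<kappa>. P * (1 / of_int g) + c / of_int \<kappa>))"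
      by (simp add: algebra_simps)
    then show ?thesis
      unfolding F_def sum_distrib_left[symmetric] using d by (intro mult_left_mono) auto
  qed
  then have "(2 ^ q) ^ (CARD('n) - 1) * (2 * \<delta> * (of_int h * P / 4 - c * (2 * real q + 3)))
    \<le> (\<Sum>k\<in>quadrant_shell i q. F (k $ i))"
    unfolding sum_quadrant_shell[OF q] h_def by (intro mult_left_mono) auto
  moreover have "(2 ^ q) ^ (CARD('n) - 1) * (2 * \<delta> * (of_int h * P / 4 - c * (2 * real q + 3)))
    = \<theta> * (P / 4 - 2 * c * (2 * real q + 3) / 2 ^ q)"
  proof -
    have "(2 ^ q) ^ CARD('n) = 2 ^ q * (2 ^ q :: real) ^ (CARD('n) - 1)"
      using power_Suc[of "2 ^ q :: real" "CARD('n) - 1"] by simp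
    then have \<delta>: "(2 ^ q) ^ (CARD('n) - 1) * \<delta> = \<theta> / 2 ^ q"
      by (simp add: \<delta>_def)
    have "(2 ^ q) ^ (CARD('n) - 1) * (2 * \<delta> * y) = (2 ^ q) ^ (CARD('n) - 1) * \<delta> * (2 * y)" for y
      by (simp only: mult_ac)
    then have "(2 ^ q) ^ (CARD('n) - 1) * (2 * \<delta> * (of_int h * P / 4 - c * (2 * real q + 3)))
      = \<theta> / 2 ^ q * (2 * (of_int h * P / 4 - c * (2 * real q + 3)))" by (simp only: \<delta>)
    then show ?thesis unfolding hr using h by (simp add: field_simps)
  qed
  ultimately show ?thesis by (simp add: P_def c_def \<delta>_def mult_ac)
qed

section \<open>The probability of at least one hit\<close>

text \<open>
The double sum counts every pair twice, so this is slightly weaker than the Bonferroni inequality.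
\<close>

lemma prob_Union_bonferroni:
  assumes "finite I" and [measurable]: "T \<in> sets borel" "\<And>x. E x \<in> sets borel"
  shows "(\<Sum>x\<in>I. tor.prob (T \<inter> E x)) - (\<Sum>x\<in>I. \<Sum>y\<in>I - {x}. tor.prob (T \<inter> (E x \<inter> E y)))
    \<le> tor.prob (T \<inter> (\<Union>x\<in>I. E x) :: (real ^ 'n) set)"
  using assms(1)
proof (induction I rule: finite_induct)
  case (insert z I)
  let ?e = "\<lambda>x y. tor.prob (T \<inter> (E x \<inter> E y))"
  let ?U = "T \<inter> (\<Union>x\<in>I. E x)"
  have U [measurable]: "?U \<in> sets borel" using insert.hyps by (intro sets.Int sets.finite_UN) auto
  have sum_ins: "(\<Sum>x\<in>insert z I. \<Sum>y\<in>insert z I - {x}. ?e x y)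
      = (\<Sum>y\<in>I. ?e z y) + ((\<Sum>x\<in>I. ?e x z) + (\<Sum>x\<in>I. \<Sum>y\<in>I - {x}. ?e x y))"
  proof -
    have "(\<Sum>y\<in>insert z I - {x}. ?e x y) = ?e x z + (\<Sum>y\<in>I - {x}. ?e x y)" if "x \<in> I" for x
    proof -
      have "insert z I - {x} = insert z (I - {x})" using that insert.hyps by auto
      then show ?thesis using insert.hyps by simp
    qed
    then have "(\<Sum>x\<in>I. \<Sum>y\<in>insert z I - {x}. ?e x y) = (\<Sum>x\<in>I. ?e x z) + (\<Sum>x\<in>I. \<Sum>y\<in>I - {x}. ?e x y)"
      by (simp add: sum.distrib)
    moreover have "insert z I - {z} = I" using insert.hyps by auto
    ultimately show ?thesis using insert.hyps by simp
  qed
  have "tor.prob ((T \<inter> E z) \<inter> ?U) \<le> (\<Sum>y\<in>I. ?e z y)"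
  proof -
    have "(T \<inter> E z) \<inter> ?U = (\<Union>y\<in>I. T \<inter> (E z \<inter> E y))" by auto
    then show ?thesis
      using insert.hyps by (simp only:) (intro tor.finite_measure_subadditive_finite, auto)
  qed
  moreover have "tor.prob (T \<inter> E z) + tor.prob ?U = tor.prob ((T \<inter> E z) \<union> ?U) + tor.prob ((T \<inter> E z) \<inter> ?U)"
    using tor.finite_measure_Union'[of "T \<inter> E z" ?U] tor.finite_measure_Diff'[of ?U "T \<inter> E z"] U
    by (auto simp: Int_commute)
  moreover have "T \<inter> (\<Union>x\<in>insert z I. E x) = (T \<inter> E z) \<union> ?U" by auto
  moreover have "0 \<le> (\<Sum>x\<in>I. ?e x z)" by (intro sum_nonneg) auto
  ultimately show ?case using insert.IH insert.hyps unfolding sum_ins by simp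
qed simp

text \<open>
If \<open>Z\<close> is the number of the events \<open>E x\<close> that occur, then \<open>Z \<le> b + Z\<^sup>2 / b\<close>.  So a set of very
small measure contributes little to the expectation of \<open>Z\<close>.
\<close>

lemma sum_prob_inter_le:
  assumes "finite I" and [measurable]: "N \<in> sets borel" "\<And>x. E x \<in> sets borel" and b: "0 < b"
  shows "(\<Sum>x\<in>I. tor.prob (N \<inter> E x))
    \<le> b * tor.prob (N :: (real ^ 'n) set) + (\<Sum>x\<in>I. \<Sum>y\<in>I. tor.prob (E x \<inter> E y)) / b"
proof -
  define Z where "Z \<alpha> = (\<Sum>x\<in>I. indicator (E x) \<alpha> :: real)" for \<alpha> :: "real ^ 'n"
  have int: "integrable tor (indicator A :: real ^ 'n \<Rightarrow> real)" if "A \<in> sets borel" for A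
    using that by (simp add: tor.emeasure_eq_measure)
  have "(\<Sum>x\<in>I. tor.prob (N \<inter> E x)) = (\<integral>\<alpha>. (\<Sum>x\<in>I. indicator (N \<inter> E x) \<alpha>) \<partial>tor)"
    by (subst Bochner_Integration.integral_sum) (auto intro!: int)
  also have "\<dots> \<le> (\<integral>\<alpha>. b * indicator N \<alpha> + (\<Sum>x\<in>I. \<Sum>y\<in>I. indicator (E x \<inter> E y) \<alpha>) / b \<partial>tor)"
  proof (rule integral_mono)
    fix \<alpha> :: "real ^ 'n"
    have N: "(\<Sum>x\<in>I. indicator (N \<inter> E x) \<alpha>) = indicator N \<alpha> * Z \<alpha>"
      by (simp add: Z_def sum_distrib_left indicator_inter_arith)
    have E: "(\<Sum>x\<in>I. \<Sum>y\<in>I. indicator (E x \<inter> E y) \<alpha>) = Z \<alpha> * Z \<alpha>"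
      by (simp only: Z_def sum_product indicator_inter_arith)
    have Z0: "0 \<le> Z \<alpha>" unfolding Z_def by (intro sum_nonneg) auto
    have "Z \<alpha> \<le> b + Z \<alpha> * Z \<alpha> / b"
    proof (cases "Z \<alpha> \<le> b")
      case True
      have "0 \<le> Z \<alpha> * Z \<alpha> / b" using b by simp
      then show ?thesis using True by linarith
    next
      case False
      then have "Z \<alpha> * b \<le> Z \<alpha> * Z \<alpha>" using Z0 by (intro mult_left_mono) auto
      then show ?thesis using b by (simp add: field_simps) (smt (verit) zero_le_square)
    qed
    moreover have "0 \<le> Z \<alpha> * Z \<alpha> / b" using b by simp
    ultimately show "(\<Sum>x\<in>I. indicator (N \<inter> E x) \<alpha>)
      \<le> b * indicator N \<alpha> + (\<Sum>x\<in>I. \<Sum>y\<in>I. indicator (E x \<inter> E y) \<alpha>) / b"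
      unfolding N E by (auto simp: indicator_def)
  qed (auto intro!: int Bochner_Integration.integrable_add Bochner_Integration.integrable_sum
        integrable_mult_right integrable_divide)
  also have "\<dots> = b * tor.prob N + (\<Sum>x\<in>I. \<Sum>y\<in>I. tor.prob (E x \<inter> E y)) / b"
    by (subst Bochner_Integration.integral_add)
       (auto intro!: int Bochner_Integration.integrable_sum integrable_mult_right integrable_divide
         simp: Bochner_Integration.integral_sum int)
  finally show ?thesis .
qed

text \<open>
Chains of length two that start from \<open>S\<close>; the enlargements of \<open>S\<close> only add neighbourhoods of the
grid boundary.
\<close>

lemma sum_prob_far_pairs_le:
  fixes S :: "(real ^ 'n) set"
  assumes l: "1 \<le> l" "9 * l \<le> 2 ^ (l - 1)" and \<theta>: "1 / 4 ^ l \<le> \<theta>" "\<theta> \<le> 1" and S: "grid_set p S"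
    and q: "2 ^ (l - 1) < q" "q \<le> 2 ^ l" "2 ^ (l - 1) < q'" "q' \<le> 2 ^ l" "q' + 10 * l \<le> q"
    and pl: "p + 20 * l \<le> 2 ^ l"
  defines "G \<equiv> - (\<Union>q\<in>{9 * l..2 ^ l}. - regular (2 ^ (8 * l)) (2 ^ (8 * l)) q)"
  shows "(\<Sum>k\<in>shell q. \<Sum>k'\<in>shell q'. tor.prob (S \<inter> G \<inter>
      (prim_slab (\<theta> / (2 ^ q) ^ CARD('n)) k \<inter> prim_slab (\<theta> / (2 ^ q') ^ CARD('n)) k')))
    \<le> (1024 * 3 ^ CARD('n) * \<theta>)\<^sup>2 * (tor.prob S + 4 * real CARD('n) / (2 ^ l) ^ 10)"
proof -
  let ?V = "2 ^ (8 * l) :: real"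
  let ?E = "\<lambda>q k. prim_slab (\<theta> / (2 ^ q) ^ CARD('n)) (k :: int ^ 'n)"
  define \<rho> where "\<rho> = ?V / 2 ^ 2 ^ l"
  define \<epsilon> where "\<epsilon> = 2 ^ p * \<rho>"
  define F where "F t = S \<union> grid_boundary (real t * \<epsilon>) p" for t
  have \<rho>0: "\<rho> \<ge> 0" by (simp add: \<rho>_def)
  have \<epsilon>0: "\<epsilon> \<ge> 0" using \<rho>0 by (simp add: \<epsilon>_def)
  have [measurable]: "S \<in> sets borel" by (rule grid_set_sets[OF S])
  have G [measurable]: "G \<in> sets borel" unfolding G_def by (intro borel_comp sets.finite_UN) auto
  have F_sets: "F t \<in> sets borel" for t unfolding F_def by measurable
  have bound: "(\<integral>\<^sup>+\<alpha>. indicator (F 0) \<alpha> * chain_weight ?V \<theta> ?V [q, q'] \<alpha> \<partial>tor)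
      \<le> ennreal ((64 * 3 ^ CARD('n) * 4 ^ 2 * \<theta>) ^ 2) * emeasure tor (F 2)"
  proof (rule nn_integral_separated_chain_le[where S = F and \<rho> = \<rho>, OF l(1) _ \<theta>])
    show "sorted_wrt (\<lambda>p q. q + 10 * l \<le> p) [q, q']" "set [q, q'] \<subseteq> {9 * l..2 ^ l}" using q l by auto
    show "\<alpha> + real_vec z \<in> F t \<longleftrightarrow> \<alpha> \<in> F t" for t \<alpha> z
      unfolding F_def by (simp add: grid_boundary_periodic grid_set_periodic[OF S])
    show "\<alpha> \<in> F (Suc t)" if \<beta>: "0 \<le> \<beta>" "\<beta> \<le> \<rho>" and mem: "\<alpha> + \<beta> *\<^sub>R axis i 1 \<in> F t" for t \<alpha> \<beta> i
    proof (cases "\<alpha> \<in> grid_boundary (real (Suc t) * \<epsilon>) p")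
      case False
      have b: "2 ^ p * \<beta> \<le> \<epsilon>" unfolding \<epsilon>_def using \<beta> by (intro mult_left_mono) auto
      have "real t * \<epsilon> + \<epsilon> \<le> real (Suc t) * \<epsilon>" by (simp add: algebra_simps)
      then have "\<alpha> + \<beta> *\<^sub>R axis i 1 \<notin> grid_boundary (real t * \<epsilon>) p"
        using grid_boundary_shift[OF \<beta>(1) b] False by blast
      then have S': "\<alpha> + \<beta> *\<^sub>R axis i 1 \<in> S" using mem by (simp add: F_def)
      have "\<epsilon> * 1 \<le> \<epsilon> * real (Suc t)" using \<epsilon>0 by (intro mult_left_mono) auto
      then have "2 ^ p * \<beta> \<le> real (Suc t) * \<epsilon>" using b by (simp add: mult.commute)
      then have "\<alpha> \<in> S" using grid_set_shift[OF S \<beta>(1) _ False] S' by blast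
      then show ?thesis by (simp add: F_def)
    qed (simp add: F_def)
    show "2 ^ (8 * l) / (4 * 2 ^ x * (2 ^ x) ^ CARD('n)) \<le> \<rho>" if "x \<in> set [q, q']" for x
      unfolding \<rho>_def
    proof (intro divide_left_mono)
      have x: "2 ^ (l - 1) < x" using that q by auto
      have "(2 :: nat) ^ l = 2 * 2 ^ (l - 1)" using l by (simp flip: power_Suc)
      then have "(2 :: real) ^ 2 ^ l \<le> 2 ^ (x + x)"
        using x by (intro power_increasing) auto
      also have "\<dots> = 1 * 2 ^ x * 2 ^ x" by (simp add: power_add)
      also have "\<dots> \<le> 4 * 2 ^ x * (2 ^ x) ^ CARD('n)" by (intro mult_mono self_le_power) auto
      finally show "(2 :: real) ^ 2 ^ l \<le> 4 * 2 ^ x * (2 ^ x) ^ CARD('n)" .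
    qed auto
  qed (use F_sets l in auto)
  have "ennreal (\<Sum>k\<in>shell q. \<Sum>k'\<in>shell q'. tor.prob (S \<inter> G \<inter> (?E q k \<inter> ?E q' k')))
      = (\<Sum>k\<in>shell q. \<Sum>k'\<in>shell q'. emeasure tor (S \<inter> G \<inter> (?E q k \<inter> ?E q' k')))"
    by (simp add: tor.emeasure_eq_measure sum_nonneg flip: sum_ennreal)
  also have "\<dots> = (\<integral>\<^sup>+\<alpha>. (\<Sum>k\<in>shell q. \<Sum>k'\<in>shell q'. indicator (S \<inter> G \<inter> (?E q k \<inter> ?E q' k')) \<alpha>) \<partial>tor)"
    by (simp add: nn_integral_sum)
  also have "\<dots> \<le> (\<integral>\<^sup>+\<alpha>. indicator (F 0) \<alpha> * chain_weight ?V \<theta> ?V [q, q'] \<alpha> \<partial>tor)"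
  proof (rule nn_integral_mono)
    fix \<alpha> :: "real ^ 'n"
    show "(\<Sum>k\<in>shell q. \<Sum>k'\<in>shell q'. indicator (S \<inter> G \<inter> (?E q k \<inter> ?E q' k')) \<alpha>)
      \<le> indicator (F 0) \<alpha> * chain_weight ?V \<theta> ?V [q, q'] \<alpha>"
    proof (cases "\<alpha> \<in> S \<inter> G")
      case True
      then have reg: "\<alpha> \<in> F 0" "\<alpha> \<in> regular ?V ?V q" "\<alpha> \<in> regular ?V ?V q'"
        using q l by (auto simp: F_def G_def)
      have "(\<Sum>k\<in>shell q. \<Sum>k'\<in>shell q'. indicator (S \<inter> G \<inter> (?E q k \<inter> ?E q' k')) \<alpha> :: ennreal)
        \<le> (\<Sum>k\<in>shell q. \<Sum>k'\<in>shell q'. indicator (slab (\<theta> / (2 ^ q) ^ CARD('n)) k) \<alpha>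
              * indicator (slab (\<theta> / (2 ^ q') ^ CARD('n)) k') \<alpha>)"
        using prim_slab_subset by (intro sum_mono) (auto simp: indicator_def)
      also have "\<dots> = of_nat (shell_hits q \<theta> \<alpha>) * of_nat (shell_hits q' \<theta> \<alpha>)"
        by (simp only: shell_hits_eq_sum sum_product)
      finally show ?thesis using reg by (simp add: chain_weight_def)
    next
      case False
      then have "indicator (S \<inter> G \<inter> X) \<alpha> = (0 :: ennreal)" for X by (auto simp: indicator_def)
      then show ?thesis by (simp only: sum.neutral_const) simp
    qed
  qed
  also have "\<dots> \<le> ennreal ((1024 * 3 ^ CARD('n) * \<theta>)\<^sup>2) * ennreal (tor.prob (F 2))"
    using bound by (simp add: tor.emeasure_eq_measure mult_ac)
  also have "\<dots> \<le> ennreal ((1024 * 3 ^ CARD('n) * \<theta>)\<^sup>2 * (tor.prob S + 4 * real CARD('n) / (2 ^ l) ^ 10))"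
  proof -
    have "\<epsilon> = 2 ^ (p + 8 * l) / 2 ^ 2 ^ l" by (simp add: \<epsilon>_def \<rho>_def power_add)
    also have "\<dots> \<le> 1 / (2 ^ l) ^ 10"
    proof -
      have "(2 :: real) ^ (p + 8 * l) * 2 ^ (l * 10) \<le> 2 ^ 2 ^ l"
        unfolding power_add[symmetric] using pl by (intro power_increasing) auto
      then show ?thesis by (simp add: field_simps flip: power_mult)
    qed
    finally have "4 * real CARD('n) * \<epsilon> \<le> 4 * real CARD('n) * (1 / (2 ^ l) ^ 10)"
      by (intro mult_left_mono) auto
    moreover have "tor.prob (F 2) \<le> tor.prob S + 2 * real CARD('n) * (real 2 * \<epsilon>)"
      unfolding F_def using \<epsilon>0
      by (intro order_trans[OF measure_Un_le] add_left_mono prob_grid_boundary_le) auto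
    ultimately have "tor.prob (F 2) \<le> tor.prob S + 4 * real CARD('n) / (2 ^ l) ^ 10" by simp
    then show ?thesis
      by (subst ennreal_mult[symmetric]) (auto intro!: ennreal_leI mult_left_mono)
  qed
  finally show ?thesis
    by (subst (asm) ennreal_le_iff) (auto intro!: mult_nonneg_nonneg add_nonneg_nonneg)
qed

text \<open>
The points with a primitive hit in one of the upper half of the shells up to \<open>2 ^ l\<close>.
\<close>

definition sub_hits :: "'n :: finite \<Rightarrow> nat \<Rightarrow> real \<Rightarrow> (real ^ 'n) set" where
  "sub_hits i l \<theta> = (\<Union>q\<in>{2 ^ (l - 1)<..2 ^ l}. \<Union>k\<in>quadrant_shell i q. prim_slab (\<theta> / (2 ^ q) ^ CARD('n)) k)"

lemma sub_hits_sets [measurable]: "sub_hits i l \<theta> \<in> sets borel"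
  unfolding sub_hits_def by (intro sets.finite_UN) auto

text \<open>
Inclusion and exclusion on the regular part of \<open>S\<close>.  By the smallness of \<open>2 ^ l * \<theta>\<close>, the pairs of hits
in distant shells remove at most half of the expected number of hits; the pairs in nearby shells and
the irregular points contribute to the error term only.
\<close>

lemma prob_sub_hits_ge:
  fixes i :: "'n :: finite"
  assumes S: "grid_set p (S :: (real ^ 'n) set)"
    and l: "1 \<le> l" "32 * l \<le> 2 ^ l" and p: "4 * p \<le> 2 ^ l"
    and \<theta>: "1 / 4 ^ l \<le> \<theta>" and small: "4 * (1024 * 3 ^ CARD('n))\<^sup>2 * (2 ^ l * \<theta>) \<le> 1"
  shows "2 ^ l * \<theta> * tor.prob S / 16 - (11 * real CARD('n) + 91 * 9 ^ CARD('n)) * (real l / 2 ^ l)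
    \<le> tor.prob (S \<inter> sub_hits i l \<theta>)"
proof -
  define d where "d = real CARD('n)"
  define L where "L = (2 :: real) ^ l"
  define J where "J = {2 ^ (l - 1)<..2 ^ l :: nat}"
  define G :: "(real ^ 'n) set" where "G = - (\<Union>q\<in>{9 * l..2 ^ l}. - regular (2 ^ (8 * l)) (2 ^ (8 * l)) q)"
  define E where "E = (\<lambda>(q, k). prim_slab (\<theta> / (2 ^ q) ^ CARD('n)) (k :: int ^ 'n))"
  define I where "I = Sigma J (quadrant_shell i)"
  define P where "P = tor.prob S"
  define B :: real where "B = (1024 * 3 ^ CARD('n))\<^sup>2"
  let ?A = "8 * 9 ^ CARD('n) * \<theta>\<^sup>2"
  let ?F = "B * \<theta>\<^sup>2 * (P + 4 * d / L ^ 10)"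
  let ?pairs = "\<lambda>T q q'. \<Sum>k\<in>quadrant_shell i q. \<Sum>k'\<in>quadrant_shell i q' - {k, - k}. tor.prob (T \<inter> (E (q, k) \<inter> E (q', k')))"
  have L: "1 \<le> L" by (simp add: L_def)
  have \<theta>0: "0 < \<theta>" using \<theta> by (rule less_le_trans[rotated]) simp
  have B: "1 \<le> B" unfolding B_def by (intro one_le_power) (auto intro: order_trans[of _ 1024])
  have L\<theta>: "0 < L * \<theta>" "4 * (B * (L * \<theta>)) \<le> 1" using small \<theta>0 L by (auto simp: B_def L_def)
  moreover have "1 * (L * \<theta>) \<le> B * (L * \<theta>)" using B L\<theta>(1) by (intro mult_right_mono) auto
  ultimately have L\<theta>4: "L * \<theta> \<le> 1 / 4" by linarith
  have "1 * \<theta> \<le> L * \<theta>" using L \<theta>0 by (intro mult_right_mono) auto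
  then have \<theta>1: "\<theta> \<le> 1 / 4" using L\<theta>4 by linarith
  have P: "0 \<le> P" "P \<le> 1" by (simp_all add: P_def)
  have l2: "(2 :: nat) ^ l = 2 * 2 ^ (l - 1)" using l by (simp flip: power_Suc)
  have cardJ: "real (card J) = L / 2" using arg_cong[OF l2, of real] by (simp add: J_def L_def)
  have finJ: "finite J" by (simp add: J_def)
  have finI: "finite I" unfolding I_def using finJ by (intro finite_SigmaI) auto
  have S_sets [measurable]: "S \<in> sets borel" by (rule grid_set_sets[OF S])
  have G_sets [measurable]: "G \<in> sets borel" unfolding G_def by (intro borel_comp sets.finite_UN) auto
  have E_sets [measurable]: "E x \<in> sets borel" for x by (auto simp: E_def split: prod.splits)
  have Gc: "tor.prob (- G) \<le> 8 * 3 ^ CARD('n) / L ^ 5"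
    unfolding G_def double_compl L_def by (rule prob_irregular_le[OF l(1)])
  have three: "(3 :: real) ^ CARD('n) \<le> 9 ^ CARD('n)" "(1 :: real) \<le> 9 ^ CARD('n)" by (auto intro: power_mono)
  have inv_sq: "1 / L\<^sup>2 \<le> real l / L"
  proof -
    have "1 / L\<^sup>2 \<le> 1 / L" using L by (intro divide_left_mono) (auto simp: power2_eq_square)
    also have "\<dots> \<le> real l / L" using L l by (intro divide_right_mono) auto
    finally show ?thesis .
  qed
  \<comment> \<open>The mesh is so much coarser than the slabs that the boundary term is negligible.\<close>
  have first: "L * \<theta> * P / 8 - 10 * d / L\<^sup>2 \<le> (\<Sum>x\<in>I. tor.prob (S \<inter> E x))"
  proof -
    have "\<theta> * (P / 4 - 20 * d / L\<^sup>2) \<le> (\<Sum>k\<in>quadrant_shell i q. tor.prob (S \<inter> E (q, k)))" if q: "q \<in> J" for q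
    proof -
      have q': "2 ^ (l - 1) < q" "q \<le> 2 ^ l" using q by (auto simp: J_def)
      then have "1 \<le> q" by linarith
      have "4 * d * 2 ^ p * (2 * real q + 3) / 2 ^ q \<le> 20 * d / L\<^sup>2"
      proof -
        have "p + 3 * l \<le> q" using p l q' l2 by linarith
        then have e: "(2 :: real) ^ p * 2 ^ (3 * l) \<le> 2 ^ q"
          unfolding power_add[symmetric] by (intro power_increasing) auto
        have "real q \<le> L" using q' unfolding L_def by (simp add: le_nat_iff of_nat_le_iff[symmetric] del: of_nat_le_iff)
        then have "2 * real q + 3 \<le> 5 * L" using L by linarith
        then have "4 * d * 2 ^ p * (2 * real q + 3) / 2 ^ q \<le> 4 * d * 2 ^ p * (5 * L) / 2 ^ q"
          by (intro divide_right_mono mult_left_mono) (auto simp: d_def)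
        also have "\<dots> = 20 * d * L * (2 ^ p / 2 ^ q)" by simp
        also have "\<dots> \<le> 20 * d * L * (1 / L ^ 3)"
        proof (intro mult_left_mono)
          show "(2 :: real) ^ p / 2 ^ q \<le> 1 / L ^ 3"
            using e unfolding L_def by (simp add: field_simps flip: power_mult)
        qed (use L in \<open>auto simp: d_def\<close>)
        also have "\<dots> = 20 * d / L\<^sup>2" using L by (simp add: power2_eq_square power3_eq_cube)
        finally show ?thesis .
      qed
      then have "\<theta> * (P / 4 - 20 * d / L\<^sup>2) \<le> \<theta> * (P / 4 - 4 * d * 2 ^ p * (2 * real q + 3) / 2 ^ q)"
        using \<theta>0 by (intro mult_left_mono) auto
      also have "\<dots> \<le> (\<Sum>k\<in>quadrant_shell i q. tor.prob (S \<inter> E (q, k)))"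
        using sum_prob_grid_prim_slab_ge[OF S \<open>1 \<le> q\<close>, of \<theta> i] \<theta>0 \<theta>1 by (simp add: P_def d_def E_def)
      finally show ?thesis .
    qed
    then have "(\<Sum>q\<in>J. \<theta> * (P / 4 - 20 * d / L\<^sup>2)) \<le> (\<Sum>q\<in>J. \<Sum>k\<in>quadrant_shell i q. tor.prob (S \<inter> E (q, k)))"
      by (rule sum_mono)
    also have "\<dots> = (\<Sum>x\<in>I. tor.prob (S \<inter> E x))"
      unfolding I_def using finJ by (subst sum.Sigma) auto
    finally have "L / 2 * (\<theta> * (P / 4 - 20 * d / L\<^sup>2)) \<le> (\<Sum>x\<in>I. tor.prob (S \<inter> E x))"
      by (simp add: cardJ)
    moreover have "L / 2 * (\<theta> * (P / 4 - 20 * d / L\<^sup>2)) = L * \<theta> * P / 8 - (L * \<theta>) * (10 * d / L\<^sup>2)"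
      by (simp add: algebra_simps)
    moreover have "(L * \<theta>) * (10 * d / L\<^sup>2) \<le> 1 * (10 * d / L\<^sup>2)"
      using L\<theta>4 by (intro mult_right_mono) (auto simp: d_def)
    ultimately show ?thesis by linarith
  qed
  have pair_le: "?pairs T q q' \<le> ?A" if [measurable]: "T \<in> sets borel" for T q q'
  proof -
    have "?pairs T q q' \<le> (\<Sum>k\<in>quadrant_shell i q. \<Sum>k'\<in>quadrant_shell i q' - {k, - k}. tor.prob (E (q, k) \<inter> E (q', k')))"
      by (intro sum_mono tor.finite_measure_mono) auto
    also have "\<dots> \<le> ?A"
      unfolding E_def prod.case using \<theta>0 \<theta>1 by (intro sum_prob_prim_slab_pairs_le quadrant_shell_subset) auto
    finally show ?thesis .
  qed
  have far: "?pairs (S \<inter> G) q q' \<le> ?F" if q: "q \<in> J" "q' \<in> J" "q' + 10 * l \<le> q \<or> q + 10 * l \<le> q'" for q q'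
  proof -
    have main: "(\<Sum>k\<in>shell q. \<Sum>k'\<in>shell q'. tor.prob (S \<inter> G \<inter> (E (q, k) \<inter> E (q', k')))) \<le> ?F"
      if q: "q \<in> J" "q' \<in> J" "q' + 10 * l \<le> q" for q q'
    proof -
      have "9 * l \<le> 2 ^ (l - 1)" using l l2 by linarith
      moreover have "p + 20 * l \<le> 2 ^ l" using l p by linarith
      ultimately show ?thesis
        using sum_prob_far_pairs_le[OF l(1) _ \<theta> _ S, of q q'] q \<theta>1
        by (simp add: G_def E_def J_def B_def P_def d_def L_def power_mult_distrib)
    qed
    have "?pairs (S \<inter> G) q q' \<le> (\<Sum>k\<in>shell q. \<Sum>k'\<in>shell q'. tor.prob (S \<inter> G \<inter> (E (q, k) \<inter> E (q', k'))))"
      using quadrant_shell_subset by (intro order_trans[OF sum_mono sum_mono2] sum_mono2 sum_nonneg) fastforce+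
    also have "\<dots> \<le> ?F"
      using q(3)
    proof
      assume "q + 10 * l \<le> q'"
      from main[OF q(2,1) this] show ?thesis
        by (subst sum.swap) (simp add: Int_commute[of "E (q, _)"])
    qed (rule main[OF q(1,2)])
    finally show ?thesis .
  qed
  have pairs_eq: "(\<Sum>x\<in>I. \<Sum>y\<in>I - {x}. tor.prob (T \<inter> (E x \<inter> E y))) = (\<Sum>q\<in>J. \<Sum>q'\<in>J. ?pairs T q q')" for T
  proof -
    have "(\<Sum>y\<in>I - {(q, k)}. tor.prob (T \<inter> (E (q, k) \<inter> E y)))
       = (\<Sum>q'\<in>J. \<Sum>k'\<in>quadrant_shell i q' - {k, - k}. tor.prob (T \<inter> (E (q, k) \<inter> E (q', k'))))"
      if qk: "q \<in> J" "k \<in> quadrant_shell i q" for q k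
    proof -
      have "q' = q" if "k \<in> quadrant_shell i q'" for q'
        using that qk quadrant_shell_subset shell_unique by blast
      moreover have "- k \<notin> quadrant_shell i q'" for q'
        using quadrant_shell_pos[of "- k" i q' i] quadrant_shell_pos[OF qk(2), of i] by auto
      ultimately have "I - {(q, k)} = Sigma J (\<lambda>q'. quadrant_shell i q' - {k, - k})"
        unfolding I_def by auto
      then show ?thesis using finJ by (simp add: sum.Sigma split_def)
    qed
    then have "(\<Sum>q\<in>J. \<Sum>k\<in>quadrant_shell i q. \<Sum>y\<in>I - {(q, k)}. tor.prob (T \<inter> (E (q, k) \<inter> E y)))
      = (\<Sum>q\<in>J. \<Sum>k\<in>quadrant_shell i q. \<Sum>q'\<in>J. \<Sum>k'\<in>quadrant_shell i q' - {k, - k}. tor.prob (T \<inter> (E (q, k) \<inter> E (q', k'))))"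
      by (intro sum.cong refl) auto
    also have "\<dots> = (\<Sum>q\<in>J. \<Sum>q'\<in>J. ?pairs T q q')"
      by (intro sum.cong refl sum.swap)
    finally have *: "(\<Sum>q\<in>J. \<Sum>k\<in>quadrant_shell i q. \<Sum>y\<in>I - {(q, k)}. tor.prob (T \<inter> (E (q, k) \<inter> E y)))
      = (\<Sum>q\<in>J. \<Sum>q'\<in>J. ?pairs T q q')" .
    have "(\<Sum>x\<in>I. g x) = (\<Sum>q\<in>J. \<Sum>k\<in>quadrant_shell i q. g (q, k))" for g :: "nat \<times> (int ^ 'n) \<Rightarrow> real"
      unfolding I_def using finJ by (subst sum.Sigma) auto
    then show ?thesis by (simp only: *)
  qed
  have second: "(\<Sum>x\<in>I. \<Sum>y\<in>I - {x}. tor.prob (S \<inter> G \<inter> (E x \<inter> E y)))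
      \<le> 80 * 9 ^ CARD('n) * (real l / L) + L * \<theta> * P / 16 + d * (real l / L)"
  proof -
    have F0: "0 \<le> ?F" using P B L by (auto simp: d_def)
    \<comment> \<open>For a given \<open>q\<close> at most \<open>20 * l\<close> shells are too close for the estimate of distant pairs.\<close>
    have row: "(\<Sum>q'\<in>J. ?pairs (S \<inter> G) q q') \<le> real (20 * l) * ?A + L / 2 * ?F" if q: "q \<in> J" for q
    proof -
      have "(\<Sum>q'\<in>J. ?pairs (S \<inter> G) q q') \<le> (\<Sum>q'\<in>J. (if q' \<in> {q - 10 * l<..<q + 10 * l} then ?A else 0) + ?F)"
      proof (intro sum_mono)
        fix q' assume q': "q' \<in> J"
        show "?pairs (S \<inter> G) q q' \<le> (if q' \<in> {q - 10 * l<..<q + 10 * l} then ?A else 0) + ?F"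
        proof (cases "q' \<in> {q - 10 * l<..<q + 10 * l}")
          case True
          then show ?thesis using pair_le[of "S \<inter> G" q q'] F0 by simp
        next
          case False
          then have "q' + 10 * l \<le> q \<or> q + 10 * l \<le> q'" using q q' by (auto simp: J_def)
          from far[OF q q' this] show ?thesis by (simp only: if_not_P[OF False] add_0_left)
        qed
      qed
      also have "\<dots> = real (card (J \<inter> {q - 10 * l<..<q + 10 * l})) * ?A + L / 2 * ?F"
        by (simp only: sum.distrib sum.If_cases[OF finJ] Collect_mem_eq) (simp add: cardJ)
      also have "\<dots> \<le> real (20 * l) * ?A + L / 2 * ?F"
      proof (intro add_right_mono mult_right_mono of_nat_mono)
        have "card (J \<inter> {q - 10 * l<..<q + 10 * l}) \<le> card {q - 10 * l<..<q + 10 * l}"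
          by (intro card_mono) auto
        also have "\<dots> \<le> 20 * l" by simp
        finally show "card (J \<inter> {q - 10 * l<..<q + 10 * l}) \<le> 20 * l" .
      qed auto
      finally show ?thesis .
    qed
    have "(\<Sum>q\<in>J. \<Sum>q'\<in>J. ?pairs (S \<inter> G) q q') \<le> (\<Sum>q\<in>J. real (20 * l) * ?A + L / 2 * ?F)"
      by (intro sum_mono row)
    also have "\<dots> = 80 * 9 ^ CARD('n) * (real l / L) * (L * \<theta>)\<^sup>2 + (B * (L * \<theta>)) * (L * \<theta>) / 4 * (P + 4 * d / L ^ 10)"
      using L by (simp add: cardJ power2_eq_square field_simps)
    also have "\<dots> \<le> 80 * 9 ^ CARD('n) * (real l / L) * 1\<^sup>2 + (1 / 4) * (L * \<theta>) / 4 * (P + 4 * d / L ^ 10)"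
    proof (intro add_mono mult_left_mono mult_right_mono divide_right_mono power_mono)
      show "B * (L * \<theta>) \<le> 1 / 4" using L\<theta> by linarith
    qed (use L\<theta> L\<theta>4 L P in \<open>auto simp: d_def\<close>)
    also have "\<dots> = 80 * 9 ^ CARD('n) * (real l / L) + L * \<theta> * P / 16 + (L * \<theta>) * (d / L ^ 10) / 4"
      by (simp add: algebra_simps)
    also have "(L * \<theta>) * (d / L ^ 10) / 4 \<le> d * (real l / L)"
    proof -
      have "(L * \<theta>) * (d / L ^ 10) \<le> 1 * (d / L ^ 10)"
        using L\<theta>4 L by (intro mult_right_mono) (auto simp: d_def)
      also have "\<dots> \<le> 1 * (d / L\<^sup>2)"
        using L by (intro mult_left_mono divide_left_mono power_increasing) (auto simp: d_def)
      also have "\<dots> = d * (1 / L\<^sup>2)" by simp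
      also have "\<dots> \<le> d * (real l / L)" using inv_sq by (intro mult_left_mono) (auto simp: d_def)
      finally have le: "(L * \<theta>) * (d / L ^ 10) \<le> d * (real l / L)" .
      have "0 \<le> (L * \<theta>) * (d / L ^ 10)" using L\<theta> L by (auto simp: d_def)
      moreover have "x / 4 \<le> y" if "0 \<le> x" "x \<le> y" for x y :: real using that by linarith
      ultimately show ?thesis using le by blast
    qed
    finally show ?thesis unfolding pairs_eq by simp
  qed
  \<comment> \<open>The choice \<open>b = L\<^sup>2\<close> balances the measure of order \<open>1 / L ^ 5\<close> against the bounded second moment.\<close>
  have irregular: "(\<Sum>x\<in>I. tor.prob (- G \<inter> E x)) \<le> 11 * 9 ^ CARD('n) * (real l / L)"
  proof -
    have "(\<Sum>x\<in>I. tor.prob (E x)) \<le> (\<Sum>q\<in>J. 2 * 3 ^ CARD('n) * \<theta>)"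
    proof -
      have "(\<Sum>x\<in>I. tor.prob (E x)) = (\<Sum>q\<in>J. \<Sum>k\<in>quadrant_shell i q. tor.prob (E (q, k)))"
        unfolding I_def using finJ by (subst sum.Sigma) auto
      also have "\<dots> \<le> (\<Sum>q\<in>J. \<Sum>k\<in>quadrant_shell i q. tor.prob (slab (\<theta> / (2 ^ q) ^ CARD('n)) k))"
        unfolding E_def prod.case using prim_slab_subset by (intro sum_mono tor.finite_measure_mono) auto
      also have "\<dots> \<le> (\<Sum>q\<in>J. 2 * 3 ^ CARD('n) * \<theta>)"
        using \<theta>0 by (intro sum_mono sum_prob_slab_shell_le quadrant_shell_subset) auto
      finally show ?thesis .
    qed
    then have EZ: "(\<Sum>x\<in>I. tor.prob (E x)) \<le> 9 ^ CARD('n)"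
    proof -
      have "(\<Sum>q\<in>J. 2 * 3 ^ CARD('n) * \<theta>) = 3 ^ CARD('n) * (L * \<theta>)" by (simp add: cardJ)
      also have "\<dots> \<le> 9 ^ CARD('n) * 1" using L\<theta>4 L\<theta> three by (intro mult_mono) auto
      finally show ?thesis using \<open>(\<Sum>x\<in>I. tor.prob (E x)) \<le> (\<Sum>q\<in>J. 2 * 3 ^ CARD('n) * \<theta>)\<close> by linarith
    qed
    have "(\<Sum>x\<in>I. \<Sum>y\<in>I. tor.prob (E x \<inter> E y)) = (\<Sum>x\<in>I. tor.prob (E x)) + (\<Sum>x\<in>I. \<Sum>y\<in>I - {x}. tor.prob (UNIV \<inter> (E x \<inter> E y)))"
      using finI by (simp add: sum.remove sum.distrib)
    also have "(\<Sum>x\<in>I. \<Sum>y\<in>I - {x}. tor.prob (UNIV \<inter> (E x \<inter> E y))) \<le> (\<Sum>q\<in>J. \<Sum>q'\<in>J. ?A)"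
      unfolding pairs_eq by (intro sum_mono pair_le) auto
    also have "\<dots> = 2 * 9 ^ CARD('n) * (L * \<theta>)\<^sup>2" by (simp add: cardJ power2_eq_square)
    also have "\<dots> \<le> 2 * 9 ^ CARD('n) * 1\<^sup>2" using L\<theta> L\<theta>4 by (intro mult_left_mono power_mono) auto
    finally have "(\<Sum>x\<in>I. \<Sum>y\<in>I. tor.prob (E x \<inter> E y)) \<le> 3 * 9 ^ CARD('n)" using EZ by simp
    then have "(\<Sum>x\<in>I. \<Sum>y\<in>I. tor.prob (E x \<inter> E y)) / L\<^sup>2 \<le> 3 * 9 ^ CARD('n) / L\<^sup>2"
      by (rule divide_right_mono) simp
    moreover have "(\<Sum>x\<in>I. tor.prob (- G \<inter> E x)) \<le> L\<^sup>2 * tor.prob (- G) + (\<Sum>x\<in>I. \<Sum>y\<in>I. tor.prob (E x \<inter> E y)) / L\<^sup>2"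
      using L finI by (intro sum_prob_inter_le) auto
    moreover have "L\<^sup>2 * tor.prob (- G) \<le> 8 * 9 ^ CARD('n) / L\<^sup>2"
    proof -
      have "L\<^sup>2 * tor.prob (- G) \<le> L\<^sup>2 * (8 * 9 ^ CARD('n) / L ^ 5)"
        using three L by (intro mult_left_mono order_trans[OF Gc] divide_right_mono) auto
      also have "\<dots> = 8 * 9 ^ CARD('n) / L ^ 3" using L by (simp add: field_simps power_numeral_reduce)
      also have "\<dots> \<le> 8 * 9 ^ CARD('n) / L\<^sup>2" using L by (intro divide_left_mono power_increasing) auto
      finally show ?thesis .
    qed
    ultimately have "(\<Sum>x\<in>I. tor.prob (- G \<inter> E x)) \<le> 11 * 9 ^ CARD('n) * (1 / L\<^sup>2)"
      by (simp add: add_divide_distrib[symmetric])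
    also have "\<dots> \<le> 11 * 9 ^ CARD('n) * (real l / L)" using inv_sq by (intro mult_left_mono) auto
    finally show ?thesis .
  qed
  have "(\<Sum>x\<in>I. tor.prob (S \<inter> E x)) \<le> (\<Sum>x\<in>I. tor.prob (S \<inter> G \<inter> E x) + tor.prob (- G \<inter> E x))"
  proof (intro sum_mono)
    fix x
    have "tor.prob (S \<inter> E x) \<le> tor.prob ((S \<inter> G \<inter> E x) \<union> (- G \<inter> E x))"
      by (intro tor.finite_measure_mono) auto
    also have "\<dots> \<le> tor.prob (S \<inter> G \<inter> E x) + tor.prob (- G \<inter> E x)" by (intro measure_Un_le) auto
    finally show "tor.prob (S \<inter> E x) \<le> tor.prob (S \<inter> G \<inter> E x) + tor.prob (- G \<inter> E x)" .
  qed
  then have split: "(\<Sum>x\<in>I. tor.prob (S \<inter> E x)) \<le> (\<Sum>x\<in>I. tor.prob (S \<inter> G \<inter> E x)) + (\<Sum>x\<in>I. tor.prob (- G \<inter> E x))"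
    by (simp add: sum.distrib)
  have union: "(\<Union>x\<in>I. E x) = sub_hits i l \<theta>"
    by (auto simp: I_def E_def J_def sub_hits_def)
  have "tor.prob (S \<inter> G \<inter> sub_hits i l \<theta>) \<le> tor.prob (S \<inter> sub_hits i l \<theta>)"
    by (intro tor.finite_measure_mono) auto
  moreover have "(\<Sum>x\<in>I. tor.prob (S \<inter> G \<inter> E x)) - (\<Sum>x\<in>I. \<Sum>y\<in>I - {x}. tor.prob (S \<inter> G \<inter> (E x \<inter> E y)))
      \<le> tor.prob (S \<inter> G \<inter> sub_hits i l \<theta>)"
    unfolding union[symmetric] using finI by (intro prob_Union_bonferroni) auto
  moreover have "10 * d / L\<^sup>2 \<le> 10 * d * (real l / L)"
    using mult_left_mono[OF inv_sq, of "10 * d"] by (simp add: d_def)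
  ultimately have "L * \<theta> * P / 16 - (10 * d * (real l / L) + 11 * 9 ^ CARD('n) * (real l / L)
      + 80 * 9 ^ CARD('n) * (real l / L) + d * (real l / L)) \<le> tor.prob (S \<inter> sub_hits i l \<theta>)"
    using first second irregular split by linarith
  moreover have "10 * d * x + 11 * 9 ^ CARD('n) * x + 80 * 9 ^ CARD('n) * x + d * x = (11 * d + 91 * 9 ^ CARD('n)) * x" for x
    by (simp add: algebra_simps)
  ultimately show ?thesis by (simp only: L_def P_def d_def)
qed

section \<open>Stages and blocks\<close>

lemma grid_set_Compl: "grid_set p S \<Longrightarrow> grid_set p (- S)"
  unfolding grid_set_def by (metis ComplD ComplI)

lemma grid_set_Int: "grid_set p S \<Longrightarrow> grid_set p T \<Longrightarrow> grid_set p (S \<inter> T)"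
  unfolding grid_set_def by (metis Int_iff)

lemma grid_set_UNIV: "grid_set p UNIV"
  by (simp add: grid_set_def)

lemma grid_set_INT:
  assumes "finite I" "\<And>x. x \<in> I \<Longrightarrow> grid_set p (A x)"
  shows "grid_set p (\<Inter>x\<in>I. A x)"
  using assms by (induction I) (auto intro: grid_set_UNIV grid_set_Int)

lemma grid_set_refine:
  fixes S :: "(real ^ 'n) set"
  assumes "grid_set p S" "p \<le> p'"
  shows "grid_set p' S"
proof -
  have fl: "\<lfloor>2 ^ p * x\<rfloor> = \<lfloor>2 ^ p' * x\<rfloor> div 2 ^ (p' - p)" for x :: real
  proof -
    have "(2 :: real) ^ p' = 2 ^ p * 2 ^ (p' - p)" using assms(2) by (simp flip: power_add)
    then have "2 ^ p * x = 2 ^ p' * x / of_int (2 ^ (p' - p))" by simp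
    then show ?thesis by (simp only: floor_divide_real_eq_div zero_le_power zero_le_numeral)
  qed
  show ?thesis
    using assms(1) unfolding grid_set_def by (metis fl)
qed

lemma prim_slab_periodic:
  fixes k :: "int ^ 'n"
  shows "\<alpha> + real_vec z \<in> prim_slab \<delta> k \<longleftrightarrow> \<alpha> \<in> prim_slab \<delta> k"
proof -
  have *: "\<alpha> + real_vec z \<in> prim_slab \<delta> k" if mem: "\<alpha> \<in> prim_slab \<delta> k" for \<alpha> z
  proof -
    let ?S = "range (\<lambda>i. k $ i)"
    define t where "t = (\<Sum>i\<in>UNIV. k $ i * z $ i)"
    from mem obtain m where m: "Gcd (insert m ?S) = 1" "\<bar>real_vec k \<bullet> \<alpha> + of_int m\<bar> \<le> \<delta>"
      unfolding prim_slab_def by blast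
    have "Gcd ?S dvd t" unfolding t_def by (intro dvd_sum dvd_mult2 Gcd_dvd) auto
    then obtain y where "t = Gcd ?S * y" by blast
    then have "gcd (m - t) (Gcd ?S) = gcd m (Gcd ?S)"
      using gcd_add_mult[of "Gcd ?S" "- y" m] by (simp add: gcd.commute algebra_simps)
    then have "Gcd (insert (m - t) ?S) = 1" using m(1) by simp
    moreover have "real_vec k \<bullet> (\<alpha> + real_vec z) + of_int (m - t) = real_vec k \<bullet> \<alpha> + of_int m"
      by (simp add: inner_add_right inner_real_vec t_def)
    then have "\<bar>real_vec k \<bullet> (\<alpha> + real_vec z) + of_int (m - t)\<bar> \<le> \<delta>" using m(2) by simp
    ultimately show ?thesis unfolding prim_slab_def by blast
  qed
  show ?thesis using *[of \<alpha> z] *[of "\<alpha> + real_vec z" "- z"] by auto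
qed

lemma sub_hits_periodic: "\<alpha> + real_vec z \<in> sub_hits i l \<theta> \<longleftrightarrow> \<alpha> \<in> sub_hits i l \<theta>"
  by (simp add: sub_hits_def prim_slab_periodic)

text \<open>
The smallest union of grid cubes containing \<open>A\<close>.  Replacing the set of hits by its hull keeps the
past of a stage in the class of grid sets.
\<close>

definition cell_hull :: "nat \<Rightarrow> (real ^ 'n) set \<Rightarrow> (real ^ 'n) set" where
  "cell_hull p A = {\<alpha>. \<exists>\<alpha>'\<in>A. \<forall>i. \<lfloor>2 ^ p * \<alpha> $ i\<rfloor> = \<lfloor>2 ^ p * \<alpha>' $ i\<rfloor>}"

lemma subset_cell_hull: "A \<subseteq> cell_hull p A"
  by (auto simp: cell_hull_def)

lemma grid_set_cell_hull:
  fixes A :: "(real ^ 'n) set"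
  assumes per: "\<And>\<alpha> z. \<alpha> + real_vec z \<in> A \<longleftrightarrow> \<alpha> \<in> A"
  shows "grid_set p (cell_hull p A)"
proof -
  have fl: "\<lfloor>2 ^ p * (x + of_int m)\<rfloor> = \<lfloor>2 ^ p * x\<rfloor> + 2 ^ p * m" for x :: real and m
  proof -
    have "2 ^ p * (x + of_int m) = 2 ^ p * x + of_int (2 ^ p * m)" by (simp add: distrib_left)
    then show ?thesis by (simp only: floor_add_int)
  qed
  have *: "\<alpha> + real_vec z \<in> cell_hull p A" if hull: "\<alpha> \<in> cell_hull p A" for \<alpha> z
  proof -
    from hull obtain \<alpha>' where "\<alpha>' \<in> A" "\<And>i. \<lfloor>2 ^ p * \<alpha> $ i\<rfloor> = \<lfloor>2 ^ p * \<alpha>' $ i\<rfloor>"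
      by (auto simp: cell_hull_def)
    then have "\<alpha>' + real_vec z \<in> A" "\<And>i. \<lfloor>2 ^ p * (\<alpha> + real_vec z) $ i\<rfloor> = \<lfloor>2 ^ p * (\<alpha>' + real_vec z) $ i\<rfloor>"
      by (simp_all add: per fl)
    then show ?thesis unfolding cell_hull_def by blast
  qed
  have "\<alpha> + real_vec z \<in> cell_hull p A \<longleftrightarrow> \<alpha> \<in> cell_hull p A" for \<alpha> z
    using *[of \<alpha> z] *[of "\<alpha> + real_vec z" "- z"] by auto
  then show ?thesis by (auto simp: grid_set_def cell_hull_def)
qed

text \<open>
On a sufficiently fine grid the passage to the hull costs a factor \<open>2\<close> in the tolerance.
\<close>

lemma cell_hull_sub_hits:
  fixes i :: "'n :: finite"
  assumes "\<alpha> \<in> cell_hull p (sub_hits i l \<theta>)" and fine: "real CARD('n) * (2 ^ 2 ^ l) ^ (CARD('n) + 1) \<le> \<theta> * 2 ^ p"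
  shows "\<alpha> \<in> sub_hits i l (2 * \<theta>)"
proof -
  let ?D = "\<lambda>q. (2 ^ q) ^ CARD('n) :: real"
  from assms(1) obtain \<alpha>' where "\<alpha>' \<in> sub_hits i l \<theta>" and cell: "\<And>i. \<lfloor>2 ^ p * \<alpha> $ i\<rfloor> = \<lfloor>2 ^ p * \<alpha>' $ i\<rfloor>"
    by (auto simp: cell_hull_def)
  then obtain q k where q: "2 ^ (l - 1) < q" "q \<le> 2 ^ l" and k: "k \<in> quadrant_shell i q"
    and mem: "\<alpha>' \<in> prim_slab (\<theta> / ?D q) k"
    by (auto simp: sub_hits_def)
  from mem obtain m where m: "Gcd (insert m (range (\<lambda>i. k $ i))) = 1" "\<bar>real_vec k \<bullet> \<alpha>' + of_int m\<bar> \<le> \<theta> / ?D q"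
    unfolding prim_slab_def by blast
  have diff: "\<bar>\<alpha> $ j - \<alpha>' $ j\<bar> \<le> 1 / 2 ^ p" for j
  proof -
    have "\<bar>2 ^ p * \<alpha> $ j - 2 ^ p * \<alpha>' $ j\<bar> \<le> 1" using cell[of j] by linarith
    then have "2 ^ p * \<bar>\<alpha> $ j - \<alpha>' $ j\<bar> \<le> 1" by (simp add: abs_mult flip: right_diff_distrib)
    then show ?thesis by (simp add: field_simps)
  qed
  have "\<bar>real_vec k \<bullet> \<alpha> - real_vec k \<bullet> \<alpha>'\<bar> = \<bar>\<Sum>j\<in>UNIV. of_int (k $ j) * (\<alpha> $ j - \<alpha>' $ j)\<bar>"
    by (simp add: inner_vec_def right_diff_distrib sum_subtractf)
  also have "\<dots> \<le> (\<Sum>j\<in>UNIV. \<bar>of_int (k $ j) * (\<alpha> $ j - \<alpha>' $ j)\<bar>)" by (rule sum_abs)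
  also have "\<dots> \<le> (\<Sum>j\<in>(UNIV :: 'n set). 2 ^ q * (1 / 2 ^ p))"
  proof (intro sum_mono)
    fix j
    have "\<bar>k $ j\<bar> \<le> 2 ^ q" using k quadrant_shell_subset by (auto simp: shell_def)
    then have "of_int \<bar>k $ j\<bar> \<le> real_of_int (2 ^ q)" by (simp only: of_int_le_iff)
    then show "\<bar>of_int (k $ j) * (\<alpha> $ j - \<alpha>' $ j)\<bar> \<le> 2 ^ q * (1 / 2 ^ p)"
      unfolding abs_mult using diff[of j] by (intro mult_mono) auto
  qed
  also have "\<dots> = real CARD('n) * 2 ^ q / 2 ^ p" by simp
  also have "\<dots> \<le> \<theta> / ?D q"
  proof -
    have "real CARD('n) * 2 ^ q * ?D q = real CARD('n) * (2 ^ q) ^ (CARD('n) + 1)" by simp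
    also have "\<dots> \<le> real CARD('n) * (2 ^ 2 ^ l) ^ (CARD('n) + 1)"
      using q by (intro mult_left_mono power_mono power_increasing) auto
    also have "\<dots> \<le> \<theta> * 2 ^ p" by (rule fine)
    finally show ?thesis by (simp add: field_simps)
  qed
  finally have "\<bar>real_vec k \<bullet> \<alpha> + of_int m\<bar> \<le> 2 * \<theta> / ?D q" using m(2) by simp
  then have "\<alpha> \<in> prim_slab (2 * \<theta> / ?D q) k" unfolding prim_slab_def using m(1) by blast
  then show ?thesis using q k by (auto simp: sub_hits_def)
qed

lemma linear_le_two_power: "8 \<le> l \<Longrightarrow> 32 * l \<le> 2 ^ l"
proof (induction l rule: nat_induct_at_least)
  case (Suc l)
  then show ?case by simp
qed simp

lemma div_two_power_antimono:
  assumes "1 \<le> m" "m \<le> n"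
  shows "real n / 2 ^ n \<le> real m / 2 ^ m"
  using assms(2)
proof (induction n rule: dec_induct)
  case (step n)
  have "real (Suc n) / 2 ^ Suc n \<le> real n / 2 ^ n" using step assms(1) by (simp add: field_simps)
  then show ?case using step.IH by linarith
qed simp

text \<open>
Stage \<open>n\<close> uses the shells up to \<open>2 ^ (growth * n)\<close> and the grid of level \<open>(d + 2) * 2 ^ (growth * n)\<close>.
The factor \<open>d + 2\<close> makes the cubes smaller than the slabs of that stage, whose width has order
\<open>\<theta> / (2\<^sup>q)\<^sup>d\<^sup>+\<^sup>1\<close>; the value of \<open>growth\<close> is large enough for the slabs of the next stage to lie much closer
to each other than the mesh.
\<close>

definition growth :: "'n :: finite itself \<Rightarrow> nat" where
  "growth _ = 4 * (CARD('n) + 2)"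

abbreviation level :: "'n :: finite itself \<Rightarrow> nat \<Rightarrow> nat" where
  "level t n \<equiv> (CARD('n) + 2) * 2 ^ (growth t * n)"

abbreviation stage :: "'n :: finite \<Rightarrow> nat \<Rightarrow> real \<Rightarrow> (real ^ 'n) set" where
  "stage i n \<theta> \<equiv> cell_hull (level TYPE('n) n) (sub_hits i (growth TYPE('n) * n) \<theta>)"

lemma level_mono: "m \<le> n \<Longrightarrow> level t m \<le> level t n"
  by (intro mult_left_mono power_increasing) auto

lemma grid_set_stage: "grid_set (level TYPE('n) n) (stage (i :: 'n :: finite) n \<theta>)"
  by (intro grid_set_cell_hull sub_hits_periodic)

definition stage_error :: "'n :: finite itself \<Rightarrow> nat \<Rightarrow> real" where
  "stage_error t n = (11 * real CARD('n) + 91 * 9 ^ CARD('n)) * (real (growth t * n) / 2 ^ (growth t * n))"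

text \<open>
Each stage is a grid set for the next one, so the lower bounds of \<open>prob_sub_hits_ge\<close> multiply.
\<close>

lemma prob_stages_ge:
  fixes i :: "'n :: finite" and S :: "(real ^ 'n) set"
  defines "a \<equiv> growth TYPE('n)"
  assumes S: "grid_set (level TYPE('n) n) S" and \<theta>: "1 / 4 ^ (a * (n + 1)) \<le> \<theta>"
    and small: "4 * (1024 * 3 ^ CARD('n))\<^sup>2 * (2 ^ (a * (n + r)) * \<theta>) \<le> 1"
  shows "(2 ^ (a * (n + 1)) * \<theta> / 16) ^ r * tor.prob S - (\<Sum>j=1..r. stage_error TYPE('n) (n + j))
    \<le> tor.prob (S \<inter> (\<Inter>j\<in>{1..r}. stage i (n + j) \<theta>))"
  using small
proof (induction r)
  case (Suc r)
  let ?B = "(1024 * 3 ^ CARD('n))\<^sup>2 :: real"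
  let ?c = "2 ^ (a * (n + 1)) * \<theta> / 16"
  let ?T = "S \<inter> (\<Inter>j\<in>{1..r}. stage i (n + j) \<theta>)"
  let ?e = "\<Sum>j=1..r. stage_error TYPE('n) (n + j)"
  define l where "l = a * (n + Suc r)"
  have a: "12 \<le> a" "a = 4 * (CARD('n) + 2)" by (simp_all add: a_def growth_def Suc_le_eq)
  have \<theta>0: "0 < \<theta>" using \<theta> by (rule less_le_trans[rotated]) simp
  have l: "12 \<le> l" using mult_le_mono[OF a(1), of 1 "n + Suc r"] by (simp add: l_def)
  have mono: "2 ^ (a * (n + r)) * \<theta> \<le> 2 ^ l * \<theta>"
    unfolding l_def using \<theta>0 by (intro mult_right_mono power_increasing) auto
  have small': "4 * ?B * (2 ^ l * \<theta>) \<le> 1" using Suc.prems by (simp add: l_def)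
  have "4 * ?B * (2 ^ (a * (n + r)) * \<theta>) \<le> 4 * ?B * (2 ^ l * \<theta>)"
    using mono by (intro mult_left_mono) auto
  then have IH: "?c ^ r * tor.prob S - ?e \<le> tor.prob ?T" using small' by (intro Suc.IH) linarith
  have c0: "0 \<le> ?c" using \<theta>0 by simp
  have cl: "?c \<le> 2 ^ l * \<theta> / 16"
    unfolding l_def using \<theta>0 by (intro divide_right_mono mult_right_mono power_increasing) auto
  have c1: "?c \<le> 1"
  proof -
    have "1 \<le> ?B" by (intro one_le_power) (auto intro: order_trans[of _ 1024])
    then have "1 * (2 ^ l * \<theta>) \<le> 4 * ?B * (2 ^ l * \<theta>)"
      using \<theta>0 by (intro mult_right_mono) auto
    then show ?thesis using small' cl by linarith
  qed
  have e0: "0 \<le> ?e" unfolding stage_error_def by (intro sum_nonneg) auto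
  have gridT: "grid_set (level TYPE('n) (n + r)) ?T"
    by (intro grid_set_Int grid_set_INT grid_set_refine[OF S] grid_set_refine[OF grid_set_stage] level_mono) auto
  have gridT': "grid_set (level TYPE('n) (n + Suc r)) (?T \<inter> stage i (n + Suc r) \<theta>)"
    by (intro grid_set_Int grid_set_stage grid_set_refine[OF gridT] level_mono) simp
  have "4 * level TYPE('n) (n + r) = a * 2 ^ (a * (n + r))"
    unfolding a_def growth_def by (rule mult.assoc[symmetric])
  also have "\<dots> \<le> 2 ^ a * 2 ^ (a * (n + r))" by (intro mult_right_mono) (auto intro: less_imp_le less_exp)
  also have "\<dots> = 2 ^ l" by (simp add: l_def algebra_simps flip: power_add)
  finally have p: "4 * level TYPE('n) (n + r) \<le> 2 ^ l" .
  have "1 / 4 ^ l \<le> 1 / (4 :: real) ^ (a * (n + 1))"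
    unfolding l_def by (intro divide_left_mono power_increasing) auto
  then have \<theta>l: "1 / 4 ^ l \<le> \<theta>" using \<theta> by linarith
  have "2 ^ l * \<theta> * tor.prob ?T / 16 - stage_error TYPE('n) (n + Suc r) \<le> tor.prob (?T \<inter> sub_hits i l \<theta>)"
    using prob_sub_hits_ge[OF gridT _ _ p \<theta>l small', of i] l linear_le_two_power[of l]
    by (simp add: stage_error_def l_def a_def)
  also have "\<dots> \<le> tor.prob (?T \<inter> stage i (n + Suc r) \<theta>)"
    unfolding l_def a_def using grid_set_sets[OF gridT']
    by (intro tor.finite_measure_mono Int_mono order_refl subset_cell_hull) simp
  also have "?T \<inter> stage i (n + Suc r) \<theta> = S \<inter> (\<Inter>j\<in>{1..Suc r}. stage i (n + j) \<theta>)"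
    by (auto simp: atLeastAtMostSuc_conv)
  finally have step: "2 ^ l * \<theta> * tor.prob ?T / 16 - stage_error TYPE('n) (n + Suc r)
    \<le> tor.prob (S \<inter> (\<Inter>j\<in>{1..Suc r}. stage i (n + j) \<theta>))" .
  have "?c ^ Suc r * tor.prob S - ?e \<le> ?c * (?c ^ r * tor.prob S - ?e)"
    using mult_right_mono[OF c1 e0] by (simp add: right_diff_distrib mult.assoc)
  also have "\<dots> \<le> ?c * tor.prob ?T" using IH c0 by (intro mult_left_mono) auto
  also have "\<dots> \<le> 2 ^ l * \<theta> / 16 * tor.prob ?T" using cl by (intro mult_right_mono) auto
  finally show ?case using step by simp
qed simp

text \<open>
If \<open>p\<close> stayed above \<open>\<epsilon>\<close>, it would decrease by \<open>\<kappa> \<epsilon> / m\<close> in each step up to summable errors, which is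
impossible as the harmonic series diverges.
\<close>

lemma divergent_recursion_small:
  fixes p E :: "nat \<Rightarrow> real"
  assumes p0: "\<And>m. 0 \<le> p m" and \<kappa>: "0 < \<kappa>" and E: "summable E" "\<And>m. 0 \<le> E m"
    and rec: "\<And>m. m0 \<le> m \<Longrightarrow> p (Suc m) \<le> p m - \<kappa> / real m * p m + E m" and \<epsilon>: "0 < \<epsilon>"
  shows "\<exists>m\<ge>m0. p m < \<epsilon>"
proof (rule ccontr)
  assume "\<not> ?thesis"
  then have ge: "\<epsilon> \<le> p m" if "m0 \<le> m" for m using that by (auto simp: not_less)
  have step: "p (m0 + k) + (\<Sum>j<k. \<kappa> * \<epsilon> / real (m0 + j)) \<le> p m0 + (\<Sum>j<k. E (m0 + j))" for k
  proof (induction k)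
    case (Suc k)
    have "\<kappa> / real (m0 + k) * \<epsilon> \<le> \<kappa> / real (m0 + k) * p (m0 + k)"
      using ge[of "m0 + k"] \<kappa> by (intro mult_left_mono) auto
    then show ?case using Suc rec[of "m0 + k"] by simp
  qed simp
  have "(\<Sum>j<k. \<kappa> * \<epsilon> / real (m0 + j)) \<le> p m0 + suminf (\<lambda>j. E (m0 + j))" for k
  proof -
    have "summable (\<lambda>j. E (m0 + j))" using E(1) by (subst add.commute) (simp add: summable_iff_shift)
    then have "(\<Sum>j<k. E (m0 + j)) \<le> suminf (\<lambda>j. E (m0 + j))" using E(2) by (intro sum_le_suminf) auto
    then show ?thesis using step[of k] p0[of "m0 + k"] by linarith
  qed
  then have "summable (\<lambda>j. \<kappa> * \<epsilon> / real (m0 + j))"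
    using \<kappa> \<epsilon> by (intro summableI_nonneg_bounded) auto
  then have "summable (\<lambda>j. \<kappa> * \<epsilon> / real (j + m0))" by (simp add: add.commute)
  then have "summable (\<lambda>j. \<kappa> * \<epsilon> / real j)"
    by (rule iffD1[OF summable_iff_shift[of "\<lambda>j. \<kappa> * \<epsilon> / real j" m0]])
  then have "summable (\<lambda>j. inverse (\<kappa> * \<epsilon>) * (\<kappa> * \<epsilon> / real j))" by (rule summable_mult)
  then have "summable (\<lambda>j. inverse (real j))" using \<kappa> \<epsilon> by (simp add: field_simps)
  then show False using not_summable_harmonic by blast
qed

text \<open>
Block \<open>m\<close> consists of the stages \<open>r * m + 1, \<dots>, r * m + r\<close>; the last one uses shells up to
\<open>2 ^ block_size\<close>, and \<open>block_bound\<close> is a bound for the norm of all vectors in these shells.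
\<close>

definition block_size :: "'n :: finite itself \<Rightarrow> nat \<Rightarrow> nat \<Rightarrow> nat" where
  "block_size t r m = growth t * (r * m + r)"

definition block_bound :: "'n :: finite itself \<Rightarrow> nat \<Rightarrow> nat \<Rightarrow> nat" where
  "block_bound t r m = CARD('n) * 2 ^ 2 ^ block_size t r m"

lemma norm_real_vec_shell_le:
  fixes k :: "int ^ 'n"
  assumes "k \<in> shell q"
  shows "norm (real_vec k) \<le> real CARD('n) * 2 ^ q"
proof -
  have "norm (real_vec k) \<le> (\<Sum>j\<in>UNIV. \<bar>real_vec k $ j\<bar>)" by (rule norm_le_l1_cart)
  also have "\<dots> \<le> (\<Sum>j\<in>(UNIV :: 'n set). 2 ^ q)"
  proof (intro sum_mono)
    fix j
    have "\<bar>k $ j\<bar> \<le> 2 ^ q" using assms by (simp add: shell_def)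
    then have "of_int \<bar>k $ j\<bar> \<le> real_of_int (2 ^ q)" by (simp only: of_int_le_iff)
    then show "\<bar>real_vec k $ j\<bar> \<le> 2 ^ q" by simp
  qed
  finally show ?thesis by simp
qed

lemma minus_in_D_set:
  assumes "k \<in> D_set \<alpha> s c N"
  shows "- k \<in> D_set \<alpha> s c N"
proof -
  from assms obtain m :: int where m: "Gcd (insert m (range (\<lambda>i. k $ i))) = 1"
    "norm (real_vec k) ^ CARD('a) * \<bar>real_vec k \<bullet> \<alpha> + real_of_int m\<bar> \<le> c / (ln (real N) * ln (ln (real N)) powr s)"
    unfolding D_set_def mem_Collect_eq by blast
  have "insert (- m) (range (\<lambda>i. (- k) $ i)) = uminus ` insert m (range (\<lambda>i. k $ i))" by (auto simp: image_image)
  moreover have "Gcd (uminus ` A) = Gcd A" for A :: "int set"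
  proof (rule zdvd_antisym_nonneg)
    show "Gcd (uminus ` A) dvd Gcd A"
      by (intro Gcd_greatest) (metis Gcd_dvd dvd_minus_iff imageI)
    show "Gcd A dvd Gcd (uminus ` A)"
      by (intro Gcd_greatest) (auto simp: Gcd_dvd)
  qed auto
  ultimately have "Gcd (insert (- m) (range (\<lambda>i. (- k) $ i))) = 1" using m(1) by (simp only:)
  moreover have "\<bar>real_vec (- k) \<bullet> \<alpha> + real_of_int (- m)\<bar> = \<bar>real_vec k \<bullet> \<alpha> + real_of_int m\<bar>"
    by simp
  ultimately show ?thesis using assms m(2) unfolding D_set_def mem_Collect_eq
    by (intro conjI exI[of _ "- m"]) auto
qed

text \<open>
Different stages use different shells, and vectors with positive entries are never negatives of each
other, so \<open>r\<close> stages with a hit produce \<open>2 r\<close> elements.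
\<close>

lemma card_D_set_ge_of_stages:
  fixes i :: "'n :: finite" and \<alpha> :: "real ^ 'n" and r m :: nat
  defines "N \<equiv> block_bound TYPE('n) r m"
  assumes stages: "\<And>j. j \<in> {1..r} \<Longrightarrow> \<alpha> \<in> sub_hits i (growth TYPE('n) * (r * m + j)) \<theta>"
    and \<theta>: "real CARD('n) ^ CARD('n) * \<theta> \<le> c / (ln (real N) * ln (ln (real N)) powr s)"
  shows "2 * r \<le> card (D_set \<alpha> s c N)"
proof -
  let ?a = "growth TYPE('n)"
  have a: "1 \<le> ?a" by (simp add: growth_def)
  let ?P = "\<lambda>j (q, k). 2 ^ (?a * (r * m + j) - 1) < q \<and> q \<le> 2 ^ (?a * (r * m + j)) \<and> k \<in> quadrant_shell i q \<and>
      \<alpha> \<in> prim_slab (\<theta> / (2 ^ q) ^ CARD('n)) k"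
  have "\<exists>f. \<forall>j\<in>{1..r}. ?P j (f j)"
    using stages by (intro bchoice) (auto simp: sub_hits_def Bex_def)
  then obtain f where f': "\<forall>j\<in>{1..r}. ?P j (f j)" by (rule exE)
  have f: "?P j (f j)" if "j \<in> {1..r}" for j using f' that by (rule bspec)
  define q k where "q j = fst (f j)" and "k j = snd (f j)" for j
  have q: "2 ^ (?a * (r * m + j) - 1) < q j" "q j \<le> 2 ^ (?a * (r * m + j))"
    and k: "k j \<in> quadrant_shell i (q j)" "\<alpha> \<in> prim_slab (\<theta> / (2 ^ q j) ^ CARD('n)) (k j)" if "j \<in> {1..r}" for j
    using f[OF that] by (auto simp: q_def k_def split_def)
  have sh: "k j \<in> shell (q j)" if "j \<in> {1..r}" for j using k(1)[OF that] quadrant_shell_subset by blast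
  have qlt: "q j < q j'" if "j \<in> {1..r}" "j' \<in> {1..r}" "j < j'" for j j'
  proof -
    have "?a * (r * m + j) < ?a * (r * m + j')" using that(3) a by simp
    then have "(2 :: nat) ^ (?a * (r * m + j)) \<le> 2 ^ (?a * (r * m + j') - 1)"
      by (intro power_increasing) (linarith, simp)
    then show ?thesis using q(2)[OF that(1)] q(1)[OF that(2)] by linarith
  qed
  have inj: "inj_on k {1..r}"
  proof (rule linorder_inj_onI)
    fix x y assume xy: "x < y" "x \<in> {1..r}" "y \<in> {1..r}"
    show "k x \<noteq> k y"
      using shell_unique[of "k x" "q x" "q y"] sh xy qlt[of x y] by auto
  qed auto
  have D: "k j \<in> D_set \<alpha> s c N" if j: "j \<in> {1..r}" for j
  proof -
    have n: "norm (real_vec (k j)) \<le> real CARD('n) * 2 ^ q j" by (rule norm_real_vec_shell_le[OF sh[OF j]])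
    have "q j \<le> 2 ^ block_size TYPE('n) r m"
      using q(2)[OF j] j unfolding block_size_def
      by (elim order_trans) (intro power_increasing mult_left_mono, auto)
    then have "real CARD('n) * 2 ^ q j \<le> real CARD('n) * 2 ^ 2 ^ block_size TYPE('n) r m"
      by (intro mult_left_mono power_increasing) auto
    then have kN: "norm (real_vec (k j)) \<le> real N"
      using n unfolding N_def block_bound_def of_nat_mult of_nat_power of_nat_numeral by linarith
    from k(2)[OF j] obtain m where m: "Gcd (insert m (range (\<lambda>i. k j $ i))) = 1"
      "\<bar>real_vec (k j) \<bullet> \<alpha> + of_int m\<bar> \<le> \<theta> / (2 ^ q j) ^ CARD('n)" unfolding prim_slab_def by blast
    have "norm (real_vec (k j)) ^ CARD('n) * \<bar>real_vec (k j) \<bullet> \<alpha> + of_int m\<bar>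
        \<le> (real CARD('n) * 2 ^ q j) ^ CARD('n) * (\<theta> / (2 ^ q j) ^ CARD('n))"
      using n m(2) by (intro mult_mono power_mono) auto
    also have "\<dots> = real CARD('n) ^ CARD('n) * \<theta>" by (simp add: power_mult_distrib)
    finally have "norm (real_vec (k j)) ^ CARD('n) * \<bar>real_vec (k j) \<bullet> \<alpha> + of_int m\<bar>
        \<le> c / (ln (real N) * ln (ln (real N)) powr s)" using \<theta> by linarith
    moreover have "k j \<noteq> 0" using sh[OF j] shell_subset_int_box by (auto simp: int_box_def)
    ultimately show ?thesis using kN m(1) unfolding D_set_def mem_Collect_eq by blast
  qed
  have "k ` {1..r} \<inter> uminus ` k ` {1..r} = {}"
  proof (rule ccontr)
    assume "k ` {1..r} \<inter> uminus ` k ` {1..r} \<noteq> {}"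
    then obtain x y where xy: "x \<in> {1..r}" "y \<in> {1..r}" "k x = - k y" by blast
    then show False using quadrant_shell_pos[OF k(1)[OF xy(1)], of i] quadrant_shell_pos[OF k(1)[OF xy(2)], of i] by simp
  qed
  then have "card (k ` {1..r} \<union> uminus ` k ` {1..r}) = card (k ` {1..r}) + card (uminus ` k ` {1..r})"
    by (intro card_Un_disjoint) auto
  also have "\<dots> = 2 * r" using inj by (simp add: card_image)
  finally have "2 * r = card (k ` {1..r} \<union> uminus ` k ` {1..r})" by simp
  also have "\<dots> \<le> card (D_set \<alpha> s c N)"
    using D by (intro card_mono finite_D_set) (auto intro!: minus_in_D_set)
  finally show ?thesis .
qed

section \<open>The divergence case\<close>

text \<open>
So the threshold at \<open>N = block_bound\<close> is at least a constant times \<open>1 / (2 ^ block_size * m powr s)\<close>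
for \<open>s \<ge> 0\<close>.
\<close>

lemma block_bound_estimates:
  fixes r m :: nat
  defines "N \<equiv> block_bound TYPE('n :: finite) r m" and "X \<equiv> (2 :: real) ^ block_size TYPE('n) r m"
  assumes r: "1 \<le> r" and m: "1 \<le> m"
  shows ln_block_bound_le: "ln (real N) \<le> 2 * real CARD('n) * X"
    and ln_block_bound_pos: "0 < ln (real N)"
    and ln_ln_block_bound_ge: "1 \<le> ln (ln (real N))"
    and ln_ln_block_bound_le: "ln (ln (real N)) \<le> (2 * real CARD('n) + 2 * real (growth TYPE('n) * r)) * real m"
proof -
  let ?d = "real CARD('n)" and ?b = "block_size TYPE('n) r m"
  have d: "1 \<le> ?d" by (simp add: Suc_le_eq)
  have X: "1 \<le> X" by (simp add: X_def)
  have "12 * 1 \<le> growth TYPE('n) * (r * m + r)"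
    using r by (intro mult_le_mono) (auto simp: growth_def Suc_le_eq)
  then have b: "12 \<le> ?b" by (simp add: block_size_def)
  have ln2: "1 / 2 \<le> ln (2 :: real)" "ln (2 :: real) \<le> 1"
    using ln2_ge_two_thirds ln_le_minus_one[of 2] by auto
  have N: "ln (real N) = ln ?d + X * ln 2"
    using d by (simp add: N_def block_bound_def X_def ln_mult ln_realpow)
  have "ln ?d \<le> ?d" using d ln_le_minus_one[of ?d] by simp
  moreover have "X * ln 2 \<le> X * 1" using X ln2 by (intro mult_left_mono) auto
  moreover have "?d * 1 \<le> ?d * X" "1 * X \<le> ?d * X" using d X by (intro mult_mono, auto)+
  ultimately show le: "ln (real N) \<le> 2 * ?d * X" using N by linarith
  have "(2 :: real) ^ 12 \<le> X" unfolding X_def using b by (intro power_increasing) auto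
  then have "4096 * (1 / 2) \<le> X * ln 2" using ln2 by (intro mult_mono) auto
  moreover have "0 \<le> ln ?d" using d by simp
  ultimately have big: "2048 \<le> ln (real N)" using N by linarith
  then show "0 < ln (real N)" by linarith
  have "exp (1 :: real) \<le> ln (real N)" using exp_le big by linarith
  then show "1 \<le> ln (ln (real N))" using big by (subst ln_ge_iff) auto
  have "ln (ln (real N)) \<le> ln (2 * ?d * X)" using le big by (intro ln_mono) auto
  also have "\<dots> = ln (2 * ?d) + real ?b * ln 2" using d by (simp add: X_def ln_mult ln_realpow)
  also have "\<dots> \<le> 2 * ?d + real ?b * 1"
    using ln_le_minus_one[of "2 * ?d"] d ln2 by (intro add_mono mult_left_mono) auto
  also have "\<dots> \<le> 2 * ?d * real m + 2 * real (growth TYPE('n) * r) * real m"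
  proof (intro add_mono)
    show "2 * ?d \<le> 2 * ?d * real m" using d m by simp
    have "?b \<le> 2 * (growth TYPE('n) * r) * m"
      using m by (simp add: block_size_def algebra_simps)
    then have "real ?b \<le> real (2 * (growth TYPE('n) * r) * m)" by (rule of_nat_mono)
    then show "real ?b * 1 \<le> 2 * real (growth TYPE('n) * r) * real m" by simp
  qed
  finally show "ln (ln (real N)) \<le> (2 * ?d + 2 * real (growth TYPE('n) * r)) * real m"
    by (simp add: algebra_simps)
qed

lemma stage_subset_sub_hits:
  fixes i :: "'n :: finite"
  assumes n: "1 \<le> n" and \<theta>: "1 / 4 ^ (growth TYPE('n) * n) \<le> \<theta>"
  shows "stage i n \<theta> \<subseteq> sub_hits i (growth TYPE('n) * n) (2 * \<theta>)"
proof
  fix \<alpha> :: "real ^ 'n" assume \<alpha>: "\<alpha> \<in> stage i n \<theta>"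
  let ?d = "CARD('n)"
  define l where "l = growth TYPE('n) * n"
  have g: "growth TYPE('n) \<le> l" using n by (simp add: l_def)
  then have l: "8 \<le> l" "?d \<le> l" by (auto simp: growth_def)
  have "real ?d * 4 ^ l \<le> 2 ^ l * 2 ^ (2 * l)"
  proof (intro mult_mono)
    have "?d < 2 ^ l" using l less_exp[of l] by linarith
    then have "real ?d \<le> real (2 ^ l)" by (intro of_nat_mono) simp
    then show "real ?d \<le> 2 ^ l" by simp
  qed (auto simp: power_mult)
  also have "\<dots> = 2 ^ (3 * l)" by (simp flip: power_add)
  also have "\<dots> \<le> 2 ^ 2 ^ l" using linear_le_two_power[OF l(1)] by (intro power_increasing) auto
  finally have dl: "real ?d * 4 ^ l \<le> 2 ^ 2 ^ l" .
  show "\<alpha> \<in> sub_hits i (growth TYPE('n) * n) (2 * \<theta>)"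
  proof (rule cell_hull_sub_hits[OF \<alpha>])
    let ?Y = "2 ^ 2 ^ l :: real"
    have "real ?d \<le> ?Y * (1 / 4 ^ l)" using dl by (simp add: field_simps)
    also have "\<dots> \<le> ?Y * \<theta>" using \<theta> by (intro mult_left_mono) (auto simp: l_def)
    finally have "real ?d * ?Y ^ (?d + 1) \<le> ?Y * \<theta> * ?Y ^ (?d + 1)" by (intro mult_right_mono) auto
    also have "\<dots> = \<theta> * ?Y ^ (?d + 2)" by (simp add: mult_ac)
    also have "?Y ^ (?d + 2) = 2 ^ level TYPE('n) n" by (simp only: l_def mult.commute[of "?d + 2"] power_mult)
    finally show "real ?d * (2 ^ 2 ^ (growth TYPE('n) * n)) ^ (?d + 1) \<le> \<theta> * 2 ^ level TYPE('n) n"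
      by (simp only: l_def)
  qed
qed

lemma sum_stage_error_le:
  assumes "1 \<le> m" "1 \<le> r"
  shows "(\<Sum>j=1..r. stage_error TYPE('n :: finite) (r * m + j))
    \<le> real r * (11 * real CARD('n) + 91 * 9 ^ CARD('n)) * (real m / 2 ^ m)"
proof -
  let ?C = "11 * real CARD('n) + 91 * 9 ^ CARD('n)"
  have "(\<Sum>j=1..r. stage_error TYPE('n) (r * m + j)) \<le> (\<Sum>j=1..r. ?C * (real m / 2 ^ m))"
  proof (intro sum_mono)
    fix j
    have "1 * (1 * m) \<le> growth TYPE('n) * (r * m + j)"
      using assms by (intro mult_le_mono trans_le_add1) (auto simp: growth_def)
    then have "m \<le> growth TYPE('n) * (r * m + j)" by simp
    from div_two_power_antimono[OF assms(1) this]
    show "stage_error TYPE('n) (r * m + j) \<le> ?C * (real m / 2 ^ m)"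
      unfolding stage_error_def by (intro mult_left_mono) auto
  qed
  then show ?thesis by (simp add: mult_ac)
qed

text \<open>
The threshold \<open>\<theta> m\<close> is chosen for the exponent \<open>1 / r\<close>, which is the least favourable one; then a
block contains \<open>r\<close> hits with conditional probability at least \<open>(\<kappa>\<^sub>0 / m powr (1 / r)) ^ r\<close>, which is a
constant divided by \<open>m\<close>.
\<close>

lemma AE_infinitely_many_large_D_set:
  fixes c s :: real and r :: nat
  assumes c: "0 < c" and r: "1 \<le> r" and s: "s \<le> 1 / real r"
  shows "AE \<alpha> in (tor :: (real ^ 'n) measure). infinite {N. 2 * r \<le> card (D_set \<alpha> s c N)}"
proof -
  define i :: 'n where "i = undefined"
  define a where "a = growth TYPE('n)"
  define d where "d = real CARD('n)"
  define s0 where "s0 = 1 / real r"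
  define K where "K = 2 * d + 2 * real (a * r)"
  define \<tau> where "\<tau> = c / (4 * d * d ^ CARD('n) * K powr s0)"
  define X where "X m = (2 :: real) ^ block_size TYPE('n) r m" for m
  define \<theta> where "\<theta> m = \<tau> / (X m * real m powr s0)" for m
  define N where "N m = block_bound TYPE('n) r m" for m
  define A where "A m = (\<Inter>j\<in>{1..r}. stage i (r * m + j) (\<theta> m))" for m
  define \<kappa>0 where "\<kappa>0 = 2 ^ a * \<tau> / (16 * 2 ^ (a * r))"
  define C where "C = 11 * real CARD('n) + 91 * 9 ^ CARD('n)"
  have d: "1 \<le> d" by (simp add: d_def Suc_le_eq)
  have a: "12 \<le> a" by (simp add: a_def growth_def Suc_le_eq)
  have s0: "0 < s0" "s0 * real r = 1" using r by (auto simp: s0_def)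
  have K: "0 < K" using d by (simp add: K_def add_pos_nonneg)
  have \<tau>: "0 < \<tau>" using c d K by (simp add: \<tau>_def)
  have \<kappa>0: "0 < \<kappa>0" using \<tau> by (simp add: \<kappa>0_def)
  have X: "1 \<le> X m" for m by (simp add: X_def)
  have N_ge: "m \<le> N m" for m
  proof -
    have "m \<le> block_size TYPE('n) r m"
    proof -
      have "1 * (1 * m) \<le> growth TYPE('n) * (r * m + r)"
        using r by (intro mult_le_mono trans_le_add1) (auto simp: growth_def)
      then show ?thesis by (simp add: block_size_def)
    qed
    also have "\<dots> \<le> 2 ^ block_size TYPE('n) r m" by (rule less_imp_le[OF less_exp])
    also have "\<dots> \<le> 2 ^ 2 ^ block_size TYPE('n) r m" by (rule less_imp_le[OF less_exp])
    also have "\<dots> \<le> N m" by (simp add: N_def block_bound_def)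
    finally show ?thesis .
  qed
  have threshold: "d ^ CARD('n) * (2 * \<theta> m) \<le> c / (ln (real (N m)) * ln (ln (real (N m))) powr s)" if m: "1 \<le> m" for m
  proof -
    note est = ln_block_bound_le[OF r m, where 'n = 'n] ln_ln_block_bound_ge[OF r m, where 'n = 'n]
      ln_ln_block_bound_le[OF r m, where 'n = 'n]
    let ?l = "ln (real (N m))"
    have ll: "1 \<le> ln ?l" using est(2) by (simp add: N_def)
    have l0: "0 < ?l" using ln_block_bound_pos[OF r m, where 'n = 'n] by (simp add: N_def)
    have "?l * ln ?l powr s \<le> (2 * d * X m) * (K * real m) powr s0"
    proof (intro mult_mono)
      show "?l \<le> 2 * d * X m" using est(1) by (simp add: N_def X_def d_def)
      have "ln ?l powr s \<le> ln ?l powr s0" using ll s by (intro powr_mono) (auto simp: s0_def)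
      also have "\<dots> \<le> (K * real m) powr s0"
        using est(3) ll s0 by (intro powr_mono2) (auto simp: N_def K_def d_def a_def)
      finally show "ln ?l powr s \<le> (K * real m) powr s0" .
    qed (use d X[of m] in auto)
    then have "c / ((2 * d * X m) * (K * real m) powr s0) \<le> c / (?l * ln ?l powr s)"
      using c l0 ll d K m X[of m] by (intro divide_left_mono mult_pos_pos) auto
    moreover have "c / ((2 * d * X m) * (K * real m) powr s0) = d ^ CARD('n) * (2 * \<theta> m)"
      using d K X[of m] m by (simp add: \<theta>_def \<tau>_def powr_mult field_simps)
    ultimately show ?thesis by simp
  qed
  have Xm: "X m = 2 ^ (a * (r * m)) * 2 ^ (a * r)" for m
    by (simp add: X_def block_size_def a_def distrib_left power_add)
  \<comment> \<open>With \<open>n = r * m\<close> these are the two conditions on \<open>\<theta>\<close> in \<open>prob_stages_ge\<close>.\<close>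
  have ev1: "eventually (\<lambda>m. 1 / 4 ^ (a * (r * m + 1)) \<le> \<theta> m) sequentially"
  proof -
    have "eventually (\<lambda>m. 2 ^ (a * r) / \<tau> \<le> 2 ^ m / real m) sequentially"
      by real_asymp
    then have "eventually (\<lambda>m. 2 ^ (a * r) / \<tau> \<le> 2 ^ m / real m \<and> 1 \<le> m) sequentially"
      using eventually_ge_at_top[of 1] by (rule eventually_conj)
    then show ?thesis
    proof eventually_elim
      case (elim m)
      have "real m powr s0 \<le> real m powr 1" using elim r by (intro powr_mono) (auto simp: s0_def)
      then have p: "0 < real m powr s0" "real m powr s0 \<le> real m" using elim by auto
      have "1 * (1 * m) \<le> a * (r * m)" using a r by (intro mult_le_mono) auto
      then have "(2 :: real) ^ m \<le> 2 ^ (a * (r * m))" by (intro power_increasing) auto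
      have "X m * real m powr s0 \<le> 2 ^ (a * (r * m)) * 2 ^ (a * r) * real m"
        unfolding Xm using p by (intro mult_left_mono) auto
      also have "\<dots> \<le> 2 ^ (a * (r * m)) * (\<tau> * 2 ^ m)"
      proof -
        have "2 ^ (a * r) / \<tau> * (\<tau> * real m) \<le> 2 ^ m / real m * (\<tau> * real m)"
          using elim \<tau> by (intro mult_right_mono) auto
        then have "2 ^ (a * r) * real m \<le> \<tau> * 2 ^ m" using elim \<tau> by (simp add: mult.commute)
        then show ?thesis by (simp add: mult.assoc)
      qed
      also have "\<dots> \<le> 2 ^ (a * (r * m)) * (\<tau> * 2 ^ (a * (r * m)))"
        using \<open>(2 :: real) ^ m \<le> 2 ^ (a * (r * m))\<close> \<tau> by (intro mult_left_mono) auto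
      also have "\<dots> = \<tau> * 4 ^ (a * (r * m))" by (simp flip: power_mult_distrib)
      also have "\<dots> \<le> \<tau> * 4 ^ (a * (r * m + 1))" using \<tau> by (intro mult_left_mono power_increasing) auto
      finally show ?case using p X[of m] \<tau> by (simp add: \<theta>_def field_simps)
    qed
  qed
  define B :: real where "B = 4 * (1024 * 3 ^ CARD('n))\<^sup>2"
  have ev2: "eventually (\<lambda>m. B * (X m * \<theta> m) \<le> 1) sequentially"
  proof -
    have "eventually (\<lambda>m. B * \<tau> \<le> real m powr s0) sequentially" using s0(1) by real_asymp
    then have "eventually (\<lambda>m. B * \<tau> \<le> real m powr s0 \<and> 1 \<le> m) sequentially"
      using eventually_ge_at_top[of 1] by (rule eventually_conj)
    then show ?thesis
    proof eventually_elim
      case (elim m)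
      have "X m * \<theta> m = \<tau> / real m powr s0" using X[of m] by (simp add: \<theta>_def)
      then have "B * (X m * \<theta> m) = B * \<tau> / real m powr s0" by simp
      also have "\<dots> \<le> 1" using elim by (simp add: divide_le_eq)
      finally show ?case .
    qed
  qed
  from eventually_conj[OF ev1 eventually_conj[OF ev2 eventually_ge_at_top[of 1]]]
  obtain m0 where m0: "\<And>m. m0 \<le> m \<Longrightarrow> 1 / 4 ^ (a * (r * m + 1)) \<le> \<theta> m \<and> B * (X m * \<theta> m) \<le> 1 \<and> 1 \<le> m"
    unfolding eventually_sequentially by blast
  have large: "2 * r \<le> card (D_set \<alpha> s c (N m))" if m: "m0 \<le> m" and \<alpha>: "\<alpha> \<in> A m" for m \<alpha>
    unfolding N_def
  proof (rule card_D_set_ge_of_stages)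
    fix j assume j: "j \<in> {1..r}"
    have "1 / 4 ^ (a * (r * m + j)) \<le> 1 / (4 :: real) ^ (a * (r * m + 1))"
      using j by (intro divide_left_mono power_increasing mult_le_mono2) auto
    then have "1 / 4 ^ (a * (r * m + j)) \<le> \<theta> m" using m0[OF m] by linarith
    then have "stage i (r * m + j) (\<theta> m) \<subseteq> sub_hits i (a * (r * m + j)) (2 * \<theta> m)"
      unfolding a_def using j by (intro stage_subset_sub_hits) auto
    then show "\<alpha> \<in> sub_hits i (growth TYPE('n) * (r * m + j)) (2 * \<theta> m)"
      using \<alpha> j unfolding A_def a_def by blast
  next
    show "real CARD('n) ^ CARD('n) * (2 * \<theta> m)
      \<le> c / (ln (real (block_bound TYPE('n) r m)) * ln (ln (real (block_bound TYPE('n) r m))) powr s)"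
      using threshold[of m] m0[OF m] by (simp add: d_def N_def)
  qed
  have gridA: "grid_set (level TYPE('n) (r * m + r)) (A m)" for m
    unfolding A_def by (intro grid_set_INT grid_set_refine[OF grid_set_stage] level_mono) auto
  have A_sets: "A m \<in> sets borel" for m by (rule grid_set_sets[OF gridA])
  define E where "E m = real r * C * (real m / 2 ^ m)" for m
  have "(\<lambda>m. real m / 2 ^ m) \<in> O(\<lambda>m. 1 / real m ^ 2)" by real_asymp
  then have "summable (\<lambda>m. real m / 2 ^ m)"
  proof (rule summable_comparison_test_bigo[rotated])
    show "summable (\<lambda>m. norm (1 / real m ^ 2))"
      using inverse_power_summable[of 2, where 'a = real] by (simp add: inverse_eq_divide)
  qed
  then have sumE: "summable E" unfolding E_def by (rule summable_mult)
  have E0: "0 \<le> E m" for m unfolding E_def C_def by (intro mult_nonneg_nonneg) auto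
  have null: "tor.prob (\<Inter>m\<in>{m1..}. - A m) = 0" if m1: "m0 \<le> m1" for m1
  proof -
    \<comment> \<open>The event that none of the blocks from \<open>m1\<close> on has been successful so far.\<close>
    define S where "S M = (\<Inter>m\<in>{m1..<M}. - A m)" for M
    have gridS: "grid_set (level TYPE('n) (r * M)) (S M)" for M
      unfolding S_def
    proof (intro grid_set_INT grid_set_Compl)
      fix m assume "m \<in> {m1..<M}"
      then have "r * (m + 1) \<le> r * M" by (intro mult_le_mono2) auto
      then have "r * m + r \<le> r * M" by simp
      from grid_set_refine[OF gridA level_mono[OF this]]
      show "grid_set (level TYPE('n) (r * M)) (A m)" .
    qed simp
    have S_sets: "S M \<in> sets borel" for M by (rule grid_set_sets[OF gridS])
    have rec: "tor.prob (S (Suc M)) \<le> tor.prob (S M) - \<kappa>0 ^ r / real M * tor.prob (S M) + E M" if M: "m1 \<le> M" for M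
    proof -
      have mM: "m0 \<le> M" using m1 M by simp
      note cond = m0[OF mM]
      have XM: "2 ^ (a * (r * M + r)) * \<theta> M = X M * \<theta> M" by (simp add: X_def block_size_def a_def)
      have small: "4 * (1024 * 3 ^ CARD('n))\<^sup>2 * (2 ^ (a * (r * M + r)) * \<theta> M) \<le> 1"
        using cond unfolding XM B_def by blast
      have "2 ^ (a * (r * M + 1)) * \<theta> M / 16 = \<kappa>0 / real M powr s0"
        by (simp add: \<theta>_def \<kappa>0_def Xm power_add distrib_left)
      moreover have "(\<kappa>0 / real M powr s0) ^ r = \<kappa>0 ^ r / real M"
      proof -
        have "(real M powr s0) ^ r = real M powr (s0 * real r)"
          using cond by (simp add: powr_powr flip: powr_realpow)
        then show ?thesis using s0(2) by (simp add: power_divide)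
      qed
      ultimately have "\<kappa>0 ^ r / real M * tor.prob (S M) - (\<Sum>j=1..r. stage_error TYPE('n) (r * M + j))
        \<le> tor.prob (S M \<inter> A M)"
        using prob_stages_ge[OF gridS[of M], where r = r and \<theta> = "\<theta> M" and i = i] small cond unfolding a_def A_def by simp
      moreover have "(\<Sum>j=1..r. stage_error TYPE('n) (r * M + j)) \<le> E M"
        using sum_stage_error_le[of M r, where 'n = 'n] cond r by (simp add: E_def C_def)
      moreover have "S (Suc M) = S M - (S M \<inter> A M)"
        using M by (auto simp: S_def atLeastLessThanSuc)
      then have "tor.prob (S (Suc M)) = tor.prob (S M) - tor.prob (S M \<inter> A M)"
        using S_sets A_sets by (simp only:) (rule tor.finite_measure_Diff, auto)
      ultimately show ?thesis by linarith
    qed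
    have "tor.prob (\<Inter>m\<in>{m1..}. - A m) \<le> 0 + \<epsilon>" if \<epsilon>: "0 < \<epsilon>" for \<epsilon>
    proof -
      obtain M where "tor.prob (S M) < \<epsilon>"
        using divergent_recursion_small[of "\<lambda>M. tor.prob (S M)" "\<kappa>0 ^ r" E m1 \<epsilon>] rec \<kappa>0 sumE E0 \<epsilon> by auto
      moreover have "tor.prob (\<Inter>m\<in>{m1..}. - A m) \<le> tor.prob (S M)"
        using S_sets by (intro tor.finite_measure_mono) (auto simp: S_def)
      ultimately show ?thesis by linarith
    qed
    then have "tor.prob (\<Inter>m\<in>{m1..}. - A m) \<le> 0" by (rule field_le_epsilon)
    then show ?thesis by (simp add: order_antisym)
  qed
  have "AE \<alpha> in tor. m0 \<le> m1 \<longrightarrow> \<alpha> \<notin> (\<Inter>m\<in>{m1..}. - A m)" for m1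
  proof (cases "m0 \<le> m1")
    case True
    have "(\<Inter>m\<in>{m1..}. - A m) \<in> sets borel"
      using A_sets by (intro sets.countable_INT') auto
    then have "(\<Inter>m\<in>{m1..}. - A m) \<in> null_sets tor"
      using null[OF True] by (simp add: null_sets_def tor.emeasure_eq_measure)
    from AE_not_in[OF this] show ?thesis by simp
  qed simp
  then have "AE \<alpha> in tor. \<forall>m1. m0 \<le> m1 \<longrightarrow> \<alpha> \<notin> (\<Inter>m\<in>{m1..}. - A m)"
    by (simp only: AE_all_countable) simp
  then show ?thesis
  proof (rule AE_mp, intro AE_I2 impI)
    fix \<alpha> :: "real ^ 'n"
    assume *: "\<forall>m1. m0 \<le> m1 \<longrightarrow> \<alpha> \<notin> (\<Inter>m\<in>{m1..}. - A m)"
    show "infinite {N. 2 * r \<le> card (D_set \<alpha> s c N)}"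
      unfolding infinite_nat_iff_unbounded_le
    proof
      fix n
      have "m0 \<le> max m0 n" by simp
      with * obtain m where "max m0 n \<le> m" "\<alpha> \<in> A m" by fastforce
      then show "\<exists>k\<ge>n. k \<in> {N. 2 * r \<le> card (D_set \<alpha> s c N)}"
        using large[of m \<alpha>] N_ge[of m] by (intro exI[of _ "N m"]) auto
    qed
  qed
qed

lemma D_set_mono:
  assumes "c \<le> c'"
  shows "D_set \<alpha> s c N \<subseteq> D_set \<alpha> s c' N"
proof -
  have "0 \<le> ln (real N)" by (cases N) auto
  then have "c / (ln (real N) * ln (ln (real N)) powr s) \<le> c' / (ln (real N) * ln (ln (real N)) powr s)"
    using assms by (intro divide_right_mono) auto
  then show ?thesis unfolding D_set_def by (blast intro: order_trans)
qed

lemma AE_approximable: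
  assumes r: "1 \<le> r" and s: "s \<le> 1 / real r"
  shows "AE \<alpha> in (tor :: (real ^ 'n) measure). approximable r s \<alpha>"
proof -
  have "AE \<alpha> in (tor :: (real ^ 'n) measure). \<forall>j::nat. infinite {N. 2 * r \<le> card (D_set \<alpha> s (1 / real (Suc j)) N)}"
    unfolding AE_all_countable by (intro allI AE_infinitely_many_large_D_set[OF _ r s]) simp
  then show ?thesis
  proof (rule AE_mp, intro AE_I2 impI)
    fix \<alpha> :: "real ^ 'n"
    assume *: "\<forall>j::nat. infinite {N. 2 * r \<le> card (D_set \<alpha> s (1 / real (Suc j)) N)}"
    show "approximable r s \<alpha>"
      unfolding approximable_def
    proof (intro allI impI)
      fix c :: real assume "0 < c"
      then obtain j :: nat where j: "1 / real (Suc j) < c" using nat_approx_posE by blast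
      have "{N. 2 * r \<le> card (D_set \<alpha> s (1 / real (Suc j)) N)} \<subseteq> {N. 2 * r \<le> card (D_set \<alpha> s c N)}"
        using j by (auto intro!: D_set_mono elim!: order_trans[OF _ card_mono[OF finite_D_set]])
      then show "infinite {N. 2 * r \<le> card (D_set \<alpha> s c N)}" using * finite_subset by blast
    qed
  qed
qed

theorem theorem9p2:
  fixes r :: nat and s :: real
  assumes "r \<ge> 1" and "s \<ge> 0"
  shows "(s \<le> 1 / real r \<longrightarrow>
            (AE \<alpha> in (torus :: (real ^ 'n) measure). approximable r s \<alpha>)) \<and>
         (s > 1 / real r \<longrightarrow>
            {\<alpha> \<in> space (torus :: (real ^ 'n) measure). approximable r s \<alpha>}
              \<in> null_sets (torus :: (real ^ 'n) measure))"
  using AE_torus[OF AE_approximable] null_sets_torus[OF AE_torus[OF AE_not_approximable]] assms(1)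
  by blast

end
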